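(* Let $p$ be fixed with $0 < p < 1-(1/2)^{1/40}$ $(\approx 0.017179)$ and let $Q \sim Q_2(n,p)$. Then with high probability $\mathbb{Z}/2\mathbb{Z}$ (the fundamental group of the projective plane) is a free factor of $\pi_1(Q)$, i.e. $\pi_1(Q) \cong (\mathbb{Z}/2\mathbb{Z}) * H$ for some group $H$.
   Context: $Q^n=[0,1]^n$ is the $n$-dimensional cube with its standard cubical (face) structure, with vertex set $\{0,1\}^n$; $Q^n_k$ denotes its $k$-skeleton. The random $2$-dimensional cubical complex $Q_2(n,p)$ has $1$-skeleton equal to $Q^n_1$, and each $2$-dimensional face of $Q^n$ is included independently with probability $p$. "With high probability" means with probability tending to $1$ as $n \to \infty$. *)

theory Defs
  imports "HOL-Probability.Probability" "HOL-Algebra.Elementary_Groups"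
begin

section \<open>The cube and its random two-dimensional subcomplexes\<close>

text \<open>
  Since \<open>n\<close> tends to infinity, Euclidean \<open>n\<close>-space is realised inside \<^typ>\<open>nat \<Rightarrow> real\<close> (with the
  product topology) as the functions that vanish outside \<open>{..<n}\<close>, as in \<^const>\<open>Euclidean_space\<close>.

  A face of the cube is determined by the set \<open>S\<close> of its free coordinates and the set \<open>V\<close> of
  those fixed coordinates whose value is \<open>1\<close>; all other coordinates are \<open>0\<close>.
\<close>

definition cube_face :: "nat set \<Rightarrow> nat set \<Rightarrow> (nat \<Rightarrow> real) set" where
  "cube_face S V = {x. \<forall>i. if i \<in> S then 0 \<le> x i \<and> x i \<le> 1 else x i = of_bool (i \<in> V)}"

definition cube_faces :: "nat \<Rightarrow> nat \<Rightarrow> (nat \<Rightarrow> real) set set" where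
  "cube_faces n k = {cube_face S V | S V. S \<subseteq> {..<n} \<and> card S = k \<and> V \<subseteq> {..<n} - S}"

lemma finite_cube_faces: "finite (cube_faces n k)"
proof (rule finite_subset)
  show "cube_faces n k \<subseteq> (\<lambda>(S, V). cube_face S V) ` (Pow {..<n} \<times> Pow {..<n})"
    unfolding cube_faces_def by auto
qed simp

text \<open>
  A subcomplex is given as the set of its (closed) faces; its underlying space is the union of
  that set. The default value \<^const>\<open>False\<close> only concerns sets that are not two-dimensional faces.
\<close>

definition random_cubical_complex :: "nat \<Rightarrow> real \<Rightarrow> (nat \<Rightarrow> real) set set pmf" where
  "random_cubical_complex n p =
     map_pmf (\<lambda>X. cube_faces n 0 \<union> cube_faces n 1 \<union> {f \<in> cube_faces n 2. X f})
       (Pi_pmf (cube_faces n 2) False (\<lambda>_. bernoulli_pmf p))"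


section \<open>The fundamental group\<close>

definition loops_at :: "'a::topological_space set \<Rightarrow> 'a \<Rightarrow> (real \<Rightarrow> 'a) set" where
  "loops_at S a = {p. path p \<and> path_image p \<subseteq> S \<and> pathstart p = a \<and> pathfinish p = a}"

definition loop_rel :: "'a::topological_space set \<Rightarrow> 'a \<Rightarrow> ((real \<Rightarrow> 'a) \<times> (real \<Rightarrow> 'a)) set" where
  "loop_rel S a = {(p, q). p \<in> loops_at S a \<and> q \<in> loops_at S a \<and> homotopic_paths S p q}"

definition fundamental_group ::
    "'a::topological_space set \<Rightarrow> 'a \<Rightarrow> (real \<Rightarrow> 'a) set monoid" where
  "fundamental_group S a =
     \<lparr>carrier = loops_at S a // loop_rel S a,
      monoid.mult = (\<lambda>A B. \<Union>p\<in>A. \<Union>q\<in>B. loop_rel S a `` {p +++ q}),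
      one = loop_rel S a `` {\<lambda>_. a}\<rparr>"

lemma equiv_loop_rel: "equiv (loops_at S a) (loop_rel S a)"
  by (rule equivI)
     (auto simp: loop_rel_def loops_at_def refl_on_def sym_def trans_def
           intro: homotopic_paths_sym homotopic_paths_trans)

lemma loops_at_join: "p \<in> loops_at S a \<Longrightarrow> q \<in> loops_at S a \<Longrightarrow> p +++ q \<in> loops_at S a"
  by (auto simp: loops_at_def subset_path_image_join)

lemma loops_at_const: "a \<in> S \<Longrightarrow> (\<lambda>_. a) \<in> loops_at S a"
  by (auto simp: loops_at_def path_def path_image_def pathstart_def pathfinish_def)

lemma homotopic_paths_const_join:
  assumes "path p" "path_image p \<subseteq> S"
  shows "homotopic_paths S ((\<lambda>_. pathstart p) +++ p) p"
proof (rule homotopic_paths_sym, rule homotopic_paths_reparametrize[OF assms])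
  let ?f = "\<lambda>t::real. max 0 (2 * t - 1)"
  show "continuous_on {0..1} ?f" by (intro continuous_intros)
  show "?f \<in> {0..1} \<rightarrow> {0..1}" by auto
  show "?f 0 = 0" "?f 1 = 1" by auto
  show "((\<lambda>_. pathstart p) +++ p) t = p (?f t)" if "t \<in> {0..1}" for t
  proof (cases "t = 1/2")
    case True
    then show ?thesis by (simp add: joinpaths_def pathstart_def)
  next
    case False
    with that show ?thesis by (auto simp: joinpaths_def pathstart_def max_def)
  qed
qed

lemma homotopic_paths_reverse_join:
  assumes "path p" "path_image p \<subseteq> S"
  shows "homotopic_paths S (reversepath p +++ p) (\<lambda>_. pathfinish p)"
proof -
  let ?g = "\<lambda>(s::real, t::real). max s \<bar>2 * t - 1\<bar>"
  let ?h = "p \<circ> ?g"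
  have g: "?g ` ({0..1} \<times> {0..1}) \<subseteq> {0..1}" by auto
  have "continuous_on ({0..1} \<times> {0..1}) ?g"
    unfolding split_beta by (intro continuous_intros)
  then have "continuous_on ({0..1} \<times> {0..1}) ?h"
    using assms(1) g unfolding path_def
    by (intro continuous_on_compose) (auto intro: continuous_on_subset)
  moreover have "?h \<in> {0..1} \<times> {0..1} \<rightarrow> S"
    using assms(2) g by (auto simp: path_image_def image_subset_iff)
  ultimately show ?thesis
    unfolding homotopic_paths
    by (intro exI[of _ ?h])
       (auto simp: joinpaths_def reversepath_def pathstart_def pathfinish_def max_def abs_if
             algebra_simps)
qed

lemma loop_rel_class_eq_iff:
  "\<lbrakk>p \<in> loops_at S a; q \<in> loops_at S a\<rbrakk> \<Longrightarrow>
     loop_rel S a `` {p} = loop_rel S a `` {q} \<longleftrightarrow> homotopic_paths S p q"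
  using eq_equiv_class_iff[OF equiv_loop_rel] by (fastforce simp: loop_rel_def)

lemma fundamental_group_mult:
  assumes "p \<in> loops_at S a" "q \<in> loops_at S a"
  shows "loop_rel S a `` {p} \<otimes>\<^bsub>fundamental_group S a\<^esub> loop_rel S a `` {q} =
         loop_rel S a `` {p +++ q}"
proof -
  have "congruent2 (loop_rel S a) (loop_rel S a) (\<lambda>p q. loop_rel S a `` {p +++ q})"
  proof (rule congruent2I'[rule_format])
    fix p p' q q' assume "(p, p') \<in> loop_rel S a" "(q, q') \<in> loop_rel S a"
    then show "loop_rel S a `` {p +++ q} = loop_rel S a `` {p' +++ q'}"
      by (subst loop_rel_class_eq_iff)
         (auto simp: loop_rel_def intro!: loops_at_join homotopic_paths_join, auto simp: loops_at_def)
  qed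
  from UN_equiv_class2[OF equiv_loop_rel equiv_loop_rel this assms] show ?thesis
    by (simp add: fundamental_group_def)
qed

lemma group_fundamental_group:
  assumes "a \<in> S"
  shows "group (fundamental_group S a)"
proof (rule groupI)
  let ?G = "fundamental_group S a" and ?c = "\<lambda>p. loop_rel S a `` {p}"
  have car: "carrier ?G = ?c ` loops_at S a" and one: "\<one>\<^bsub>?G\<^esub> = ?c (\<lambda>_. a)"
    by (auto simp: fundamental_group_def quotient_def)
  show "x \<otimes>\<^bsub>?G\<^esub> y \<in> carrier ?G" if "x \<in> carrier ?G" "y \<in> carrier ?G" for x y
    using that by (auto simp: car fundamental_group_mult loops_at_join)
  show "\<one>\<^bsub>?G\<^esub> \<in> carrier ?G"
    using loops_at_const[OF assms] by (auto simp: car one)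
  show "x \<otimes>\<^bsub>?G\<^esub> y \<otimes>\<^bsub>?G\<^esub> z = x \<otimes>\<^bsub>?G\<^esub> (y \<otimes>\<^bsub>?G\<^esub> z)"
    if xyz: "x \<in> carrier ?G" "y \<in> carrier ?G" "z \<in> carrier ?G" for x y z
  proof -
    obtain p q r where pqr: "p \<in> loops_at S a" "q \<in> loops_at S a" "r \<in> loops_at S a"
      and x: "x = ?c p" "y = ?c q" "z = ?c r" using xyz unfolding car by blast
    then have "homotopic_paths S ((p +++ q) +++ r) (p +++ (q +++ r))"
      by (intro homotopic_paths_sym[OF homotopic_paths_assoc]) (auto simp: loops_at_def)
    with pqr show ?thesis
      by (simp add: x fundamental_group_mult loops_at_join loop_rel_class_eq_iff)
  qed
  show "\<one>\<^bsub>?G\<^esub> \<otimes>\<^bsub>?G\<^esub> x = x" if "x \<in> carrier ?G" for x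
  proof -
    obtain p where p: "p \<in> loops_at S a" "x = ?c p" using \<open>x \<in> carrier ?G\<close> unfolding car by blast
    then have "homotopic_paths S ((\<lambda>_. a) +++ p) p"
      using homotopic_paths_const_join[of p S] by (auto simp: loops_at_def)
    with p show ?thesis
      by (simp add: one fundamental_group_mult loops_at_join loops_at_const assms loop_rel_class_eq_iff)
  qed
  show "\<exists>y\<in>carrier ?G. y \<otimes>\<^bsub>?G\<^esub> x = \<one>\<^bsub>?G\<^esub>" if "x \<in> carrier ?G" for x
  proof -
    obtain p where p: "p \<in> loops_at S a" "x = ?c p" using \<open>x \<in> carrier ?G\<close> unfolding car by blast
    then have r: "reversepath p \<in> loops_at S a" by (auto simp: loops_at_def)
    have "homotopic_paths S (reversepath p +++ p) (\<lambda>_. a)"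
      using p homotopic_paths_reverse_join[of p S] by (auto simp: loops_at_def)
    with p r have "?c (reversepath p) \<otimes>\<^bsub>?G\<^esub> x = \<one>\<^bsub>?G\<^esub>"
      by (simp add: one fundamental_group_mult loops_at_join loops_at_const assms loop_rel_class_eq_iff)
    with r show ?thesis unfolding car by blast
  qed
qed


section \<open>The free product of two groups\<close>

text \<open>
  Words in the disjoint union of the carriers, modulo the equivalence relation generated by
  deleting a letter that is a unit and by multiplying two adjacent letters from the same factor.
\<close>

abbreviation free_product_words ::
    "('a, 'c) monoid_scheme \<Rightarrow> ('b, 'd) monoid_scheme \<Rightarrow> ('a + 'b) list set" where
  "free_product_words G H \<equiv> lists (carrier G <+> carrier H)"

inductive free_product_step ::
    "('a, 'c) monoid_scheme \<Rightarrow> ('b, 'd) monoid_scheme \<Rightarrow> ('a + 'b) list \<Rightarrow> ('a + 'b) list \<Rightarrow> bool"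
  for G H where
    one_left: "\<lbrakk>u \<in> free_product_words G H; v \<in> free_product_words G H\<rbrakk>
      \<Longrightarrow> free_product_step G H (u @ [Inl \<one>\<^bsub>G\<^esub>] @ v) (u @ v)"
  | one_right: "\<lbrakk>u \<in> free_product_words G H; v \<in> free_product_words G H\<rbrakk>
      \<Longrightarrow> free_product_step G H (u @ [Inr \<one>\<^bsub>H\<^esub>] @ v) (u @ v)"
  | mult_left: "\<lbrakk>u \<in> free_product_words G H; v \<in> free_product_words G H; x \<in> carrier G; y \<in> carrier G\<rbrakk>
      \<Longrightarrow> free_product_step G H (u @ [Inl x, Inl y] @ v) (u @ [Inl (x \<otimes>\<^bsub>G\<^esub> y)] @ v)"
  | mult_right: "\<lbrakk>u \<in> free_product_words G H; v \<in> free_product_words G H; x \<in> carrier H; y \<in> carrier H\<rbrakk>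
      \<Longrightarrow> free_product_step G H (u @ [Inr x, Inr y] @ v) (u @ [Inr (x \<otimes>\<^bsub>H\<^esub> y)] @ v)"

definition free_product_rel ::
    "('a, 'c) monoid_scheme \<Rightarrow> ('b, 'd) monoid_scheme \<Rightarrow> (('a + 'b) list \<times> ('a + 'b) list) set" where
  "free_product_rel G H =
     {(u, v). u \<in> free_product_words G H \<and> v \<in> free_product_words G H \<and>
              equivclp (free_product_step G H) u v}"

definition free_product ::
    "('a, 'c) monoid_scheme \<Rightarrow> ('b, 'd) monoid_scheme \<Rightarrow> ('a + 'b) list set monoid" where
  "free_product G H =
     \<lparr>carrier = free_product_words G H // free_product_rel G H,
      monoid.mult = (\<lambda>A B. \<Union>u\<in>A. \<Union>v\<in>B. free_product_rel G H `` {u @ v}),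
      one = free_product_rel G H `` {[]}\<rparr>"

lemma equiv_free_product_rel: "equiv (free_product_words G H) (free_product_rel G H)"
  by (rule equivI)
     (auto simp: free_product_rel_def refl_on_def sym_def trans_def
           intro: equivclp_sym equivclp_trans)

lemma free_product_step_append:
  assumes "free_product_step G H u v" "w \<in> free_product_words G H" "z \<in> free_product_words G H"
  shows "free_product_step G H (w @ u @ z) (w @ v @ z)"
  using assms(1)
proof cases
  case (one_left u' v')
  with assms show ?thesis using free_product_step.one_left[of "w @ u'" G H "v' @ z"] by simp
next
  case (one_right u' v')
  with assms show ?thesis using free_product_step.one_right[of "w @ u'" G H "v' @ z"] by simp
next
  case (mult_left u' v' x y)
  with assms show ?thesis using free_product_step.mult_left[of "w @ u'" G H "v' @ z" x y] by simp
next
  case (mult_right u' v' x y)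
  with assms show ?thesis using free_product_step.mult_right[of "w @ u'" G H "v' @ z" x y] by simp
qed

lemma free_product_equiv_append:
  assumes "equivclp (free_product_step G H) u v"
    and "w \<in> free_product_words G H" "z \<in> free_product_words G H"
  shows "equivclp (free_product_step G H) (w @ u @ z) (w @ v @ z)"
  using assms(1)
proof (induction rule: equivclp_induct)
  case (step y y')
  then have "equivclp (free_product_step G H) (w @ y @ z) (w @ y' @ z)"
    using free_product_step_append[OF _ assms(2,3)] by (blast intro: r_into_equivclp equivclp_sym)
  with step.IH show ?case by (rule equivclp_trans)
qed simp

lemma free_product_class_eq_iff:
  "\<lbrakk>u \<in> free_product_words G H; v \<in> free_product_words G H\<rbrakk> \<Longrightarrow>
     free_product_rel G H `` {u} = free_product_rel G H `` {v} \<longleftrightarrow>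
     equivclp (free_product_step G H) u v"
  using eq_equiv_class_iff[OF equiv_free_product_rel, of u G H v] by (simp add: free_product_rel_def)

lemma free_product_mult:
  assumes "u \<in> free_product_words G H" "v \<in> free_product_words G H"
  shows "free_product_rel G H `` {u} \<otimes>\<^bsub>free_product G H\<^esub> free_product_rel G H `` {v} =
         free_product_rel G H `` {u @ v}"
proof -
  have "congruent2 (free_product_rel G H) (free_product_rel G H)
          (\<lambda>u v. free_product_rel G H `` {u @ v})"
  proof (rule congruent2I'[rule_format])
    fix u u' v v' assume "(u, u') \<in> free_product_rel G H" "(v, v') \<in> free_product_rel G H"
    then have W: "u \<in> free_product_words G H" "u' \<in> free_product_words G H"
        "v \<in> free_product_words G H" "v' \<in> free_product_words G H"
      and E: "equivclp (free_product_step G H) u u'" "equivclp (free_product_step G H) v v'"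
      by (auto simp: free_product_rel_def)
    have 1: "equivclp (free_product_step G H) (u @ v) (u' @ v)"
      using free_product_equiv_append[OF E(1), of "[]" v] W by simp
    have 2: "equivclp (free_product_step G H) (u' @ v) (u' @ v')"
      using free_product_equiv_append[OF E(2), of u' "[]"] W by simp
    show "free_product_rel G H `` {u @ v} = free_product_rel G H `` {u' @ v'}"
      using W equivclp_trans[OF 1 2] by (simp add: free_product_class_eq_iff)
  qed
  from UN_equiv_class2[OF equiv_free_product_rel equiv_free_product_rel this assms] show ?thesis
    by (simp add: free_product_def)
qed

lemma free_product_letter_inverse:
  assumes "group G" "group H" "l \<in> carrier G <+> carrier H"
  shows "\<exists>m \<in> carrier G <+> carrier H. equivclp (free_product_step G H) [m, l] []"
proof -
  interpret G: group G by fact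
  interpret H: group H by fact
  from assms(3) show ?thesis
  proof
    fix x assume x: "x \<in> carrier G" "l = Inl x"
    have "free_product_step G H [Inl (inv\<^bsub>G\<^esub> x), Inl x] [Inl \<one>\<^bsub>G\<^esub>]"
      using free_product_step.mult_left[of "[]" G H "[]" "inv\<^bsub>G\<^esub> x" x] x by simp
    moreover have "free_product_step G H [Inl \<one>\<^bsub>G\<^esub>] []"
      using free_product_step.one_left[of "[]" G H "[]"] by simp
    ultimately have "equivclp (free_product_step G H) [Inl (inv\<^bsub>G\<^esub> x), l] []"
      unfolding x(2) by (blast intro: equivclp_trans)
    then show ?thesis using x by blast
  next
    fix x assume x: "x \<in> carrier H" "l = Inr x"
    have "free_product_step G H [Inr (inv\<^bsub>H\<^esub> x), Inr x] [Inr \<one>\<^bsub>H\<^esub>]"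
      using free_product_step.mult_right[of "[]" G H "[]" "inv\<^bsub>H\<^esub> x" x] x by simp
    moreover have "free_product_step G H [Inr \<one>\<^bsub>H\<^esub>] []"
      using free_product_step.one_right[of "[]" G H "[]"] by simp
    ultimately have "equivclp (free_product_step G H) [Inr (inv\<^bsub>H\<^esub> x), l] []"
      unfolding x(2) by (blast intro: equivclp_trans)
    then show ?thesis using x by blast
  qed
qed

lemma free_product_word_inverse:
  assumes "group G" "group H" "w \<in> free_product_words G H"
  shows "\<exists>z \<in> free_product_words G H. equivclp (free_product_step G H) (z @ w) []"
  using assms(3)
proof (induction w rule: lists.induct)
  case Nil
  show ?case by (rule bexI[of _ "[]"]) auto
next
  case (Cons l w)
  obtain z where z: "z \<in> free_product_words G H" "equivclp (free_product_step G H) (z @ w) []"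
    using Cons by blast
  obtain m where m: "m \<in> carrier G <+> carrier H" "equivclp (free_product_step G H) [m, l] []"
    using free_product_letter_inverse[OF assms(1,2) Cons.hyps(1)] by blast
  have "equivclp (free_product_step G H) ((z @ [m]) @ l # w) (z @ w)"
    using free_product_equiv_append[OF m(2) z(1) Cons.hyps(2)] by simp
  then have "equivclp (free_product_step G H) ((z @ [m]) @ l # w) []"
    using z(2) by (rule equivclp_trans)
  moreover have "z @ [m] \<in> free_product_words G H" using z m by auto
  ultimately show ?case by blast
qed

lemma group_free_product:
  assumes "group G" "group H"
  shows "group (free_product G H)"
proof (rule groupI)
  let ?F = "free_product G H" and ?c = "\<lambda>u. free_product_rel G H `` {u}"
  have car: "carrier ?F = ?c ` free_product_words G H" and one: "\<one>\<^bsub>?F\<^esub> = ?c []"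
    by (auto simp: free_product_def quotient_def)
  show "x \<otimes>\<^bsub>?F\<^esub> y \<in> carrier ?F" if "x \<in> carrier ?F" "y \<in> carrier ?F" for x y
  proof -
    from that obtain u v where uv: "u \<in> free_product_words G H" "v \<in> free_product_words G H"
      "x = ?c u" "y = ?c v" unfolding car by blast
    then have "u @ v \<in> free_product_words G H" by simp
    with uv show ?thesis unfolding car by (simp only: free_product_mult) blast
  qed
  show "\<one>\<^bsub>?F\<^esub> \<in> carrier ?F"
    unfolding car one by blast
  show "x \<otimes>\<^bsub>?F\<^esub> y \<otimes>\<^bsub>?F\<^esub> z = x \<otimes>\<^bsub>?F\<^esub> (y \<otimes>\<^bsub>?F\<^esub> z)"
    if "x \<in> carrier ?F" "y \<in> carrier ?F" "z \<in> carrier ?F" for x y z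
  proof -
    from that obtain u v w where w: "u \<in> free_product_words G H" "v \<in> free_product_words G H"
      "w \<in> free_product_words G H" "x = ?c u" "y = ?c v" "z = ?c w" unfolding car by blast
    then have "u @ v \<in> free_product_words G H" "v @ w \<in> free_product_words G H" by simp_all
    with w show ?thesis by (simp only: free_product_mult append_assoc)
  qed
  show "\<one>\<^bsub>?F\<^esub> \<otimes>\<^bsub>?F\<^esub> x = x" if "x \<in> carrier ?F" for x
  proof -
    from that obtain u where "u \<in> free_product_words G H" "x = ?c u" unfolding car by blast
    then show ?thesis unfolding one by (simp only: free_product_mult lists.Nil append_Nil)
  qed
  show "\<exists>y\<in>carrier ?F. y \<otimes>\<^bsub>?F\<^esub> x = \<one>\<^bsub>?F\<^esub>" if "x \<in> carrier ?F" for x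
  proof -
    obtain w where w: "w \<in> free_product_words G H" "x = ?c w"
      using \<open>x \<in> carrier ?F\<close> unfolding car by blast
    obtain z where z: "z \<in> free_product_words G H" "equivclp (free_product_step G H) (z @ w) []"
      using free_product_word_inverse[OF assms w(1)] by blast
    have "?c z \<otimes>\<^bsub>?F\<^esub> x = \<one>\<^bsub>?F\<^esub>"
      unfolding one w(2) free_product_mult[OF z(1) w(1)]
      using z w by (subst free_product_class_eq_iff) auto
    with z(1) show ?thesis unfolding car by blast
  qed
qed

text \<open>
  In \<open>G \<cong> K * H\<close> the complementary factor \<open>H\<close> embeds into \<open>G\<close>, so that requiring its elements to
  be of the same type as those of \<open>G\<close> is no restriction.
\<close>

definition free_factor :: "'a monoid \<Rightarrow> 'b monoid \<Rightarrow> bool" where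
  "free_factor K G \<longleftrightarrow> (\<exists>H :: 'b monoid. group H \<and> G \<cong> free_product K H)"

end

theory Submission
  imports Defs
begin

text \<open>
  The projective plane is the union of twenty squares of the five-dimensional cube, with forty edges
  and twenty-one vertices (\<open>rp2_faces\<close>). A copy of it in \<open>Q\<close> is isolated if \<open>Q\<close> has no further
  square that contains one of the forty edges. At most \<open>40 * n\<close> squares contain one of these edges, so
  a given copy is isolated in \<open>Q\<close> with probability at least \<open>p ^ 20 * (1 - p) ^ (40 * n)\<close>. There are
  \<open>2 ^ (n - 6)\<close> parallel copies whose isolation is decided by pairwise disjoint sets of squares
  (\<open>touching_faces_disjoint\<close>), and \<open>2 * (1 - p) ^ 40 > 1\<close>; hence with high probability one of them is
  isolated.

  Let \<open>A\<close> be an isolated copy, and let \<open>B\<close> consist of a spanning tree of the edges of \<open>A\<close> and of all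
  faces of \<open>Q\<close> outside \<open>A\<close>. Then \<open>Q\<close> is the union of \<open>A\<close> and \<open>B\<close>, the two meet in the tree only,
  and \<open>B\<close> is connected. By van Kampen's theorem the fundamental group of \<open>Q\<close> is the free product of
  that of \<open>A\<close>, which is cyclic of order 2, and that of \<open>B\<close>.

  The form of van Kampen's theorem proved here, \<open>fundamental_group_free_product\<close>, rests on the open
  stars of the vertices. A face that meets the star of a vertex contains the vertex. Therefore a
  function with values in a group \<open>\<Gamma>\<close>, defined on the pairs of vertices of a common face and
  multiplicative on each face, is a Cech cocycle for the cover by the stars. Collecting its values
  along a path gives the holonomy of the path in \<open>\<Gamma>\<close>, which depends on the homotopy class only
  (\<open>hol_homotopic\<close>). For \<open>\<Gamma>\<close> the free product of \<open>\<int>/2\<close> and the fundamental group of \<open>B\<close>, one takes as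
  cocycle the class of the segment from \<open>u\<close> to \<open>v\<close> if the common face is in \<open>B\<close>, and an explicit
  \<open>\<int>/2\<close>-valued cocycle of the projective plane (\<open>rp2_cocycle\<close>) if it is in \<open>A\<close>. The universal
  property of the free product gives a homomorphism back, and \<open>path_class_transport\<close> shows that it
  undoes the holonomy. No separate computation of the fundamental group of \<open>A\<close> is made: it enters
  through the cocycle, which provides a homomorphism onto \<open>\<int>/2\<close>, and through \<open>rp2_labels\<close>, by which
  the relations of the twenty squares leave no more than \<open>\<int>/2\<close>.
\<close>


section \<open>The universal property of the free product\<close>

abbreviation free_product_inl ::
    "('a, 'c) monoid_scheme \<Rightarrow> ('b, 'd) monoid_scheme \<Rightarrow> 'a \<Rightarrow> ('a + 'b) list set" where
  "free_product_inl G H x \<equiv> free_product_rel G H `` {[Inl x]}"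

abbreviation free_product_inr ::
    "('a, 'c) monoid_scheme \<Rightarrow> ('b, 'd) monoid_scheme \<Rightarrow> 'b \<Rightarrow> ('a + 'b) list set" where
  "free_product_inr G H y \<equiv> free_product_rel G H `` {[Inr y]}"

lemma carrier_free_product:
  "carrier (free_product G H) = (\<lambda>u. free_product_rel G H `` {u}) ` free_product_words G H"
  by (auto simp: free_product_def quotient_def)

lemma one_free_product: "\<one>\<^bsub>free_product G H\<^esub> = free_product_rel G H `` {[]}"
  by (simp add: free_product_def)

lemma free_product_inl_hom:
  assumes "group G" "group H"
  shows "free_product_inl G H \<in> hom G (free_product G H)"
proof (rule homI)
  show "free_product_inl G H x \<in> carrier (free_product G H)" if "x \<in> carrier G" for x
    using that by (auto simp: carrier_free_product)
  fix x y assume xy: "x \<in> carrier G" "y \<in> carrier G"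
  interpret G: group G by fact
  have "free_product_step G H [Inl x, Inl y] [Inl (x \<otimes>\<^bsub>G\<^esub> y)]"
    using free_product_step.mult_left[of "[]" G H "[]" x y] xy by simp
  then have "free_product_rel G H `` {[Inl x, Inl y]} = free_product_inl G H (x \<otimes>\<^bsub>G\<^esub> y)"
    using xy by (subst free_product_class_eq_iff) auto
  then show "free_product_inl G H (x \<otimes>\<^bsub>G\<^esub> y) =
      free_product_inl G H x \<otimes>\<^bsub>free_product G H\<^esub> free_product_inl G H y"
    using xy by (subst free_product_mult) auto
qed

lemma free_product_inr_hom:
  assumes "group G" "group H"
  shows "free_product_inr G H \<in> hom H (free_product G H)"
proof (rule homI)
  show "free_product_inr G H x \<in> carrier (free_product G H)" if "x \<in> carrier H" for x
    using that by (auto simp: carrier_free_product)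
  fix x y assume xy: "x \<in> carrier H" "y \<in> carrier H"
  interpret H: group H by fact
  have "free_product_step G H [Inr x, Inr y] [Inr (x \<otimes>\<^bsub>H\<^esub> y)]"
    using free_product_step.mult_right[of "[]" G H "[]" x y] xy by simp
  then have "free_product_rel G H `` {[Inr x, Inr y]} = free_product_inr G H (x \<otimes>\<^bsub>H\<^esub> y)"
    using xy by (subst free_product_class_eq_iff) auto
  then show "free_product_inr G H (x \<otimes>\<^bsub>H\<^esub> y) =
      free_product_inr G H x \<otimes>\<^bsub>free_product G H\<^esub> free_product_inr G H y"
    using xy by (subst free_product_mult) auto
qed

lemma free_product_generated:
  assumes "group G" "group H" "subgroup J (free_product G H)"
    and "\<And>x. x \<in> carrier G \<Longrightarrow> free_product_inl G H x \<in> J"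
    and "\<And>y. y \<in> carrier H \<Longrightarrow> free_product_inr G H y \<in> J"
  shows "carrier (free_product G H) \<subseteq> J"
proof -
  interpret J: subgroup J "free_product G H" by fact
  have "free_product_rel G H `` {w} \<in> J" if "w \<in> free_product_words G H" for w
    using that
  proof (induction w rule: lists.induct)
    case Nil
    then show ?case using J.one_closed by (simp add: one_free_product)
  next
    case (Cons l w)
    have "free_product_rel G H `` {[l]} \<in> J"
      using Cons.hyps(1) assms(4,5) by auto
    then have "free_product_rel G H `` {[l]} \<otimes>\<^bsub>free_product G H\<^esub> free_product_rel G H `` {w} \<in> J"
      using Cons.IH by (rule J.m_closed)
    then show ?case
      using Cons.hyps by (subst (asm) free_product_mult) auto
  qed
  then show ?thesis by (auto simp: carrier_free_product)
qed

definition free_product_eval ::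
    "('k, 'e) monoid_scheme \<Rightarrow> ('a \<Rightarrow> 'k) \<Rightarrow> ('b \<Rightarrow> 'k) \<Rightarrow> ('a + 'b) list \<Rightarrow> 'k" where
  "free_product_eval K f g w = foldr (\<lambda>l z. case_sum f g l \<otimes>\<^bsub>K\<^esub> z) w \<one>\<^bsub>K\<^esub>"

context
  fixes G :: "('a, 'c) monoid_scheme" and H :: "('b, 'd) monoid_scheme"
    and K :: "('k, 'e) monoid_scheme" and f :: "'a \<Rightarrow> 'k" and g :: "'b \<Rightarrow> 'k"
  assumes groups: "group G" "group H" "group K"
    and f: "f \<in> hom G K" and g: "g \<in> hom H K"
begin

interpretation G: group G by (fact groups)
interpretation H: group H by (fact groups)
interpretation K: group K by (fact groups)
interpretation f: group_hom G K f by unfold_locales (fact f)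
interpretation g: group_hom H K g by unfold_locales (fact g)

lemma free_product_eval_closed:
  "w \<in> free_product_words G H \<Longrightarrow> free_product_eval K f g w \<in> carrier K"
  by (induction w rule: lists.induct) (auto simp: free_product_eval_def)

lemma free_product_eval_append:
  assumes "v \<in> free_product_words G H"
  shows "w \<in> free_product_words G H \<Longrightarrow>
     free_product_eval K f g (w @ v) = free_product_eval K f g w \<otimes>\<^bsub>K\<^esub> free_product_eval K f g v"
proof (induction w rule: lists.induct)
  case Nil
  then show ?case using free_product_eval_closed[OF assms] by (simp add: free_product_eval_def)
next
  case (Cons l w)
  have "case_sum f g l \<in> carrier K" using Cons.hyps by auto
  moreover have "free_product_eval K f g (l # u) = case_sum f g l \<otimes>\<^bsub>K\<^esub> free_product_eval K f g u" for u
    by (simp add: free_product_eval_def)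
  ultimately show ?case
    using Cons free_product_eval_closed[OF assms] free_product_eval_closed[OF Cons.hyps(2)]
    by (simp add: K.m_assoc)
qed

lemma free_product_eval_step:
  assumes "free_product_step G H u v"
  shows "free_product_eval K f g u = free_product_eval K f g v"
proof -
  have *: "free_product_eval K f g u = free_product_eval K f g v"
    if "u = a @ m @ b" "v = a @ m' @ b" "a \<in> free_product_words G H" "b \<in> free_product_words G H"
      "m \<in> free_product_words G H" "m' \<in> free_product_words G H"
      "free_product_eval K f g m = free_product_eval K f g m'" for a b m m'
    using that by (simp add: free_product_eval_append)
  from assms show ?thesis
  proof cases
    case (one_left a b)
    then show ?thesis by (intro *[of a "[Inl \<one>\<^bsub>G\<^esub>]" b "[]"]) (auto simp: free_product_eval_def)
  next
    case (one_right a b)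
    then show ?thesis by (intro *[of a "[Inr \<one>\<^bsub>H\<^esub>]" b "[]"]) (auto simp: free_product_eval_def)
  next
    case (mult_left a b x y)
    then show ?thesis
      by (intro *[of a "[Inl x, Inl y]" b "[Inl (x \<otimes>\<^bsub>G\<^esub> y)]"]) (auto simp: free_product_eval_def)
  next
    case (mult_right a b x y)
    then show ?thesis
      by (intro *[of a "[Inr x, Inr y]" b "[Inr (x \<otimes>\<^bsub>H\<^esub> y)]"]) (auto simp: free_product_eval_def)
  qed
qed

lemma free_product_eval_equivclp:
  "equivclp (free_product_step G H) u v \<Longrightarrow> free_product_eval K f g u = free_product_eval K f g v"
  by (induction rule: equivclp_induct) (auto dest: free_product_eval_step)

text \<open>
  The value of a word does not change under the steps that generate the equivalence of words, because
  \<open>f\<close> and \<open>g\<close> are homomorphisms.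
\<close>

lemma free_product_universal:
  obtains \<psi> where "\<psi> \<in> hom (free_product G H) K"
    "\<And>x. x \<in> carrier G \<Longrightarrow> \<psi> (free_product_inl G H x) = f x"
    "\<And>y. y \<in> carrier H \<Longrightarrow> \<psi> (free_product_inr G H y) = g y"
proof -
  define \<psi> where "\<psi> C = free_product_eval K f g (SOME w. w \<in> C)" for C
  have \<psi>: "\<psi> (free_product_rel G H `` {w}) = free_product_eval K f g w"
    if "w \<in> free_product_words G H" for w
  proof -
    have "w \<in> free_product_rel G H `` {w}"
      using that by (auto simp: free_product_rel_def)
    then have "(w, SOME w'. w' \<in> free_product_rel G H `` {w}) \<in> free_product_rel G H"
      by (metis Image_singleton_iff someI)
    then have "equivclp (free_product_step G H) w (SOME w'. w' \<in> free_product_rel G H `` {w})"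
      unfolding free_product_rel_def by blast
    then show ?thesis
      unfolding \<psi>_def by (rule free_product_eval_equivclp[symmetric])
  qed
  show thesis
  proof
    show "\<psi> \<in> hom (free_product G H) K"
    proof (rule homI)
      fix x assume "x \<in> carrier (free_product G H)"
      then obtain u where "u \<in> free_product_words G H" "x = free_product_rel G H `` {u}"
        unfolding carrier_free_product by blast
      then show "\<psi> x \<in> carrier K"
        using \<psi> free_product_eval_closed by metis
    next
      fix x y assume "x \<in> carrier (free_product G H)" "y \<in> carrier (free_product G H)"
      then obtain u v where uv: "u \<in> free_product_words G H" "v \<in> free_product_words G H"
        "x = free_product_rel G H `` {u}" "y = free_product_rel G H `` {v}"
        unfolding carrier_free_product by blast
      then have "u @ v \<in> free_product_words G H" by simp
      then show "\<psi> (x \<otimes>\<^bsub>free_product G H\<^esub> y) = \<psi> x \<otimes>\<^bsub>K\<^esub> \<psi> y"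
        using uv by (simp only: free_product_mult \<psi> free_product_eval_append)
    qed
    show "\<psi> (free_product_inl G H x) = f x" if "x \<in> carrier G" for x
      using that by (subst \<psi>) (auto simp: free_product_eval_def)
    show "\<psi> (free_product_inr G H y) = g y" if "y \<in> carrier H" for y
      using that by (subst \<psi>) (auto simp: free_product_eval_def)
  qed
qed

end


section \<open>Straight segments in a function space\<close>

text \<open>
  The spaces in question are sets of functions with the product topology. Convexity is used only
  through these straight paths.
\<close>

definition segment_path :: "('i \<Rightarrow> real) \<Rightarrow> ('i \<Rightarrow> real) \<Rightarrow> real \<Rightarrow> 'i \<Rightarrow> real" where
  "segment_path x y t = (\<lambda>i. (1 - t) * x i + t * y i)"

definition segment_convex :: "('i \<Rightarrow> real) set \<Rightarrow> bool" where
  "segment_convex S \<longleftrightarrow> (\<forall>x\<in>S. \<forall>y\<in>S. \<forall>t\<in>{0..1}. segment_path x y t \<in> S)"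

lemma segment_path_0 [simp]: "segment_path x y 0 = x"
  and segment_path_1 [simp]: "segment_path x y 1 = y"
  by (auto simp: segment_path_def)

lemma continuous_on_segment_path [continuous_intros]:
  assumes "continuous_on A f" "continuous_on A g" "continuous_on A h"
  shows "continuous_on A (\<lambda>z. segment_path (f z) (g z) (h z))"
  unfolding segment_path_def
  by (intro continuous_on_coordinatewise_then_product continuous_intros
      continuous_on_product_then_coordinatewise[OF assms(1)]
      continuous_on_product_then_coordinatewise[OF assms(2)] assms(3))

lemma path_segment_path [simp]: "path (segment_path x y)"
  unfolding path_def
  by (rule continuous_on_segment_path[OF continuous_on_const continuous_on_const continuous_on_id])

lemma pathstart_segment_path [simp]: "pathstart (segment_path x y) = x"
  and pathfinish_segment_path [simp]: "pathfinish (segment_path x y) = y"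
  by (auto simp: pathstart_def pathfinish_def)

lemma path_image_segment_path:
  "\<lbrakk>segment_convex S; x \<in> S; y \<in> S\<rbrakk> \<Longrightarrow> path_image (segment_path x y) \<subseteq> S"
  by (auto simp: path_image_def segment_convex_def)

lemma homotopic_paths_segment_convex:
  assumes "segment_convex C" "C \<subseteq> S" "path p" "path q" "path_image p \<subseteq> C" "path_image q \<subseteq> C"
    and "pathstart p = pathstart q" "pathfinish p = pathfinish q"
  shows "homotopic_paths S p q"
proof -
  let ?h = "\<lambda>z. segment_path (p (snd z)) (q (snd z)) (fst z)"
  have eq: "segment_path x x t = x" for x :: "'a \<Rightarrow> real" and t
    by (auto simp: segment_path_def fun_eq_iff algebra_simps)
  have "continuous_on ({0..1} \<times> {0..1}) ?h"
  proof (rule continuous_on_segment_path)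
    show "continuous_on ({0..1} \<times> {0..1}) (fst :: real \<times> real \<Rightarrow> real)"
      by (rule continuous_on_fst[OF continuous_on_id])
    show "continuous_on ({0..1} \<times> {0..1}) (\<lambda>z. p (snd z))"
      using assms(3) unfolding path_def
      by (rule continuous_on_compose2[OF _ continuous_on_snd[OF continuous_on_id]]) auto
    show "continuous_on ({0..1} \<times> {0..1}) (\<lambda>z. q (snd z))"
      using assms(4) unfolding path_def
      by (rule continuous_on_compose2[OF _ continuous_on_snd[OF continuous_on_id]]) auto
  qed
  moreover have "?h \<in> {0..1} \<times> {0..1} \<rightarrow> S"
  proof
    fix z :: "real \<times> real" assume z: "z \<in> {0..1} \<times> {0..1}"
    then have "p (snd z) \<in> C" "q (snd z) \<in> C" "fst z \<in> {0..1}"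
      using assms(5,6) by (auto simp: path_image_def)
    then have "?h z \<in> C" using assms(1) unfolding segment_convex_def by blast
    then show "?h z \<in> S" using assms(2) by blast
  qed
  ultimately show ?thesis
    unfolding homotopic_paths
    using assms(7,8) by (intro exI[of _ ?h]) (auto simp: pathstart_def pathfinish_def eq)
qed

text \<open>
  The map that sends \<open>(\<theta>, \<rho>)\<close> to \<open>segment_path z (p \<theta>) \<rho>\<close> takes the unit square into \<open>S\<close>. Its
  restriction to the top edge is \<open>p\<close>, to the bottom edge constant, and to the vertical edges a segment
  between \<open>z\<close> and an end of \<open>p\<close>. In the square, the top edge is homotopic to the other three.
\<close>

lemma homotopic_paths_star:
  assumes p: "path p" "pathstart p = x" "pathfinish p = y"
    and star: "\<And>t s. \<lbrakk>t \<in> {0..1}; s \<in> {0..1}\<rbrakk> \<Longrightarrow> segment_path z (p t) s \<in> S"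
  shows "homotopic_paths S (segment_path x z +++ (\<lambda>_. z) +++ segment_path z y) p"
proof -
  let ?M = "\<lambda>w::real \<times> real. segment_path z (p (fst w)) (snd w)"
  let ?Q = "{0..1::real} \<times> {0..1::real}"
  let ?r = "linepath (0,1) (0,0) +++ linepath (0,0) (1,0) +++ linepath (1,0) (1::real,1::real)"
  let ?s = "linepath (0,1) (1::real,1::real)"
  have convQ: "convex ?Q" by (intro convex_Times) auto
  have cont: "continuous_on ?Q ?M"
  proof (rule continuous_on_segment_path)
    show "continuous_on ?Q snd" by (rule continuous_on_snd[OF continuous_on_id])
    show "continuous_on ?Q (\<lambda>_. z)" by (rule continuous_on_const)
    show "continuous_on ?Q (\<lambda>w. p (fst w))"
      using p(1) unfolding path_def
      by (rule continuous_on_compose2[OF _ continuous_on_fst[OF continuous_on_id]]) auto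
  qed
  have img: "path_image (linepath a b) \<subseteq> ?Q" if "a \<in> ?Q" "b \<in> ?Q" for a b
    unfolding path_image_linepath using that convQ by (rule closed_segment_subset)
  have "simply_connected ?Q"
    using convQ by (rule convex_imp_simply_connected)
  moreover have "path_image ?r \<subseteq> ?Q" "path_image ?s \<subseteq> ?Q"
    by (intro subset_path_image_join img; simp)+
  ultimately have "homotopic_paths ?Q ?r ?s"
    unfolding simply_connected_eq_homotopic_paths by simp
  then have "homotopic_paths S (?M \<circ> ?r) (?M \<circ> ?s)"
    by (rule homotopic_paths_continuous_image[OF _ cont]) (auto intro: star)
  moreover have "?M \<circ> ?s = p"
    by (auto simp: fun_eq_iff linepath_def algebra_simps)
  moreover have "?M \<circ> ?r = segment_path x z +++ (\<lambda>_. z) +++ segment_path z y"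
  proof -
    have "?M \<circ> linepath (0,1) (0,0) = segment_path x z"
      using p(2) by (auto simp: fun_eq_iff linepath_def segment_path_def algebra_simps pathstart_def)
    moreover have "?M \<circ> linepath (0,0) (1,0) = (\<lambda>_. z)"
      by (auto simp: fun_eq_iff linepath_def segment_path_def algebra_simps)
    moreover have "?M \<circ> linepath (1,0) (1,1) = segment_path z y"
      using p(3) by (auto simp: fun_eq_iff linepath_def segment_path_def algebra_simps pathfinish_def)
    ultimately show ?thesis by (simp only: path_compose_join)
  qed
  ultimately show ?thesis by simp
qed


section \<open>Classes of paths relative to a system of base paths\<close>

lemma homotopic_paths_join_const:
  assumes "path p" "path_image p \<subseteq> S"
  shows "homotopic_paths S (p +++ (\<lambda>_. pathfinish p)) p"
proof -
  have "homotopic_paths S ((\<lambda>_. pathstart (reversepath p)) +++ reversepath p) (reversepath p)"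
    using assms by (intro homotopic_paths_const_join) auto
  then have "homotopic_paths S (reversepath ((\<lambda>_. pathstart (reversepath p)) +++ reversepath p)) p"
    using homotopic_paths_reversepath[of S _ "reversepath p"] by simp
  moreover have "reversepath ((\<lambda>_. pathfinish p) +++ reversepath p) = p +++ reversepath (\<lambda>_. pathfinish p)"
    by (subst reversepath_joinpaths) (auto simp: pathfinish_def pathstart_def reversepath_def)
  moreover have "reversepath (\<lambda>_. pathfinish p) = (\<lambda>_. pathfinish p)"
    by (simp add: reversepath_def)
  ultimately show ?thesis by simp
qed

lemma homotopic_paths_join_left:
  assumes "path p" "path_image p \<subseteq> S" "homotopic_paths S q q'" "pathfinish p = pathstart q"
  shows "homotopic_paths S (p +++ q) (p +++ q')"
  using assms by (intro homotopic_paths_join) auto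

lemma carrier_fundamental_group:
  "carrier (fundamental_group S a) = (\<lambda>p. loop_rel S a `` {p}) ` loops_at S a"
  by (auto simp: fundamental_group_def quotient_def)

text \<open>
  All homomorphisms defined on a fundamental group below arise in this way: a change of base point,
  an inclusion, and a holonomy.
\<close>

lemma fundamental_group_induced_hom:
  assumes closed: "\<And>p. p \<in> loops_at S a \<Longrightarrow> F p \<in> carrier G"
    and homotopic: "\<And>p q. \<lbrakk>p \<in> loops_at S a; q \<in> loops_at S a; homotopic_paths S p q\<rbrakk> \<Longrightarrow> F p = F q"
    and join: "\<And>p q. \<lbrakk>p \<in> loops_at S a; q \<in> loops_at S a\<rbrakk> \<Longrightarrow> F (p +++ q) = F p \<otimes>\<^bsub>G\<^esub> F q"
  obtains f where "f \<in> hom (fundamental_group S a) G"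
    "\<And>p. p \<in> loops_at S a \<Longrightarrow> f (loop_rel S a `` {p}) = F p"
proof -
  define f where "f C = F (SOME p. p \<in> C)" for C
  have f: "f (loop_rel S a `` {p}) = F p" if p: "p \<in> loops_at S a" for p
  proof -
    have "p \<in> loop_rel S a `` {p}"
      using p by (auto simp: loop_rel_def loops_at_def)
    then have "(SOME q. q \<in> loop_rel S a `` {p}) \<in> loop_rel S a `` {p}"
      by (rule someI[of "\<lambda>q. q \<in> loop_rel S a `` {p}"])
    then have "(SOME q. q \<in> loop_rel S a `` {p}) \<in> loops_at S a"
      "homotopic_paths S p (SOME q. q \<in> loop_rel S a `` {p})"
      unfolding loop_rel_def by blast+
    with p show ?thesis unfolding f_def by (intro homotopic[symmetric])
  qed
  have "f \<in> hom (fundamental_group S a) G"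
    by (rule homI)
      (auto simp: carrier_fundamental_group f closed join fundamental_group_mult loops_at_join)
  with f show thesis by (rule that[rotated])
qed

text \<open>
  Once a path from the base point to every other point is chosen, each path closes up to a loop. The
  class of this loop is multiplicative, so that calculations with paths between arbitrary points can
  be carried out in the fundamental group.
\<close>

definition base_paths :: "'a::topological_space set \<Rightarrow> 'a \<Rightarrow> ('a \<Rightarrow> real \<Rightarrow> 'a) \<Rightarrow> bool" where
  "base_paths S a \<tau> \<longleftrightarrow>
     (\<forall>y\<in>S. path (\<tau> y) \<and> path_image (\<tau> y) \<subseteq> S \<and> pathstart (\<tau> y) = a \<and> pathfinish (\<tau> y) = y)"

definition path_class ::
    "'a::topological_space set \<Rightarrow> 'a \<Rightarrow> ('a \<Rightarrow> real \<Rightarrow> 'a) \<Rightarrow> (real \<Rightarrow> 'a) \<Rightarrow> (real \<Rightarrow> 'a) set" where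
  "path_class S a \<tau> p =
     loop_rel S a `` {\<tau> (pathstart p) +++ p +++ reversepath (\<tau> (pathfinish p))}"

lemma base_pathsD:
  assumes "base_paths S a \<tau>" "y \<in> S"
  shows "path (\<tau> y)" "path_image (\<tau> y) \<subseteq> S" "pathstart (\<tau> y) = a" "pathfinish (\<tau> y) = y"
  using assms by (auto simp: base_paths_def)

lemma pathstart_in: "path_image p \<subseteq> S \<Longrightarrow> pathstart p \<in> S"
  and pathfinish_in: "path_image p \<subseteq> S \<Longrightarrow> pathfinish p \<in> S"
  by auto

context
  fixes S :: "'a::topological_space set" and a \<tau>
  assumes \<tau>: "base_paths S a \<tau>"
begin

lemma path_class_loop:
  assumes "path p" "path_image p \<subseteq> S"
  shows "\<tau> (pathstart p) +++ p +++ reversepath (\<tau> (pathfinish p)) \<in> loops_at S a"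
  using assms base_pathsD[OF \<tau> pathstart_in[OF assms(2)]] base_pathsD[OF \<tau> pathfinish_in[OF assms(2)]]
  by (simp add: loops_at_def subset_path_image_join)

lemma path_class_closed:
  "\<lbrakk>path p; path_image p \<subseteq> S\<rbrakk> \<Longrightarrow> path_class S a \<tau> p \<in> carrier (fundamental_group S a)"
  using path_class_loop by (auto simp: path_class_def fundamental_group_def quotient_def)

lemma path_class_cong:
  assumes "homotopic_paths S p q"
  shows "path_class S a \<tau> p = path_class S a \<tau> q"
proof -
  have pq: "path p" "path q" "path_image p \<subseteq> S" "path_image q \<subseteq> S"
    "pathstart p = pathstart q" "pathfinish p = pathfinish q"
    using assms homotopic_paths_imp_path homotopic_paths_imp_subset homotopic_paths_imp_pathstart
      homotopic_paths_imp_pathfinish by blast+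
  have "homotopic_paths S (\<tau> (pathstart p) +++ p +++ reversepath (\<tau> (pathfinish p)))
     (\<tau> (pathstart q) +++ q +++ reversepath (\<tau> (pathfinish q)))"
    using assms pq base_pathsD[OF \<tau> pathstart_in[OF pq(3)]] base_pathsD[OF \<tau> pathfinish_in[OF pq(3)]]
    by (intro homotopic_paths_join) (auto simp: pq(5,6)[symmetric])
  then show ?thesis
    unfolding path_class_def
    using path_class_loop[OF pq(1,3)] path_class_loop[OF pq(2,4)] by (simp add: loop_rel_class_eq_iff)
qed

text \<open>
  Composition with the base paths, traversed in the opposite direction, recovers the path.
\<close>

lemma homotopic_of_path_class_eq:
  assumes "path_class S a \<tau> p = path_class S a \<tau> q"
    and p: "path p" "path_image p \<subseteq> S" and q: "path q" "path_image q \<subseteq> S"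
    and ends: "pathstart p = pathstart q" "pathfinish p = pathfinish q"
  shows "homotopic_paths S p q"
proof -
  note \<sigma> = base_pathsD[OF \<tau> pathstart_in[OF p(2)]] and \<phi> = base_pathsD[OF \<tau> pathfinish_in[OF p(2)]]
  let ?s = "\<tau> (pathstart p)" and ?f = "\<tau> (pathfinish p)"
  have cancel: "homotopic_paths S (reversepath ?s +++ (?s +++ r +++ reversepath ?f) +++ ?f) r"
    if r: "path r" "path_image r \<subseteq> S" "pathstart r = pathstart p" "pathfinish r = pathfinish p" for r
  proof -
    have 1: "homotopic_paths S ((r +++ reversepath ?f) +++ ?f) r"
    proof -
      have "homotopic_paths S ((r +++ reversepath ?f) +++ ?f) (r +++ (reversepath ?f +++ ?f))"
        using \<sigma> \<phi> r by (intro homotopic_paths_sym[OF homotopic_paths_assoc]) auto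
      also have "homotopic_paths S \<dots> (r +++ (\<lambda>_. pathfinish ?f))"
        using \<sigma> \<phi> r by (intro homotopic_paths_join homotopic_paths_reverse_join) auto
      also have "homotopic_paths S \<dots> r"
        using homotopic_paths_join_const[of r S] r \<phi> by simp
      finally show ?thesis .
    qed
    have "homotopic_paths S ((?s +++ r +++ reversepath ?f) +++ ?f)
        (?s +++ ((r +++ reversepath ?f) +++ ?f))"
      using \<sigma> \<phi> r by (intro homotopic_paths_sym[OF homotopic_paths_assoc]) (auto simp: subset_path_image_join)
    also have "homotopic_paths S \<dots> (?s +++ r)"
      using \<sigma> \<phi> r by (intro homotopic_paths_join_left 1) auto
    finally have 2: "homotopic_paths S ((?s +++ r +++ reversepath ?f) +++ ?f) (?s +++ r)" .
    have "homotopic_paths S (reversepath ?s +++ (?s +++ r +++ reversepath ?f) +++ ?f)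
        (reversepath ?s +++ (?s +++ r))"
      using \<sigma> \<phi> r by (intro homotopic_paths_join_left 2) auto
    also have "homotopic_paths S \<dots> ((reversepath ?s +++ ?s) +++ r)"
      using \<sigma> \<phi> r by (intro homotopic_paths_assoc) auto
    also have "homotopic_paths S \<dots> ((\<lambda>_. pathfinish ?s) +++ r)"
      using \<sigma> \<phi> r by (intro homotopic_paths_join homotopic_paths_reverse_join) auto
    also have "homotopic_paths S \<dots> r"
      using homotopic_paths_const_join[of r S] r \<sigma> by simp
    finally show ?thesis .
  qed
  have E: "homotopic_paths S (?s +++ p +++ reversepath ?f) (?s +++ q +++ reversepath ?f)"
    using assms(1) loop_rel_class_eq_iff[OF path_class_loop[OF p] path_class_loop[OF q]]
    unfolding path_class_def ends by (rule_tac iffD1)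
  have "homotopic_paths S ((?s +++ p +++ reversepath ?f) +++ ?f) ((?s +++ q +++ reversepath ?f) +++ ?f)"
    using \<phi> by (intro homotopic_paths_join[OF E]) auto
  then have "homotopic_paths S (reversepath ?s +++ (?s +++ p +++ reversepath ?f) +++ ?f)
      (reversepath ?s +++ (?s +++ q +++ reversepath ?f) +++ ?f)"
    using \<sigma> by (rule_tac homotopic_paths_join_left) auto
  then have "homotopic_paths S (reversepath ?s +++ (?s +++ p +++ reversepath ?f) +++ ?f) q"
    using cancel[of q] q ends by (auto intro: homotopic_paths_trans)
  then show ?thesis
    using homotopic_paths_sym[OF cancel[of p]] p by (auto intro: homotopic_paths_trans)
qed

text \<open>
  The base path of the point where \<open>p\<close> and \<open>q\<close> meet occurs together with its reverse, and cancels.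
\<close>

lemma path_class_join:
  assumes p: "path p" "path_image p \<subseteq> S" and q: "path q" "path_image q \<subseteq> S"
    and pq: "pathfinish p = pathstart q"
  shows "path_class S a \<tau> (p +++ q) =
     path_class S a \<tau> p \<otimes>\<^bsub>fundamental_group S a\<^esub> path_class S a \<tau> q"
proof -
  note \<sigma> = base_pathsD[OF \<tau> pathstart_in[OF p(2)]] and \<mu> = base_pathsD[OF \<tau> pathstart_in[OF q(2)]]
    and \<phi> = base_pathsD[OF \<tau> pathfinish_in[OF q(2)]]
  let ?s = "\<tau> (pathstart p)" and ?m = "\<tau> (pathstart q)" and ?f = "\<tau> (pathfinish q)"
  have "homotopic_paths S (reversepath ?m +++ ?m +++ q +++ reversepath ?f)
      ((reversepath ?m +++ ?m) +++ q +++ reversepath ?f)"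
    using \<sigma> \<mu> \<phi> p q by (intro homotopic_paths_assoc) (auto simp: subset_path_image_join)
  also have "homotopic_paths S \<dots> ((\<lambda>_. pathfinish ?m) +++ q +++ reversepath ?f)"
    using \<sigma> \<mu> \<phi> p q by (intro homotopic_paths_join homotopic_paths_reverse_join)
      (auto simp: subset_path_image_join)
  also have "homotopic_paths S \<dots> (q +++ reversepath ?f)"
    using homotopic_paths_const_join[of "q +++ reversepath ?f" S] \<mu> \<phi> q
    by (simp add: subset_path_image_join)
  finally have 1: "homotopic_paths S (reversepath ?m +++ ?m +++ q +++ reversepath ?f)
     (q +++ reversepath ?f)" .
  have "homotopic_paths S ((?s +++ p +++ reversepath ?m) +++ (?m +++ q +++ reversepath ?f))
      (?s +++ (p +++ reversepath ?m) +++ (?m +++ q +++ reversepath ?f))"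
    using \<sigma> \<mu> \<phi> p q pq by (intro homotopic_paths_sym[OF homotopic_paths_assoc])
      (auto simp: subset_path_image_join)
  also have "homotopic_paths S \<dots> (?s +++ p +++ reversepath ?m +++ ?m +++ q +++ reversepath ?f)"
    using \<sigma> \<mu> \<phi> p q pq
    by (intro homotopic_paths_join homotopic_paths_sym[OF homotopic_paths_assoc])
      (auto simp: subset_path_image_join)
  also have "homotopic_paths S \<dots> (?s +++ p +++ q +++ reversepath ?f)"
    using \<sigma> \<mu> \<phi> p q pq by (intro homotopic_paths_join_left 1) auto
  also have "homotopic_paths S \<dots> (?s +++ (p +++ q) +++ reversepath ?f)"
    using \<sigma> \<mu> \<phi> p q pq by (intro homotopic_paths_join homotopic_paths_assoc)
      (auto simp: subset_path_image_join)
  finally have "homotopic_paths S ((?s +++ p +++ reversepath ?m) +++ (?m +++ q +++ reversepath ?f))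
     (?s +++ (p +++ q) +++ reversepath ?f)" .
  moreover note L = path_class_loop[OF p] path_class_loop[OF q]
  moreover have "?s +++ (p +++ q) +++ reversepath ?f \<in> loops_at S a"
    using path_class_loop[of "p +++ q"] p q pq by (simp add: subset_path_image_join)
  ultimately have "loop_rel S a `` {(?s +++ p +++ reversepath ?m) +++ (?m +++ q +++ reversepath ?f)} =
      loop_rel S a `` {?s +++ (p +++ q) +++ reversepath ?f}"
    using pq loops_at_join[OF L] by (subst loop_rel_class_eq_iff) simp_all
  then show ?thesis
    unfolding path_class_def fundamental_group_mult[OF L] by (simp add: pq)
qed

lemma path_class_const:
  assumes "y \<in> S"
  shows "path_class S a \<tau> (\<lambda>_. y) = \<one>\<^bsub>fundamental_group S a\<^esub>"
proof -
  note y = base_pathsD[OF \<tau> assms]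
  have "a \<in> S" using y by (metis pathstart_in)
  then interpret G: group "fundamental_group S a" by (rule group_fundamental_group)
  let ?c = "path_class S a \<tau> (\<lambda>_. y)"
  have c: "path (\<lambda>_. y)" "path_image (\<lambda>_. y) \<subseteq> S" "pathstart (\<lambda>_. y) = y" "pathfinish (\<lambda>_. y) = y"
    using assms by (auto simp: path_def path_image_def pathstart_def pathfinish_def)
  have "(\<lambda>_. y) +++ (\<lambda>_. y) = (\<lambda>_::real. y)" by (auto simp: joinpaths_def)
  then have "?c \<otimes>\<^bsub>fundamental_group S a\<^esub> ?c = ?c"
    using path_class_join[of "\<lambda>_. y" "\<lambda>_. y"] c by simp
  then show ?thesis using path_class_closed[OF c(1,2)] by (simp add: G.l_cancel_one')
qed

lemma path_class_of_loop:
  assumes "\<tau> a = (\<lambda>_. a)" "p \<in> loops_at S a"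
  shows "path_class S a \<tau> p = loop_rel S a `` {p}"
proof -
  have p: "path p" "path_image p \<subseteq> S" "pathstart p = a" "pathfinish p = a"
    using assms(2) by (auto simp: loops_at_def)
  then have "a \<in> S" by (metis pathstart_in)
  have r: "reversepath (\<lambda>_. a) = (\<lambda>_::real. a)" by (simp add: reversepath_def)
  have c: "path (\<lambda>_. a)" "path_image (\<lambda>_. a) \<subseteq> S" "pathstart (\<lambda>_. a) = a" "pathfinish (\<lambda>_. a) = a"
    using \<open>a \<in> S\<close> by (auto simp: path_def path_image_def pathstart_def pathfinish_def)
  have "homotopic_paths S ((\<lambda>_. a) +++ p +++ (\<lambda>_. a)) ((\<lambda>_. a) +++ p)"
    using homotopic_paths_join_const[OF p(1,2)] p c by (intro homotopic_paths_join) auto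
  also have "homotopic_paths S \<dots> p"
    using homotopic_paths_const_join[OF p(1,2)] p by simp
  finally have "homotopic_paths S ((\<lambda>_. a) +++ p +++ (\<lambda>_. a)) p" .
  then show ?thesis
    unfolding path_class_def
    using path_class_loop[OF p(1,2)] assms p
    by (subst loop_rel_class_eq_iff) (auto simp: r)
qed

lemma path_class_base_path:
  assumes "\<tau> a = (\<lambda>_. a)" "y \<in> S"
  shows "path_class S a \<tau> (\<tau> y) = \<one>\<^bsub>fundamental_group S a\<^esub>"
proof -
  note y = base_pathsD[OF \<tau> assms(2)]
  have "a \<in> S" using y by (metis pathstart_in)
  have c: "path (\<lambda>_. a)" "path_image (\<lambda>_. a) \<subseteq> S" "pathstart (\<lambda>_. a) = a" "pathfinish (\<lambda>_. a) = a"
    using \<open>a \<in> S\<close> by (auto simp: path_def path_image_def pathstart_def pathfinish_def)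
  have "homotopic_paths S ((\<lambda>_. a) +++ (\<tau> y +++ reversepath (\<tau> y))) (\<tau> y +++ reversepath (\<tau> y))"
    using homotopic_paths_const_join[of "\<tau> y +++ reversepath (\<tau> y)" S] y
    by (simp add: subset_path_image_join)
  also have "homotopic_paths S \<dots> (\<lambda>_. a)"
    using homotopic_paths_reverse_join[of "reversepath (\<tau> y)" S] y by simp
  finally show ?thesis
    unfolding path_class_def
    using path_class_loop[OF y(1,2)] assms y loops_at_const[OF \<open>a \<in> S\<close>]
    by (simp add: loop_rel_class_eq_iff fundamental_group_def)
qed

end

text \<open>
  The isomorphism closes up loops at \<open>b\<close> by the base path of \<open>b\<close>.
\<close>

lemma fundamental_group_base_change:
  assumes \<tau>: "base_paths S a \<tau>" "\<tau> a = (\<lambda>_. a)" and b: "b \<in> S"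
  shows "fundamental_group S b \<cong> fundamental_group S a"
proof -
  have "a \<in> S" using base_pathsD[OF \<tau>(1) b] by (metis pathstart_in)
  obtain h where hom: "h \<in> hom (fundamental_group S b) (fundamental_group S a)"
    and h: "\<And>p. p \<in> loops_at S b \<Longrightarrow> h (loop_rel S b `` {p}) = path_class S a \<tau> p"
  proof (rule fundamental_group_induced_hom[of S b "path_class S a \<tau>" "fundamental_group S a"])
    show "path_class S a \<tau> p \<in> carrier (fundamental_group S a)" if "p \<in> loops_at S b" for p
      using that by (intro path_class_closed[OF \<tau>(1)]) (auto simp: loops_at_def)
    show "path_class S a \<tau> p = path_class S a \<tau> q" if "homotopic_paths S p q" for p q
      using that by (rule path_class_cong[OF \<tau>(1)])
    show "path_class S a \<tau> (p +++ q) =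
       path_class S a \<tau> p \<otimes>\<^bsub>fundamental_group S a\<^esub> path_class S a \<tau> q"
      if "p \<in> loops_at S b" "q \<in> loops_at S b" for p q
      using that by (intro path_class_join[OF \<tau>(1)]) (auto simp: loops_at_def)
  qed (rule that)
  have "bij_betw h (carrier (fundamental_group S b)) (carrier (fundamental_group S a))"
  proof (intro bij_betwI')
    fix x y assume "x \<in> carrier (fundamental_group S b)" "y \<in> carrier (fundamental_group S b)"
    then obtain p q where pq: "p \<in> loops_at S b" "x = loop_rel S b `` {p}"
      "q \<in> loops_at S b" "y = loop_rel S b `` {q}" by (auto simp: carrier_fundamental_group)
    then have "path_class S a \<tau> p = path_class S a \<tau> q \<longleftrightarrow> homotopic_paths S p q"
      using homotopic_of_path_class_eq[OF \<tau>(1), of p q] path_class_cong[OF \<tau>(1), of p q]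
      by (auto simp: loops_at_def)
    with pq show "h x = h y \<longleftrightarrow> x = y"
      by (simp add: h loop_rel_class_eq_iff)
  next
    fix x assume "x \<in> carrier (fundamental_group S b)"
    then show "h x \<in> carrier (fundamental_group S a)"
      using hom by (auto simp: hom_def)
  next
    fix y assume "y \<in> carrier (fundamental_group S a)"
    then obtain p where p: "p \<in> loops_at S a" "y = loop_rel S a `` {p}" by (auto simp: carrier_fundamental_group)
    let ?b = "\<tau> b"
    note B = base_pathsD[OF \<tau>(1) b]
    have p': "path p" "path_image p \<subseteq> S" "pathstart p = a" "pathfinish p = a"
      using p by (auto simp: loops_at_def)
    let ?G = "fundamental_group S a" and ?c = "path_class S a \<tau>"
    interpret G: group ?G using \<open>a \<in> S\<close> by (rule group_fundamental_group)
    have 1: "?c ?b = \<one>\<^bsub>?G\<^esub>" by (rule path_class_base_path[OF \<tau> b])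
    have "?c (reversepath ?b) \<otimes>\<^bsub>?G\<^esub> ?c ?b = ?c (reversepath ?b +++ ?b)"
      using B by (intro path_class_join[OF \<tau>(1), symmetric]) auto
    also have "\<dots> = ?c (\<lambda>_. b)"
      using homotopic_paths_reverse_join[OF B(1,2)] B by (intro path_class_cong[OF \<tau>(1)]) simp
    also have "\<dots> = \<one>\<^bsub>?G\<^esub>" using b by (rule path_class_const[OF \<tau>(1)])
    finally have 2: "?c (reversepath ?b) = \<one>\<^bsub>?G\<^esub>"
      using 1 path_class_closed[OF \<tau>(1), of "reversepath ?b"] B by simp
    have q: "reversepath ?b +++ p +++ ?b \<in> loops_at S b"
      using B p' by (auto simp: loops_at_def subset_path_image_join)
    have "?c (p +++ ?b) = ?c p \<otimes>\<^bsub>?G\<^esub> ?c ?b"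
      using B p' by (intro path_class_join[OF \<tau>(1)]) auto
    moreover have "?c (reversepath ?b +++ p +++ ?b) = ?c (reversepath ?b) \<otimes>\<^bsub>?G\<^esub> ?c (p +++ ?b)"
      using B p' by (intro path_class_join[OF \<tau>(1)]) (auto simp: subset_path_image_join)
    ultimately have "?c (reversepath ?b +++ p +++ ?b) = ?c p"
      using 1 2 path_class_closed[OF \<tau>(1) p'(1,2)] by simp
    then have "y = h (loop_rel S b `` {reversepath ?b +++ p +++ ?b})"
      using h[OF q] p(2) path_class_of_loop[OF \<tau> p(1)] by simp
    then show "\<exists>x\<in>carrier (fundamental_group S b). y = h x"
      using q unfolding carrier_fundamental_group by (rule_tac bexI[OF _ imageI])
  qed
  with hom have "h \<in> iso (fundamental_group S b) (fundamental_group S a)" by (intro isoI)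
  then show ?thesis by (rule is_isoI)
qed

lemma fundamental_group_inclusion:
  assumes "S \<subseteq> T" "a \<in> S"
  obtains \<iota> where "\<iota> \<in> hom (fundamental_group S a) (fundamental_group T a)"
    "\<And>p. p \<in> loops_at S a \<Longrightarrow> \<iota> (loop_rel S a `` {p}) = loop_rel T a `` {p}"
proof (rule fundamental_group_induced_hom[of S a "\<lambda>p. loop_rel T a `` {p}" "fundamental_group T a"])
  have T: "p \<in> loops_at T a" if "p \<in> loops_at S a" for p
    using that assms(1) by (auto simp: loops_at_def)
  show "loop_rel T a `` {p} \<in> carrier (fundamental_group T a)" if "p \<in> loops_at S a" for p
    using T[OF that] by (auto simp: carrier_fundamental_group)
  show "loop_rel T a `` {p} = loop_rel T a `` {q}"
    if "p \<in> loops_at S a" "q \<in> loops_at S a" "homotopic_paths S p q" for p q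
    using T that assms(1) by (simp add: loop_rel_class_eq_iff homotopic_paths_subset)
  show "loop_rel T a `` {p +++ q} =
      loop_rel T a `` {p} \<otimes>\<^bsub>fundamental_group T a\<^esub> loop_rel T a `` {q}"
    if "p \<in> loops_at S a" "q \<in> loops_at S a" for p q
    using T that by (simp add: fundamental_group_mult)
qed (rule that)

text \<open>
  Both sides are images of paths in the interval, where paths with the same ends are homotopic.
\<close>

lemma homotopic_paths_split_at:
  fixes p :: "real \<Rightarrow> 'a::topological_space"
  assumes "path p" "path_image p \<subseteq> S" "0 \<le> s" "s \<le> t" "t \<le> r" "r \<le> 1"
  shows "homotopic_paths S ((p \<circ> linepath s t) +++ (p \<circ> linepath t r)) (p \<circ> linepath s r)"
proof -
  have "path_image (linepath s t) \<subseteq> {0..1}" "path_image (linepath t r) \<subseteq> {0..1}"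
    "path_image (linepath s r) \<subseteq> {0..1}"
    using assms(3-6) by (auto simp: closed_segment_eq_real_ivl)
  then have "homotopic_paths {0..1} (linepath s t +++ linepath t r) (linepath s r)"
    using convex_imp_simply_connected[of "{0..1::real}"]
    by (simp add: simply_connected_eq_homotopic_paths subset_path_image_join)
  then have "homotopic_paths S (p \<circ> (linepath s t +++ linepath t r)) (p \<circ> linepath s r)"
    by (rule homotopic_paths_continuous_image)
      (use assms(1,2) in \<open>auto simp: path_def path_image_def\<close>)
  then show ?thesis by (simp add: path_compose_join)
qed

lemma path_restrict:
  fixes p :: "real \<Rightarrow> 'a::topological_space"
  assumes "path p" "0 \<le> s" "s \<le> t" "t \<le> 1"
  shows "path (p \<circ> linepath s t)" "path_image (p \<circ> linepath s t) = p ` {s..t}"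
    "pathstart (p \<circ> linepath s t) = p s" "pathfinish (p \<circ> linepath s t) = p t"
proof -
  have "continuous_on (path_image (linepath s t)) p"
    using assms by (intro continuous_on_subset[OF assms(1)[unfolded path_def]])
      (auto simp: closed_segment_eq_real_ivl)
  then show "path (p \<circ> linepath s t)" by (intro path_continuous_image) simp_all
  show "path_image (p \<circ> linepath s t) = p ` {s..t}"
    using assms by (simp add: path_image_compose closed_segment_eq_real_ivl)
qed (simp_all add: pathstart_def pathfinish_def linepath_def)

lemma segment_path_refl [simp]: "segment_path x x = (\<lambda>_. x)"
  by (auto simp: segment_path_def fun_eq_iff algebra_simps)

lemma path_class_segments:
  assumes \<tau>: "base_paths S a \<tau>" and C: "segment_convex C" "C \<subseteq> S" and xyz: "x \<in> C" "y \<in> C" "z \<in> C"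
  shows "path_class S a \<tau> (segment_path x y) \<otimes>\<^bsub>fundamental_group S a\<^esub>
     path_class S a \<tau> (segment_path y z) = path_class S a \<tau> (segment_path x z)"
proof -
  note im = path_image_segment_path[OF C(1)]
  have "path_class S a \<tau> (segment_path x y +++ segment_path y z) =
      path_class S a \<tau> (segment_path x z)"
    using im xyz
    by (intro path_class_cong[OF \<tau>] homotopic_paths_segment_convex[OF C]) (simp_all add: subset_path_image_join)
  moreover have "path_class S a \<tau> (segment_path x y +++ segment_path y z) =
      path_class S a \<tau> (segment_path x y) \<otimes>\<^bsub>fundamental_group S a\<^esub> path_class S a \<tau> (segment_path y z)"
    using im[THEN order_trans[OF _ C(2)]] xyz by (intro path_class_join[OF \<tau>]) simp_all
  ultimately show ?thesis by simp
qed


section \<open>Holonomy of a cocycle on an open cover\<close>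

text \<open>
  A derivation of \<open>transport V U \<Gamma> g \<gamma> s t u w c\<close> is a subdivision of \<open>{s..t}\<close> together with a chart for
  each piece, from \<open>u\<close> at the beginning to \<open>w\<close> at the end; \<open>c\<close> is the product of the transition
  values \<open>g\<close> between consecutive charts. An inductive definition replaces the bookkeeping with
  subdivisions: derivations can be cut at any point, glued together, and transferred to nearby paths
  by induction.
\<close>

inductive transport ::
    "'v set \<Rightarrow> ('v \<Rightarrow> 'a set) \<Rightarrow> ('g, 'm) monoid_scheme \<Rightarrow> ('v \<Rightarrow> 'v \<Rightarrow> 'g) \<Rightarrow> (real \<Rightarrow> 'a) \<Rightarrow>
     real \<Rightarrow> real \<Rightarrow> 'v \<Rightarrow> 'v \<Rightarrow> 'g \<Rightarrow> bool"
  for V U \<Gamma> g \<gamma> where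
    stay: "\<lbrakk>s \<le> t; v \<in> V; \<gamma> ` {s..t} \<subseteq> U v\<rbrakk> \<Longrightarrow> transport V U \<Gamma> g \<gamma> s t v v \<one>\<^bsub>\<Gamma>\<^esub>"
  | switch: "\<lbrakk>transport V U \<Gamma> g \<gamma> s t u v c; w \<in> V; \<gamma> t \<in> U w\<rbrakk>
      \<Longrightarrow> transport V U \<Gamma> g \<gamma> s t u w (c \<otimes>\<^bsub>\<Gamma>\<^esub> g v w)"
  | append: "\<lbrakk>transport V U \<Gamma> g \<gamma> s t u v c; transport V U \<Gamma> g \<gamma> t r v w d\<rbrakk>
      \<Longrightarrow> transport V U \<Gamma> g \<gamma> s r u w (c \<otimes>\<^bsub>\<Gamma>\<^esub> d)"

lemma transport_ends:
  "transport V U \<Gamma> g \<gamma> s t u w c \<Longrightarrow> s \<le> t \<and> u \<in> V \<and> w \<in> V \<and> \<gamma> s \<in> U u \<and> \<gamma> t \<in> U w"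
  by (induction rule: transport.induct) auto

lemma transport_reparametrize:
  assumes "transport V U \<Gamma> g \<gamma> s t u w c" "m > 0"
    and "\<And>x. x \<in> {(s - b) / m..(t - b) / m} \<Longrightarrow> \<delta> x = \<gamma> (m * x + b)"
  shows "transport V U \<Gamma> g \<delta> ((s - b) / m) ((t - b) / m) u w c"
  using assms(1,3)
proof (induction rule: transport.induct)
  case (stay s t v)
  have "\<delta> ` {(s - b) / m..(t - b) / m} \<subseteq> \<gamma> ` {s..t}"
  proof
    fix y assume "y \<in> \<delta> ` {(s - b) / m..(t - b) / m}"
    then obtain x where x: "x \<in> {(s - b) / m..(t - b) / m}" "y = \<delta> x" by blast
    then have "m * x + b \<in> {s..t}" using \<open>m > 0\<close> by (auto simp: field_simps)
    with x stay.prems[OF x(1)] show "y \<in> \<gamma> ` {s..t}" by blast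
  qed
  with stay.hyps \<open>m > 0\<close> show ?case
    by (intro transport.stay) (auto simp: divide_right_mono)
next
  case (switch s t u v c w)
  have "s \<le> t" using transport_ends[OF switch.hyps(1)] by simp
  then have "\<delta> ((t - b) / m) = \<gamma> t"
    using switch.prems[of "(t - b) / m"] \<open>m > 0\<close> by (simp add: divide_right_mono)
  with switch show ?case by (intro transport.switch) auto
next
  case (append s t u v c r w d)
  have "s \<le> t" "t \<le> r" using transport_ends append.hyps by metis+
  then have "(s - b) / m \<le> (t - b) / m" "(t - b) / m \<le> (r - b) / m"
    using \<open>m > 0\<close> by (auto simp: divide_right_mono)
  with append show ?case by (intro transport.append) auto
qed

locale cover_cocycle = group \<Gamma>
  for \<Gamma> :: "('g, 'm) monoid_scheme" (structure) +
  fixes S :: "'a::topological_space set" and V :: "'v set" and U :: "'v \<Rightarrow> 'a set"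
    and g :: "'v \<Rightarrow> 'v \<Rightarrow> 'g"
  assumes open_U: "v \<in> V \<Longrightarrow> open (U v)"
    and cover: "x \<in> S \<Longrightarrow> \<exists>v\<in>V. x \<in> U v"
    and g_closed: "\<lbrakk>u \<in> V; v \<in> V; x \<in> S; x \<in> U u; x \<in> U v\<rbrakk> \<Longrightarrow> g u v \<in> carrier \<Gamma>"
    and cocycle: "\<lbrakk>u \<in> V; v \<in> V; w \<in> V; x \<in> S; x \<in> U u; x \<in> U v; x \<in> U w\<rbrakk> \<Longrightarrow>
       g u v \<otimes> g v w = g u w"
begin

abbreviation tr where "tr \<equiv> transport V U \<Gamma> g"

lemma g_refl: "\<lbrakk>v \<in> V; x \<in> S; x \<in> U v\<rbrakk> \<Longrightarrow> g v v = \<one>"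
  using cocycle[of v v v x] g_closed[of v v x] by (simp add: l_cancel_one')

lemma transport_closed:
  "\<lbrakk>tr \<gamma> s t u w c; \<gamma> ` {s..t} \<subseteq> S\<rbrakk> \<Longrightarrow> c \<in> carrier \<Gamma>"
proof (induction rule: transport.induct)
  case (switch s t u v c w)
  have "s \<le> t" "v \<in> V" "\<gamma> t \<in> U v" using transport_ends[OF switch.hyps(1)] by auto
  moreover from this have "\<gamma> t \<in> S" using switch.prems by auto
  ultimately show ?case using switch g_closed[of v w "\<gamma> t"] by auto
next
  case (append s t u v c r w d)
  have "s \<le> t" "t \<le> r" using transport_ends append.hyps by metis+
  with append show ?case by (auto simp: image_subset_iff)
qed simp

lemma transport_split:
  "\<lbrakk>tr \<gamma> s r u w c; s \<le> t; t \<le> r; \<gamma> ` {s..r} \<subseteq> S\<rbrakk> \<Longrightarrow>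
     \<exists>v c1 c2. tr \<gamma> s t u v c1 \<and> tr \<gamma> t r v w c2 \<and> c = c1 \<otimes> c2"
proof (induction rule: transport.induct)
  case (stay s r v)
  have "\<gamma> ` {s..t} \<subseteq> U v" "\<gamma> ` {t..r} \<subseteq> U v"
    using stay by (auto simp: image_subset_iff)
  then have "tr \<gamma> s t v v \<one>" "tr \<gamma> t r v v \<one>"
    using stay by (simp_all add: transport.stay)
  then show ?case by (intro exI[of _ v] exI[of _ \<one>]) simp
next
  case (switch s r u v c w)
  then obtain v' c1 c2 where *: "tr \<gamma> s t u v' c1" "tr \<gamma> t r v' v c2" "c = c1 \<otimes> c2" by blast
  have sub: "\<gamma> ` {s..t} \<subseteq> S" "\<gamma> ` {t..r} \<subseteq> S" using switch.prems by auto
  have "c1 \<in> carrier \<Gamma>" "c2 \<in> carrier \<Gamma>" 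
    using transport_closed[OF *(1) sub(1)] transport_closed[OF *(2) sub(2)] by simp_all
  moreover have "g v w \<in> carrier \<Gamma>"
    using transport_ends[OF *(2)] switch.hyps switch.prems by (intro g_closed[of v w "\<gamma> r"]) auto
  moreover have "tr \<gamma> t r v' w (c2 \<otimes> g v w)" using * switch.hyps by (auto intro: transport.switch)
  ultimately show ?case using *(1,3) by (intro exI[of _ v'] exI[of _ c1] exI[of _ "c2 \<otimes> g v w"]) (simp add: m_assoc)
next
  case (append s q u v c r w d)
  have ends: "s \<le> q" "q \<le> r" using transport_ends append.hyps by metis+
  have sub: "\<gamma> ` {s..q} \<subseteq> S" "\<gamma> ` {q..r} \<subseteq> S" using append.prems ends by auto
  have cd: "c \<in> carrier \<Gamma>" "d \<in> carrier \<Gamma>" 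
    using transport_closed[OF append.hyps(1) sub(1)] transport_closed[OF append.hyps(2) sub(2)] by simp_all
  show ?case
  proof (cases "t \<le> q")
    case True
    then obtain v' c1 c2 where *: "tr \<gamma> s t u v' c1" "tr \<gamma> t q v' v c2" "c = c1 \<otimes> c2"
      using append.IH(1) append.prems sub by blast
    have sub': "\<gamma> ` {s..t} \<subseteq> S" "\<gamma> ` {t..q} \<subseteq> S" using sub append.prems True by auto
    have "c1 \<in> carrier \<Gamma>" "c2 \<in> carrier \<Gamma>"
      using transport_closed[OF *(1) sub'(1)] transport_closed[OF *(2) sub'(2)] by simp_all
    then show ?thesis using * cd append.hyps(2) by (metis m_assoc transport.append)
  next
    case False
    then obtain v' c1 c2 where *: "tr \<gamma> q t v v' c1" "tr \<gamma> t r v' w c2" "d = c1 \<otimes> c2"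
      using append.IH(2) append.prems sub by force
    have sub': "\<gamma> ` {q..t} \<subseteq> S" "\<gamma> ` {t..r} \<subseteq> S" using sub append.prems False by auto
    have "c1 \<in> carrier \<Gamma>" "c2 \<in> carrier \<Gamma>"
      using transport_closed[OF *(1) sub'(1)] transport_closed[OF *(2) sub'(2)] by simp_all
    then show ?thesis using * cd append.hyps(1) by (metis m_assoc transport.append)
  qed
qed

text \<open>
  All charts met by a path inside \<open>U x\<close> can be compared with \<open>x\<close>, and the intermediate transition values
  telescope.
\<close>

lemma transport_in_chart:
  "\<lbrakk>tr \<gamma> s t u w c; x \<in> V; \<gamma> ` {s..t} \<subseteq> S; \<gamma> ` {s..t} \<subseteq> U x\<rbrakk> \<Longrightarrow> c = g u x \<otimes> g x w"
proof (induction rule: transport.induct)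
  case (stay s t v)
  then have "\<gamma> s \<in> S" "\<gamma> s \<in> U v" "\<gamma> s \<in> U x" by auto
  then show ?case using stay cocycle[of v x v "\<gamma> s"] g_refl[of v "\<gamma> s"] by simp
next
  case (switch s t u v c w)
  have e: "s \<le> t" "u \<in> V" "v \<in> V" "\<gamma> s \<in> U u" "\<gamma> t \<in> U v"
    using transport_ends[OF switch.hyps(1)] by auto
  then have pts: "\<gamma> s \<in> S" "\<gamma> s \<in> U x" "\<gamma> t \<in> S" "\<gamma> t \<in> U x" using switch.prems by auto
  have "g u x \<in> carrier \<Gamma>" "g x v \<in> carrier \<Gamma>" "g v w \<in> carrier \<Gamma>"
    using g_closed e pts switch.hyps switch.prems by blast+
  moreover have "g x v \<otimes> g v w = g x w"
    using cocycle[of x v w "\<gamma> t"] e pts switch by auto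
  ultimately show ?case using switch by (simp add: m_assoc)
next
  case (append s t u v c r w d)
  have e: "s \<le> t" "t \<le> r" "u \<in> V" "v \<in> V" "w \<in> V" "\<gamma> s \<in> U u" "\<gamma> t \<in> U v" "\<gamma> r \<in> U w"
    using transport_ends append.hyps by metis+
  then have pts: "\<gamma> s \<in> S" "\<gamma> s \<in> U x" "\<gamma> t \<in> S" "\<gamma> t \<in> U x" "\<gamma> r \<in> S" "\<gamma> r \<in> U x"
    using append.prems by auto
  have cl: "g u x \<in> carrier \<Gamma>" "g x v \<in> carrier \<Gamma>" "g v x \<in> carrier \<Gamma>" "g x w \<in> carrier \<Gamma>"
    using g_closed e pts append.prems by blast+
  have "g x v \<otimes> g v x = \<one>"
    using cocycle[of x v x "\<gamma> t"] g_refl[of x "\<gamma> t"] e pts append.prems by auto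
  then have "g x v \<otimes> (g v x \<otimes> g x w) = g x w" using cl by (simp flip: m_assoc)
  moreover have "c = g u x \<otimes> g x v" "d = g v x \<otimes> g x w"
    using append.IH append.prems e by (auto simp: image_subset_iff)
  ultimately show ?case using cl by (simp add: m_assoc)
qed

lemma small_interval_in_chart:
  fixes s t :: real
  assumes "continuous_on {s..t} \<gamma>" "\<gamma> ` {s..t} \<subseteq> S" "x \<in> {s..t}"
  obtains v d where "v \<in> V" "d > 0"
    "\<And>a b. \<lbrakk>a \<le> x; x \<le> b; b - a < d; s \<le> a; b \<le> t\<rbrakk> \<Longrightarrow> \<gamma> ` {a..b} \<subseteq> U v"
proof -
  have "\<gamma> x \<in> S" using assms by auto
  then obtain v where v: "v \<in> V" "\<gamma> x \<in> U v" using cover by blast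
  then have "\<forall>\<^sub>F y in at x within {s..t}. \<gamma> y \<in> U v"
    using assms(1,3) open_U[OF v(1)] by (metis continuous_on_def topological_tendstoD)
  then obtain d where d: "d > 0" "\<And>y. \<lbrakk>y \<in> {s..t}; y \<noteq> x; dist y x < d\<rbrakk> \<Longrightarrow> \<gamma> y \<in> U v"
    unfolding eventually_at by blast
  show thesis
  proof (rule that[OF v(1) d(1)])
    fix a b assume ab: "a \<le> x" "x \<le> b" "b - a < d" "s \<le> a" "b \<le> t"
    show "\<gamma> ` {a..b} \<subseteq> U v"
    proof
      fix z assume "z \<in> \<gamma> ` {a..b}"
      then obtain y where y: "y \<in> {a..b}" "z = \<gamma> y" by blast
      then show "z \<in> U v"
        using v(2) d(2)[of y] ab by (cases "y = x") (auto simp: dist_real_def abs_if)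
    qed
  qed
qed

text \<open>
  Short pieces of the path lie in a single chart, and pieces can be glued after a change of chart.
\<close>

lemma transport_exists:
  assumes "s \<le> t" "continuous_on {s..t} \<gamma>" "\<gamma> ` {s..t} \<subseteq> S"
    and "u \<in> V" "\<gamma> s \<in> U u" "w \<in> V" "\<gamma> t \<in> U w"
  shows "\<exists>c. tr \<gamma> s t u w c"
proof -
  let ?P = "\<lambda>a b. s \<le> a \<and> b \<le> t \<longrightarrow> (\<exists>u w c. tr \<gamma> a b u w c)"
  have "?P s t"
  proof (rule Bolzano[OF assms(1), where P = ?P])
    fix a b c assume trans: "?P a b" "?P b c" "a \<le> b" "b \<le> c"
    show "?P a c"
    proof
      assume "s \<le> a \<and> c \<le> t"
      then obtain u w c1 u' w' c2 where *: "tr \<gamma> a b u w c1" "tr \<gamma> b c u' w' c2"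
        using trans by fastforce
      have "tr \<gamma> a b u u' (c1 \<otimes> g w u')"
        using * transport_ends[OF *(2)] by (auto intro: transport.switch)
      then show "\<exists>u w c'. tr \<gamma> a c u w c'" using *(2) transport.append by metis
    qed
  next
    fix x assume local: "s \<le> x" "x \<le> t"
    then obtain v d where vd: "v \<in> V" "d > 0"
      "\<And>a b. \<lbrakk>a \<le> x; x \<le> b; b - a < d; s \<le> a; b \<le> t\<rbrakk> \<Longrightarrow> \<gamma> ` {a..b} \<subseteq> U v"
      using small_interval_in_chart[OF assms(2,3), of x thesis] by simp
    have "\<forall>a b. a \<le> x \<and> x \<le> b \<and> b - a < d \<longrightarrow> s \<le> a \<and> b \<le> t \<longrightarrow> tr \<gamma> a b v v \<one>"
      using vd by (auto intro!: transport.stay simp del: image_subset_iff)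
    with vd(2) show "\<exists>d>0. \<forall>a b. a \<le> x \<and> x \<le> b \<and> b - a < d \<longrightarrow> ?P a b" by blast
  qed
  then obtain u' w' c where *: "tr \<gamma> s t u' w' c" by blast
  have "\<gamma> ` {s..s} \<subseteq> U u" using assms by auto
  then have "tr \<gamma> s s u u' (\<one> \<otimes> g u u')"
    using transport_ends[OF *] assms by (intro transport.switch transport.stay) auto
  then have "tr \<gamma> s t u w' ((\<one> \<otimes> g u u') \<otimes> c)" using * by (rule transport.append)
  then show ?thesis using assms by (blast intro: transport.switch)
qed

text \<open>
  The assertion holds on short intervals, which lie in one chart, and passes from two adjacent
  intervals to their union: after cutting both derivations at the common point, the two transition
  values at this point cancel.
\<close>

lemma transport_unique_up_to_charts:
  assumes "s \<le> t" "continuous_on {s..t} \<gamma>" "\<gamma> ` {s..t} \<subseteq> S"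
    and "tr \<gamma> s t u w c" "tr \<gamma> s t u' w' c'"
  shows "c' = g u' u \<otimes> c \<otimes> g w w'"
proof -
  let ?P = "\<lambda>a b. s \<le> a \<and> b \<le> t \<longrightarrow>
      (\<forall>u w c u' w' c'. tr \<gamma> a b u w c \<longrightarrow> tr \<gamma> a b u' w' c' \<longrightarrow> c' = g u' u \<otimes> c \<otimes> g w w')"
  have "?P s t"
  proof (rule Bolzano[OF assms(1), where P = ?P])
    fix a b r assume trans: "?P a b" "?P b r" "a \<le> b" "b \<le> r"
    show "?P a r"
    proof (intro impI allI)
      fix u w c u' w' c'
      assume "s \<le> a \<and> r \<le> t" and c: "tr \<gamma> a r u w c" "tr \<gamma> a r u' w' c'"
      then have sub: "\<gamma> ` {a..r} \<subseteq> S" "\<gamma> ` {a..b} \<subseteq> S" "\<gamma> ` {b..r} \<subseteq> S"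
        using assms(3) trans by (auto simp: image_subset_iff)
      obtain v c1 c2 where 1: "tr \<gamma> a b u v c1" "tr \<gamma> b r v w c2" "c = c1 \<otimes> c2"
        using transport_split[OF c(1) _ _ sub(1), of b] trans(3,4) by blast
      obtain v' c1' c2' where 2: "tr \<gamma> a b u' v' c1'" "tr \<gamma> b r v' w' c2'" "c' = c1' \<otimes> c2'"
        using transport_split[OF c(2) _ _ sub(1), of b] trans(3,4) by blast
      have eq: "c1' = g u' u \<otimes> c1 \<otimes> g v v'" "c2' = g v' v \<otimes> c2 \<otimes> g w w'"
        using trans(1,2) 1 2 \<open>s \<le> a \<and> r \<le> t\<close> trans(3,4) by force+
      note e = transport_ends[OF 1(1)] transport_ends[OF 1(2)] transport_ends[OF 2(1)]
        transport_ends[OF 2(2)]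
      have pts: "\<gamma> a \<in> S" "\<gamma> b \<in> S" "\<gamma> r \<in> S" using sub trans(3,4) by auto
      have cl: "c1 \<in> carrier \<Gamma>" "c2 \<in> carrier \<Gamma>" "g u' u \<in> carrier \<Gamma>" "g w w' \<in> carrier \<Gamma>"
        "g v v' \<in> carrier \<Gamma>" "g v' v \<in> carrier \<Gamma>"
        using transport_closed[OF 1(1) sub(2)] transport_closed[OF 1(2) sub(3)] e pts g_closed
        by blast+
      have "g v v' \<otimes> g v' v = \<one>"
        using cocycle[of v v' v "\<gamma> b"] g_refl[of v "\<gamma> b"] e pts by auto
      then have "g v v' \<otimes> (g v' v \<otimes> (c2 \<otimes> g w w')) = c2 \<otimes> g w w'"
        using cl by (simp flip: m_assoc)
      then show "c' = g u' u \<otimes> c \<otimes> g w w'"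
        unfolding 1(3) 2(3) eq using cl by (simp add: m_assoc)
    qed
  next
    fix x assume local: "s \<le> x" "x \<le> t"
    then obtain v d where vd: "v \<in> V" "d > 0"
      "\<And>a b. \<lbrakk>a \<le> x; x \<le> b; b - a < d; s \<le> a; b \<le> t\<rbrakk> \<Longrightarrow> \<gamma> ` {a..b} \<subseteq> U v"
      using small_interval_in_chart[OF assms(2,3), of x thesis] by simp
    show "\<exists>d>0. \<forall>a b. a \<le> x \<and> x \<le> b \<and> b - a < d \<longrightarrow> ?P a b"
    proof (intro exI[of _ d] conjI allI impI vd(2))
      fix a b u w c u' w' c'
      assume ab: "a \<le> x \<and> x \<le> b \<and> b - a < d" "s \<le> a \<and> b \<le> t"
        and c: "tr \<gamma> a b u w c" "tr \<gamma> a b u' w' c'"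
      have U: "\<gamma> ` {a..b} \<subseteq> U v" using vd(3) ab by blast
      have S: "\<gamma> ` {a..b} \<subseteq> S" using assms(3) ab by (auto simp: image_subset_iff)
      have eq: "c = g u v \<otimes> g v w" "c' = g u' v \<otimes> g v w'"
        using transport_in_chart[OF c(1) vd(1) S U] transport_in_chart[OF c(2) vd(1) S U] by auto
      note e = transport_ends[OF c(1)] transport_ends[OF c(2)]
      have pts: "\<gamma> a \<in> S" "\<gamma> b \<in> S" "\<gamma> a \<in> U v" "\<gamma> b \<in> U v" using S U ab by auto
      have "g u' u \<otimes> g u v = g u' v" "g v w \<otimes> g w w' = g v w'"
        using cocycle[of u' u v "\<gamma> a"] cocycle[of v w w' "\<gamma> b"] e pts vd(1) by auto
      moreover have "g u' u \<in> carrier \<Gamma>" "g u v \<in> carrier \<Gamma>" "g v w \<in> carrier \<Gamma>" "g w w' \<in> carrier \<Gamma>"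
        using g_closed e pts vd(1) by blast+
      ultimately show "c' = g u' u \<otimes> c \<otimes> g w w'"
        unfolding eq by (metis m_assoc m_closed)
    qed
  qed
  with assms(4,5) show ?thesis by blast
qed

lemma transport_unique:
  assumes "continuous_on {s..t} \<gamma>" "\<gamma> ` {s..t} \<subseteq> S"
    and c: "tr \<gamma> s t u w c" "tr \<gamma> s t u w c'"
  shows "c' = c"
proof -
  note e = transport_ends[OF c(1)]
  have "\<gamma> s \<in> S" "\<gamma> t \<in> S" using assms e by auto
  then have "g u u = \<one>" "g w w = \<one>" using g_refl e by blast+
  then show ?thesis
    using transport_unique_up_to_charts[OF _ assms] e transport_closed[OF c(1) assms(2)] by simp
qed

text \<open>
  A derivation imposes finitely many conditions, each saying that a compact piece of the path lies in
  an open set. By the tube lemma, all of them persist for nearby members of the family, and so the same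
  derivation serves for these.
\<close>

lemma transport_stable:
  fixes h :: "real \<times> real \<Rightarrow> 'a"
  assumes "continuous_on ({0..1} \<times> {0..1}) h" "x \<in> {0..1}"
  shows "tr (\<lambda>y. h (x, y)) s t u w c \<Longrightarrow> 0 \<le> s \<Longrightarrow> t \<le> 1 \<Longrightarrow>
    \<forall>\<^sub>F x' in at x within {0..1}. tr (\<lambda>y. h (x', y)) s t u w c"
proof -
  have tube: "\<forall>\<^sub>F x' in at x within {0..1}. \<forall>y\<in>{s..t}. h (x', y) \<in> U v"
    if v: "v \<in> V" and st: "0 \<le> s" "t \<le> 1" and sub: "\<And>y. y \<in> {s..t} \<Longrightarrow> h (x, y) \<in> U v" for s t v
  proof -
    obtain W where W: "open W" "W \<inter> ({0..1} \<times> {0..1}) = h -` U v \<inter> ({0..1} \<times> {0..1})"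
      using assms(1) open_U[OF v] by (metis continuous_on_open_invariant)
    have "{x} \<times> {s..t} \<subseteq> W"
      using W(2) sub st assms(2) by auto
    then obtain X where X: "x \<in> X" "open X" "X \<times> {s..t} \<subseteq> W"
      using Elementary_Topology.tube_lemma[of "{s..t}" W x] W(1) by auto
    have "\<forall>\<^sub>F x' in at x within {0..1}. x' \<in> X \<and> x' \<in> {0..1}"
      using X(1,2) by (auto simp: eventually_at_topological)
    then show ?thesis
    proof (rule eventually_mono)
      fix x' assume x': "x' \<in> X \<and> x' \<in> {0..1}"
      show "\<forall>y\<in>{s..t}. h (x', y) \<in> U v"
      proof
        fix y assume y: "y \<in> {s..t}"
        then have "(x', y) \<in> W \<inter> ({0..1} \<times> {0..1})" using X(3) x' st by auto
        then show "h (x', y) \<in> U v" unfolding W(2) by simp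
      qed
    qed
  qed
  show "tr (\<lambda>y. h (x, y)) s t u w c \<Longrightarrow> 0 \<le> s \<Longrightarrow> t \<le> 1 \<Longrightarrow>
    \<forall>\<^sub>F x' in at x within {0..1}. tr (\<lambda>y. h (x', y)) s t u w c"
  proof (induction rule: transport.induct)
    case (stay s t v)
    then have "\<forall>\<^sub>F x' in at x within {0..1}. \<forall>y\<in>{s..t}. h (x', y) \<in> U v"
      by (intro tube) auto
    then show ?case
      by (rule eventually_mono) (use stay in \<open>auto intro!: transport.stay\<close>)
  next
    case (switch s t u v c w)
    have "s \<le> t" using transport_ends[OF switch.hyps(1)] by simp
    with switch have "\<forall>\<^sub>F x' in at x within {0..1}. \<forall>y\<in>{t..t}. h (x', y) \<in> U w"
      by (intro tube) auto
    moreover have "\<forall>\<^sub>F x' in at x within {0..1}. tr (\<lambda>y. h (x', y)) s t u v c"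
      using switch by blast
    ultimately show ?case
      by eventually_elim (use switch in \<open>auto intro!: transport.switch\<close>)
  next
    case (append s t u v c r w d)
    have "s \<le> t" "t \<le> r"
      using transport_ends[OF append.hyps(1)] transport_ends[OF append.hyps(2)] by auto
    with append have "\<forall>\<^sub>F x' in at x within {0..1}. tr (\<lambda>y. h (x', y)) s t u v c"
      "\<forall>\<^sub>F x' in at x within {0..1}. tr (\<lambda>y. h (x', y)) t r v w d" by auto
    then show ?case by eventually_elim (rule transport.append)
  qed
qed

definition hol :: "(real \<Rightarrow> 'a) \<Rightarrow> 'v \<Rightarrow> 'v \<Rightarrow> 'g" where
  "hol \<gamma> u w = (THE c. tr \<gamma> 0 1 u w c)"

lemma hol_eq:
  assumes "path p" "path_image p \<subseteq> S" "tr p 0 1 u w c"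
  shows "hol p u w = c"
  unfolding hol_def using assms
  by (intro the_equality) (auto simp: path_def path_image_def intro: transport_unique)

lemma transport_hol:
  assumes "path p" "path_image p \<subseteq> S" "u \<in> V" "pathstart p \<in> U u" "w \<in> V" "pathfinish p \<in> U w"
  shows "tr p 0 1 u w (hol p u w)"
proof -
  obtain c where "tr p 0 1 u w c"
    using transport_exists[of 0 1 p u w] assms
    by (auto simp: path_def path_image_def pathstart_def pathfinish_def)
  then show ?thesis using hol_eq assms by metis
qed

text \<open>
  By stability the holonomy is a locally constant function on the parameter interval of the homotopy.
\<close>

lemma hol_homotopic:
  assumes "homotopic_paths S p q" "u \<in> V" "pathstart p \<in> U u" "w \<in> V" "pathfinish p \<in> U w"
  shows "hol p u w = hol q u w"
proof -
  obtain h :: "real \<times> real \<Rightarrow> 'a" where h: "continuous_on ({0..1} \<times> {0..1}) h" "h \<in> ({0..1} \<times> {0..1}) \<rightarrow> S"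
      "\<forall>y\<in>{0..1}. h (0, y) = p y" "\<forall>y\<in>{0..1}. h (1, y) = q y"
      "\<forall>x\<in>{0..1}. pathstart (h \<circ> Pair x) = pathstart p \<and> pathfinish (h \<circ> Pair x) = pathfinish p"
    using assms(1) unfolding homotopic_paths by blast
  let ?h = "\<lambda>x y. h (x, y)"
  have path: "path (?h x)" "path_image (?h x) \<subseteq> S" if "x \<in> {0..1}" for x
  proof -
    show "path (?h x)"
      unfolding path_def using that
      by (intro continuous_on_compose2[OF h(1)] continuous_intros) auto
    show "path_image (?h x) \<subseteq> S" using h(2) that by (auto simp: path_image_def)
  qed
  have "hol (?h 0) u w = hol (?h 1) u w"
  proof (rule connected_local_const[of "{0..1}" 0 1 "\<lambda>x. hol (?h x) u w"])
    show "\<forall>x\<in>{0..1}. \<forall>\<^sub>F x' in at x within {0..1}. hol (?h x) u w = hol (?h x') u w"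
    proof
      fix x :: real assume x: "x \<in> {0..1}"
      have "pathstart (?h x) = pathstart p" "pathfinish (?h x) = pathfinish p"
        using h(5) x by (auto simp: comp_def)
      then have "tr (?h x) 0 1 u w (hol (?h x) u w)"
        using assms path[OF x] by (intro transport_hol) auto
      then have "\<forall>\<^sub>F x' in at x within {0..1}. tr (?h x') 0 1 u w (hol (?h x) u w)"
        using transport_stable[OF h(1) x] by simp
      moreover have "\<forall>\<^sub>F x' in at x within {0..1}. x' \<in> {0..1}"
        by (auto simp: eventually_at_topological)
      ultimately show "\<forall>\<^sub>F x' in at x within {0..1}. hol (?h x) u w = hol (?h x') u w"
        by eventually_elim (use path hol_eq in metis)
    qed
  qed auto
  moreover have "tr p 0 1 u w c = tr (?h 0) 0 1 u w c" for c
    using transport_reparametrize[of V U \<Gamma> g p 0 1 u w c 1 0 "?h 0"]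
      transport_reparametrize[of V U \<Gamma> g "?h 0" 0 1 u w c 1 0 p] h(3) by auto
  moreover have "tr q 0 1 u w c = tr (?h 1) 0 1 u w c" for c
    using transport_reparametrize[of V U \<Gamma> g q 0 1 u w c 1 0 "?h 1"]
      transport_reparametrize[of V U \<Gamma> g "?h 1" 0 1 u w c 1 0 q] h(4) by auto
  ultimately show ?thesis by (simp add: hol_def)
qed

lemma hol_join:
  assumes p: "path p" "path_image p \<subseteq> S" and q: "path q" "path_image q \<subseteq> S"
    and pq: "pathfinish p = pathstart q"
    and u: "u \<in> V" "pathstart p \<in> U u" and v: "v \<in> V" "pathfinish p \<in> U v"
    and w: "w \<in> V" "pathfinish q \<in> U w"
  shows "hol (p +++ q) u w = hol p u v \<otimes> hol q v w"
proof -
  have "tr (p +++ q) ((0 - 0) / 2) ((1 - 0) / 2) u v (hol p u v)"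
    using transport_hol[OF p u v]
    by (rule transport_reparametrize) (auto simp: joinpaths_def)
  moreover have "p (2 * x) = q (2 * x - 1)" if "x * 2 = 1" for x
    using that pq by (simp add: mult.commute[of 2] pathstart_def pathfinish_def)
  then have "tr (p +++ q) ((0 - (- 1)) / 2) ((1 - (- 1)) / 2) v w (hol q v w)"
    using transport_hol[OF q v(1) _ w] v pq
    by (intro transport_reparametrize)
      (auto simp: joinpaths_def pathstart_def pathfinish_def)
  ultimately have "tr (p +++ q) 0 1 u w (hol p u v \<otimes> hol q v w)"
    using transport.append[of V U \<Gamma> g "p +++ q" 0 "1/2" u v _ 1 w] by simp
  then show ?thesis
    using p q pq by (intro hol_eq) (auto simp: subset_path_image_join)
qed

end


section \<open>Complexes covered by convex vertex stars\<close>

text \<open>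
  The union of \<open>F\<close> is covered by the stars \<open>U v\<close>. The last assumption is what makes the cover
  computable: vertices whose stars have a point in common are vertices of a common face, and the whole
  segment between a vertex and a point of its star lies in the complex.
\<close>

locale star_complex =
  fixes F :: "('i \<Rightarrow> real) set set" and V :: "('i \<Rightarrow> real) set"
    and U :: "('i \<Rightarrow> real) \<Rightarrow> ('i \<Rightarrow> real) set"
  assumes face_convex: "f \<in> F \<Longrightarrow> segment_convex f"
    and star_convex: "v \<in> V \<Longrightarrow> segment_convex (U v)"
    and star_open: "v \<in> V \<Longrightarrow> open (U v)"
    and vertex_in_star: "v \<in> V \<Longrightarrow> v \<in> U v"
    and stars_cover: "\<lbrakk>f \<in> F; x \<in> f\<rbrakk> \<Longrightarrow> \<exists>v\<in>V. x \<in> U v"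
    and star_face: "\<lbrakk>f \<in> F; x \<in> f; v \<in> V; x \<in> U v\<rbrakk> \<Longrightarrow> v \<in> f"
begin

lemma star_complex_subset: "F' \<subseteq> F \<Longrightarrow> star_complex F' V U"
  using star_complex_axioms unfolding star_complex_def by blast

lemma segment_in_complex:
  assumes "x \<in> \<Union>F" "v \<in> V" "x \<in> U v" "t \<in> {0..1}"
  shows "segment_path v x t \<in> \<Union>F"
proof -
  obtain f where f: "f \<in> F" "x \<in> f" using assms(1) by blast
  then have "v \<in> f" using star_face assms by blast
  then have "segment_path v x t \<in> f"
    using face_convex[OF f(1)] f(2) assms(4) by (simp add: segment_convex_def)
  with f(1) show ?thesis by blast
qed

lemma cover_cocycleI:
  assumes "group \<Gamma>"
    and "\<And>f u v. \<lbrakk>f \<in> F; u \<in> V \<inter> f; v \<in> V \<inter> f\<rbrakk> \<Longrightarrow> g u v \<in> carrier \<Gamma>"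
    and "\<And>f u v w. \<lbrakk>f \<in> F; u \<in> V \<inter> f; v \<in> V \<inter> f; w \<in> V \<inter> f\<rbrakk> \<Longrightarrow> g u v \<otimes>\<^bsub>\<Gamma>\<^esub> g v w = g u w"
  shows "cover_cocycle \<Gamma> (\<Union>F) V U g"
proof (intro cover_cocycle.intro cover_cocycle_axioms.intro assms(1))
  show "\<exists>v\<in>V. x \<in> U v" if "x \<in> \<Union>F" for x using that stars_cover by blast
  show "g u v \<in> carrier \<Gamma>" if "u \<in> V" "v \<in> V" "x \<in> \<Union>F" "x \<in> U u" "x \<in> U v" for u v x
    using that star_face assms(2) by blast
  show "g u v \<otimes>\<^bsub>\<Gamma>\<^esub> g v w = g u w"
    if *: "u \<in> V" "v \<in> V" "w \<in> V" "x \<in> \<Union>F" "x \<in> U u" "x \<in> U v" "x \<in> U w" for u v w x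
  proof -
    obtain f where f: "f \<in> F" "x \<in> f" using *(4) by blast
    then have "u \<in> V \<inter> f" "v \<in> V \<inter> f" "w \<in> V \<inter> f" using * star_face by blast+
    then show ?thesis using assms(3) f(1) by blast
  qed
qed (rule star_open)

lemma transport_in_face:
  assumes "group \<Gamma>" and f: "f \<in> F"
    and closed: "\<And>u v. \<lbrakk>u \<in> V \<inter> f; v \<in> V \<inter> f\<rbrakk> \<Longrightarrow> g u v \<in> carrier \<Gamma>"
    and cocycle: "\<And>u v w. \<lbrakk>u \<in> V \<inter> f; v \<in> V \<inter> f; w \<in> V \<inter> f\<rbrakk> \<Longrightarrow> g u v \<otimes>\<^bsub>\<Gamma>\<^esub> g v w = g u w"
  shows "\<lbrakk>transport V U \<Gamma> g \<gamma> s t u w c; \<gamma> ` {s..t} \<subseteq> f\<rbrakk> \<Longrightarrow> u \<in> f \<and> w \<in> f \<and> c = g u w"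
proof (induction rule: transport.induct)
  interpret group \<Gamma> by fact
  {
    case (stay s t v)
    then have "\<gamma> s \<in> f" "\<gamma> s \<in> U v" by auto
    with stay have "v \<in> V \<inter> f" using star_face[OF f] by blast
    then show ?case using cocycle[of v v v] closed[of v v] by (simp add: l_cancel_one')
  next
    case (switch s t u v c w)
    note e = transport_ends[OF switch.hyps(1)]
    then have "\<gamma> t \<in> f" using switch.prems by auto
    then have "w \<in> f" using star_face[OF f] switch.hyps by blast
    then show ?case using switch e cocycle[of u v w] by auto
  next
    case (append s t u v c r w d)
    note e = transport_ends[OF append.hyps(1)] transport_ends[OF append.hyps(2)]
    have "\<gamma> ` {s..t} \<subseteq> f" "\<gamma> ` {t..r} \<subseteq> f" using append.prems e by auto
    then show ?case using append.IH e cocycle[of u v w] by auto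
  }
qed

text \<open>
  If the values of \<open>g\<close> are mapped by \<open>\<psi>\<close> to the classes of the segments between vertices, then
  holonomy is mapped to the class of the path, corrected by segments at both ends that lead from the
  vertices of the first and last chart to the ends of the path. A piece inside a star is homotopic to the
  two segments through the centre, and the segments at a change of chart form a triangle in a face.
\<close>

lemma path_class_transport:
  assumes \<tau>: "base_paths (\<Union>F) a \<tau>" and "group \<Gamma>"
    and \<psi>: "\<psi> \<in> hom \<Gamma> (fundamental_group (\<Union>F) a)"
    and g: "\<And>f u v. \<lbrakk>f \<in> F; u \<in> V \<inter> f; v \<in> V \<inter> f\<rbrakk> \<Longrightarrow>
      g u v \<in> carrier \<Gamma> \<and> \<psi> (g u v) = path_class (\<Union>F) a \<tau> (segment_path u v)"
    and p: "path p" "path_image p \<subseteq> \<Union>F"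
  shows "\<lbrakk>transport V U \<Gamma> g p s t u w c; 0 \<le> s; t \<le> 1\<rbrakk> \<Longrightarrow> c \<in> carrier \<Gamma> \<and>
    \<psi> c = path_class (\<Union>F) a \<tau> (segment_path u (p s)) \<otimes>\<^bsub>fundamental_group (\<Union>F) a\<^esub>
        path_class (\<Union>F) a \<tau> (p \<circ> linepath s t) \<otimes>\<^bsub>fundamental_group (\<Union>F) a\<^esub>
        path_class (\<Union>F) a \<tau> (segment_path (p t) w)"
proof -
  let ?S = "\<Union>F"
  let ?G = "fundamental_group ?S a" and ?c = "path_class ?S a \<tau>"
  have S: "p x \<in> ?S" if "0 \<le> x" "x \<le> 1" for x
    using subsetD[OF p(2), of "p x"] that by (simp add: path_image_def)
  have "a \<in> ?S" using base_pathsD[OF \<tau> S[of 0]] by (metis order_refl pathstart_in zero_le_one)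
  interpret G: group ?G using \<open>a \<in> ?S\<close> by (rule group_fundamental_group)
  interpret \<Gamma>: group \<Gamma> by fact
  interpret \<psi>: group_hom \<Gamma> ?G \<psi> by unfold_locales (fact \<psi>)
  have tri: "?c (segment_path x y) \<otimes>\<^bsub>?G\<^esub> ?c (segment_path y z) = ?c (segment_path x z)"
    if "f \<in> F" "x \<in> f" "y \<in> f" "z \<in> f" for f x y z
    using that by (intro path_class_segments[OF \<tau>, of f] face_convex) auto
  have clf: "?c (segment_path x y) \<in> carrier ?G" if "f \<in> F" "x \<in> f" "y \<in> f" for f x y
    using that face_convex[OF that(1)]
    by (intro path_class_closed[OF \<tau>] order_trans[OF path_image_segment_path[of f]]) auto
  have star: "\<exists>f\<in>F. x \<in> f \<and> v \<in> f" if "x \<in> ?S" "v \<in> V" "x \<in> U v" for x v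
    using that star_face by blast
  have cl: "?c (segment_path x v) \<in> carrier ?G" "?c (segment_path v x) \<in> carrier ?G"
    and inv: "?c (segment_path x v) \<otimes>\<^bsub>?G\<^esub> ?c (segment_path v x) = \<one>\<^bsub>?G\<^esub>"
      "?c (segment_path v x) \<otimes>\<^bsub>?G\<^esub> ?c (segment_path x v) = \<one>\<^bsub>?G\<^esub>"
    if xv: "x \<in> ?S" "v \<in> V" "x \<in> U v" for x v
  proof -
    obtain f where f: "f \<in> F" "x \<in> f" "v \<in> f" using star[OF xv] by blast
    show "?c (segment_path x v) \<in> carrier ?G" "?c (segment_path v x) \<in> carrier ?G"
      using f clf by blast+
    have "?c (segment_path y y) = \<one>\<^bsub>?G\<^esub>" if "y \<in> f" for y
      using that f(1) path_class_const[OF \<tau>, of y] by auto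
    then show "?c (segment_path x v) \<otimes>\<^bsub>?G\<^esub> ?c (segment_path v x) = \<one>\<^bsub>?G\<^esub>"
      "?c (segment_path v x) \<otimes>\<^bsub>?G\<^esub> ?c (segment_path x v) = \<one>\<^bsub>?G\<^esub>"
      using tri[OF f(1)] f by metis+
  qed
  define r where "r s t = ?c (p \<circ> linepath s t)" for s t
  have clr: "r s t \<in> carrier ?G" if "0 \<le> s" "s \<le> t" "t \<le> 1" for s t
    unfolding r_def using that S by (intro path_class_closed[OF \<tau>]) (auto simp: path_restrict[OF p(1)])
  have "\<lbrakk>transport V U \<Gamma> g p s t u w c; 0 \<le> s; t \<le> 1\<rbrakk> \<Longrightarrow> c \<in> carrier \<Gamma> \<and>
    \<psi> c = ?c (segment_path u (p s)) \<otimes>\<^bsub>?G\<^esub> r s t \<otimes>\<^bsub>?G\<^esub> ?c (segment_path (p t) w)"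
  proof (induction rule: transport.induct)
    case (stay s t v)
    have ends: "p s \<in> ?S" "p t \<in> ?S" "p s \<in> U v" "p t \<in> U v" using stay S by auto
    let ?q = "p \<circ> linepath s t"
    note q = path_restrict[OF p(1), of s t]
    have sub: "segment_path v (?q x) y \<in> ?S" if "x \<in> {0..1}" "y \<in> {0..1}" for x y
    proof -
      have "?q x \<in> p ` {s..t}" using q(2) that(1) stay unfolding path_image_def by blast
      then obtain z where "z \<in> {s..t}" "?q x = p z" by blast
      then show ?thesis using stay S that(2) by (intro segment_in_complex) auto
    qed
    let ?s = "segment_path (p s) v" and ?t = "segment_path v (p t)"
    have im: "path_image ?s \<subseteq> ?S" "path_image ?t \<subseteq> ?S" "v \<in> ?S"
      using star[OF ends(1) stay.hyps(2) ends(3)] star[OF ends(2) stay.hyps(2) ends(4)]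
        path_image_segment_path face_convex by (meson Union_upper UnionI order_trans)+
    have const: "path (\<lambda>_. v)" "path_image (\<lambda>_. v) \<subseteq> ?S" "pathstart (\<lambda>_. v) = v" "pathfinish (\<lambda>_. v) = v"
      using im(3) by (auto simp: path_def path_image_def pathstart_def pathfinish_def)
    have "?c ?q = ?c (?s +++ (\<lambda>_. v) +++ ?t)"
      using q stay sub by (intro path_class_cong[OF \<tau>, symmetric] homotopic_paths_star) auto
    also have "\<dots> = ?c ?s \<otimes>\<^bsub>?G\<^esub> ?c ((\<lambda>_. v) +++ ?t)"
      using im const by (intro path_class_join[OF \<tau>]) (auto simp: subset_path_image_join)
    also have "?c ((\<lambda>_. v) +++ ?t) = ?c (\<lambda>_. v) \<otimes>\<^bsub>?G\<^esub> ?c ?t"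
      using im const by (intro path_class_join[OF \<tau>]) auto
    also have "\<dots> = ?c ?t"
      using path_class_const[OF \<tau> im(3)] cl(2)[OF ends(2) stay.hyps(2) ends(4)] by simp
    finally have "r s t = ?c ?s \<otimes>\<^bsub>?G\<^esub> ?c ?t" by (simp only: r_def)
    then have "?c (segment_path v (p s)) \<otimes>\<^bsub>?G\<^esub> r s t \<otimes>\<^bsub>?G\<^esub> ?c (segment_path (p t) v) =
       (?c (segment_path v (p s)) \<otimes>\<^bsub>?G\<^esub> ?c ?s) \<otimes>\<^bsub>?G\<^esub> (?c ?t \<otimes>\<^bsub>?G\<^esub> ?c (segment_path (p t) v))"
      using cl[OF ends(1) stay.hyps(2) ends(3)] cl[OF ends(2) stay.hyps(2) ends(4)]
      by (simp add: G.m_assoc)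
    also have "\<dots> = \<one>\<^bsub>?G\<^esub>"
      using inv[OF ends(1) stay.hyps(2) ends(3)] inv[OF ends(2) stay.hyps(2) ends(4)] by simp
    finally show ?case by (simp only: \<psi>.hom_one \<Gamma>.one_closed simp_thms)
  next
    case (switch s t u v c w)
    note e = transport_ends[OF switch.hyps(1)]
    have "p s \<in> ?S" "p t \<in> ?S" using e switch.prems S by auto
    then obtain f where f: "f \<in> F" "p t \<in> f" by blast
    then have vw: "v \<in> V \<inter> f" "w \<in> V \<inter> f" using star_face e switch.hyps by blast+
    note IH = switch.IH[OF switch.prems, THEN conjunct1] switch.IH[OF switch.prems, THEN conjunct2]
    have "?c (segment_path u (p s)) \<in> carrier ?G" using cl(2)[of "p s" u] e \<open>p s \<in> ?S\<close> by simp
    moreover have "?c (segment_path (p t) v) \<in> carrier ?G" "?c (segment_path v w) \<in> carrier ?G"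
      "?c (segment_path (p t) w) \<in> carrier ?G"
      using clf[OF f] clf[OF f(1)] vw by simp_all
    moreover have "?c (segment_path (p t) v) \<otimes>\<^bsub>?G\<^esub> ?c (segment_path v w) = ?c (segment_path (p t) w)"
      using tri[OF f] vw by simp
    moreover have "r s t \<in> carrier ?G" using clr[of s t] switch.prems e by simp
    ultimately show ?case
      using IH g[OF f(1) vw] by (simp add: G.m_assoc)
  next
    case (append s t u v c q w d)
    note e = transport_ends[OF append.hyps(1)] transport_ends[OF append.hyps(2)]
    have pts: "p s \<in> ?S" "p t \<in> ?S" "p q \<in> ?S" using e append.prems S by auto
    have bounds: "t \<le> 1" "0 \<le> t" using e append.prems by auto
    note IH1 = append.IH(1)[OF append.prems(1) bounds(1)]
      and IH2 = append.IH(2)[OF bounds(2) append.prems(2)]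
    note IH = IH1[THEN conjunct1] IH1[THEN conjunct2] IH2[THEN conjunct1] IH2[THEN conjunct2]
    have "?c (p \<circ> linepath s q) = ?c ((p \<circ> linepath s t) +++ (p \<circ> linepath t q))"
      using e append.prems p
      by (intro path_class_cong[OF \<tau>, symmetric] homotopic_paths_split_at) auto
    also have "\<dots> = ?c (p \<circ> linepath s t) \<otimes>\<^bsub>?G\<^esub> ?c (p \<circ> linepath t q)"
      using e append.prems S path_restrict[OF p(1), of s t] path_restrict[OF p(1), of t q]
      by (intro path_class_join[OF \<tau>]) auto
    finally have split: "r s q = r s t \<otimes>\<^bsub>?G\<^esub> r t q" by (simp only: r_def)
    have cls: "?c (segment_path u (p s)) \<in> carrier ?G" "?c (segment_path (p t) v) \<in> carrier ?G"
      "?c (segment_path v (p t)) \<in> carrier ?G" "?c (segment_path (p q) w) \<in> carrier ?G"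
      using cl(2)[OF pts(1), of u] cl[OF pts(2), of v] cl(1)[OF pts(3), of w] e by simp_all
    have clp: "r s t \<in> carrier ?G" "r t q \<in> carrier ?G"
      using clr append.prems e by auto
    have "?c (segment_path (p t) v) \<otimes>\<^bsub>?G\<^esub> (?c (segment_path v (p t)) \<otimes>\<^bsub>?G\<^esub> y) = y"
      if "y \<in> carrier ?G" for y
      using that cls inv(1)[OF pts(2), of v] e by (simp flip: G.m_assoc)
    then show ?case
      using IH cls clp by (simp add: split G.m_assoc)
  qed
  then show "\<lbrakk>transport V U \<Gamma> g p s t u w c; 0 \<le> s; t \<le> 1\<rbrakk> \<Longrightarrow> c \<in> carrier \<Gamma> \<and>
    \<psi> c = ?c (segment_path u (p s)) \<otimes>\<^bsub>?G\<^esub> ?c (p \<circ> linepath s t) \<otimes>\<^bsub>?G\<^esub> ?c (segment_path (p t) w)"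
    by (simp only: r_def)
qed

end


section \<open>Splitting off a presented subcomplex\<close>

text \<open>
  This is van Kampen's theorem for a union of two complexes, where the first is given by a group \<open>K\<close>
  with a cocycle \<open>k\<close> that takes all values in \<open>K\<close>, and a homomorphism \<open>\<phi>\<close> that realises the values of \<open>k\<close>
  by segments. The last assumption expresses that the complexes meet in a part on which both cocycles
  are trivial, such as a tree that contains the base paths of its vertices.
  
  Holonomy of the combined cocycle is a homomorphism \<open>F\<close> to the free product. It is injective because
  \<open>\<psi>\<close> undoes it. It is surjective because a loop in \<open>Y\<close> has its own class as holonomy, and because the
  loop formed by the segment from \<open>u\<close> to \<open>v\<close> and two base paths in \<open>Y\<close> has holonomy \<open>k u v\<close>, base paths
  having trivial class.
\<close>

theorem fundamental_group_free_product:
  fixes A B :: "('i \<Rightarrow> real) set set" and V :: "('i \<Rightarrow> real) set"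
    and K :: "('k, 'm) monoid_scheme"
  defines "X \<equiv> \<Union>(A \<union> B)" and "Y \<equiv> \<Union>B"
  assumes complex: "star_complex (A \<union> B) V U" and a: "a \<in> V"
    and \<tau>X: "base_paths X a \<tau>" and \<tau>Y: "base_paths Y a \<sigma>"
    and \<tau>\<sigma>: "\<And>y. y \<in> Y \<Longrightarrow> \<tau> y = \<sigma> y" and \<sigma>a: "\<sigma> a = (\<lambda>_. a)" and aY: "a \<in> Y"
    and AY: "V \<inter> \<Union>A \<subseteq> Y"
    and K: "group K" and \<phi>: "\<phi> \<in> hom K (fundamental_group X a)"
    and k: "\<And>f u v. \<lbrakk>f \<in> A; u \<in> V \<inter> f; v \<in> V \<inter> f\<rbrakk> \<Longrightarrow>
        k u v \<in> carrier K \<and> \<phi> (k u v) = path_class X a \<tau> (segment_path u v)"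
    and k_cocycle: "\<And>f u v w. \<lbrakk>f \<in> A; u \<in> V \<inter> f; v \<in> V \<inter> f; w \<in> V \<inter> f\<rbrakk> \<Longrightarrow> k u v \<otimes>\<^bsub>K\<^esub> k v w = k u w"
    and k_surj: "\<And>x. x \<in> carrier K \<Longrightarrow> \<exists>f\<in>A. \<exists>u\<in>V \<inter> f. \<exists>v\<in>V \<inter> f. x = k u v"
    and common: "\<And>f b u v. \<lbrakk>f \<in> A; b \<in> B; u \<in> V \<inter> f \<inter> b; v \<in> V \<inter> f \<inter> b\<rbrakk> \<Longrightarrow>
        k u v = \<one>\<^bsub>K\<^esub> \<and> path_class Y a \<sigma> (segment_path u v) = \<one>\<^bsub>fundamental_group Y a\<^esub>"
  shows "fundamental_group X a \<cong> free_product K (fundamental_group Y a)"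
proof -
  let ?G = "fundamental_group X a" and ?H = "fundamental_group Y a"
  let ?\<Gamma> = "free_product K ?H"
  let ?cX = "path_class X a \<tau>" and ?cY = "path_class Y a \<sigma>"
  have YX: "Y \<subseteq> X" by (auto simp: X_def Y_def)
  interpret X: star_complex "A \<union> B" V U by fact
  interpret Y: star_complex B V U by (rule X.star_complex_subset) simp
  interpret K: group K by fact
  interpret H: group ?H using aY by (rule group_fundamental_group)
  have "a \<in> X" using aY YX by blast
  then interpret G: group ?G by (rule group_fundamental_group)
  interpret \<Gamma>: group ?\<Gamma> by (intro group_free_product K H.group_axioms)
  let ?inl = "free_product_inl K ?H" and ?inr = "free_product_inr K ?H"
  interpret inl: group_hom K ?\<Gamma> ?inl
    by unfold_locales (intro free_product_inl_hom K H.group_axioms)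
  interpret inr: group_hom ?H ?\<Gamma> ?inr
    by unfold_locales (intro free_product_inr_hom K H.group_axioms)

  obtain \<iota> where \<iota>: "\<iota> \<in> hom ?H ?G"
    "\<And>p. p \<in> loops_at Y a \<Longrightarrow> \<iota> (loop_rel Y a `` {p}) = loop_rel X a `` {p}"
    using fundamental_group_inclusion[OF YX aY] by blast
  have \<iota>c: "\<iota> (?cY p) = ?cX p" if p: "path p" "path_image p \<subseteq> Y" for p
  proof -
    have "pathstart p \<in> Y" "pathfinish p \<in> Y" using p by (auto simp: pathstart_in pathfinish_in)
    then show ?thesis
      using \<iota>(2)[OF path_class_loop[OF \<tau>Y p]] \<tau>\<sigma> by (simp add: path_class_def)
  qed
  obtain \<psi> where \<psi>: "\<psi> \<in> hom ?\<Gamma> ?G" "\<And>x. x \<in> carrier K \<Longrightarrow> \<psi> (?inl x) = \<phi> x"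
    "\<And>y. y \<in> carrier ?H \<Longrightarrow> \<psi> (?inr y) = \<iota> y"
    using free_product_universal[OF K H.group_axioms G.group_axioms \<phi> \<iota>(1)] by blast

  have segY: "path_image (segment_path u v) \<subseteq> Y" if "b \<in> B" "u \<in> b" "v \<in> b" for b u v
    using path_image_segment_path[OF Y.face_convex[OF that(1)] that(2,3)] that(1) by (auto simp: Y_def)
  have h_closed: "?cY (segment_path u v) \<in> carrier ?H" if "b \<in> B" "u \<in> V \<inter> b" "v \<in> V \<inter> b" for b u v
    using that segY[of b u v] by (intro path_class_closed[OF \<tau>Y]) auto
  have h_cocycle: "?cY (segment_path u v) \<otimes>\<^bsub>?H\<^esub> ?cY (segment_path v w) = ?cY (segment_path u w)"
    if "b \<in> B" "u \<in> V \<inter> b" "v \<in> V \<inter> b" "w \<in> V \<inter> b" for b u v w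
    using that by (intro path_class_segments[OF \<tau>Y Y.face_convex, of b]) (auto simp: Y_def)
  interpret D: cover_cocycle ?H Y V U "\<lambda>u v. ?cY (segment_path u v)"
    by (rule Y.cover_cocycleI[folded Y_def, OF H.group_axioms h_closed h_cocycle])

  \<comment> \<open>a pair of vertices that belongs to a face in both families has trivial value from either side\<close>
  define g where "g u v = (if \<exists>f\<in>A. u \<in> f \<and> v \<in> f then ?inl (k u v)
      else ?inr (?cY (segment_path u v)))" for u v
  have gA: "g u v = ?inl (k u v)" if "f \<in> A" "u \<in> V \<inter> f" "v \<in> V \<inter> f" for f u v
    using that by (auto simp: g_def)
  have gB: "g u v = ?inr (?cY (segment_path u v))" if b: "b \<in> B" "u \<in> V \<inter> b" "v \<in> V \<inter> b" for b u v
  proof (cases "\<exists>f\<in>A. u \<in> f \<and> v \<in> f")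
    case True
    then obtain f where "f \<in> A" "u \<in> f" "v \<in> f" by blast
    with common[of f b u v] gA[of f u v] b show ?thesis by simp
  qed (auto simp: g_def)
  have g_closed: "g u v \<in> carrier ?\<Gamma>" if "f \<in> A \<union> B" "u \<in> V \<inter> f" "v \<in> V \<inter> f" for f u v
    using that gA[of f u v] gB[of f u v] k[of f u v] h_closed[of f u v] by auto
  have g_cocycle: "g u v \<otimes>\<^bsub>?\<Gamma>\<^esub> g v w = g u w"
    if f: "f \<in> A \<union> B" and uvw: "u \<in> V \<inter> f" "v \<in> V \<inter> f" "w \<in> V \<inter> f" for f u v w
  proof (cases "f \<in> A")
    case True
    then show ?thesis
      using gA[OF True uvw(1,2)] gA[OF True uvw(2,3)] gA[OF True uvw(1,3)] k[OF True uvw(1,2)]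
        k[OF True uvw(2,3)] k_cocycle[OF True uvw] by (metis inl.hom_mult)
  next
    case False
    with f have b: "f \<in> B" by simp
    then show ?thesis
      using gB[OF b uvw(1,2)] gB[OF b uvw(2,3)] gB[OF b uvw(1,3)] h_closed[OF b uvw(1,2)]
        h_closed[OF b uvw(2,3)] h_cocycle[OF b uvw] by (metis inr.hom_mult)
  qed
  have g_\<psi>: "\<psi> (g u v) = ?cX (segment_path u v)" if "f \<in> A \<union> B" "u \<in> V \<inter> f" "v \<in> V \<inter> f" for f u v
  proof (cases "f \<in> A")
    case True
    then show ?thesis using that gA[of f u v] k[of f u v] \<psi>(2) by simp
  next
    case False
    with that have "f \<in> B" by simp
    then show ?thesis
      using that gB[of f u v] h_closed[of f u v] \<psi>(3) \<iota>c segY[of f u v] by simp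
  qed
  interpret C: cover_cocycle ?\<Gamma> X V U g
    by (rule X.cover_cocycleI[folded X_def, OF \<Gamma>.group_axioms g_closed g_cocycle])

  have aU: "a \<in> U a" using a by (rule X.vertex_in_star)
  have hol_in_Y: "C.hol p u w = ?inr (D.hol p u w)"
    if p: "path p" "path_image p \<subseteq> Y" and uw: "u \<in> V" "pathstart p \<in> U u" "w \<in> V" "pathfinish p \<in> U w"
    for p u w
  proof (rule C.hol_eq)
    have "C.tr p s t u w (?inr c)" if "D.tr p s t u w c" "0 \<le> s" "t \<le> 1" for s t u w c
      using that
    proof (induction rule: transport.induct)
      case (stay s t v)
      then have "C.tr p s t v v \<one>\<^bsub>?\<Gamma>\<^esub>" by (intro transport.stay)
      then show ?case by simp
    next
      case (switch s t u v c w)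
      note e = transport_ends[OF switch.hyps(1)]
      have im: "p ` {s..t} \<subseteq> Y" using p(2) e switch.prems by (auto simp: path_image_def)
      then have "p t \<in> Y" using e by auto
      then obtain b where b: "b \<in> B" "p t \<in> b" by (auto simp: Y_def)
      then have vw: "v \<in> V \<inter> b" "w \<in> V \<inter> b" using Y.star_face e switch.hyps by blast+
      have "C.tr p s t u w (?inr c \<otimes>\<^bsub>?\<Gamma>\<^esub> g v w)"
        using switch e by (intro transport.switch) auto
      then show ?case
        using gB[OF b(1) vw] h_closed[OF b(1) vw] D.transport_closed[OF switch.hyps(1) im] by simp
    next
      case (append s t u v c r w d)
      note e = transport_ends[OF append.hyps(1)] transport_ends[OF append.hyps(2)]
      have im: "p ` {s..t} \<subseteq> Y" "p ` {t..r} \<subseteq> Y"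
        using p(2) e append.prems by (auto simp: path_image_def)
      have "C.tr p s r u w (?inr c \<otimes>\<^bsub>?\<Gamma>\<^esub> ?inr d)"
        using append e by (intro transport.append) auto
      then show ?case
        using D.transport_closed[OF append.hyps(1) im(1)] D.transport_closed[OF append.hyps(2) im(2)]
        by simp
    qed
    then show "C.tr p 0 1 u w (?inr (D.hol p u w))"
      using D.transport_hol[OF p uw] by simp
  qed (use p YX in auto)
  have restrict_all: "q \<circ> linepath 0 1 = q" for q :: "real \<Rightarrow> 'i \<Rightarrow> real"
    by (simp add: fun_eq_iff linepath_def)
  have hol_Y: "D.hol p u w = ?cY (segment_path u (pathstart p)) \<otimes>\<^bsub>?H\<^esub> ?cY p \<otimes>\<^bsub>?H\<^esub> ?cY (segment_path (pathfinish p) w)"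
    if p: "path p" "path_image p \<subseteq> Y" and uw: "u \<in> V" "pathstart p \<in> U u" "w \<in> V" "pathfinish p \<in> U w"
    for p u w
    using Y.path_class_transport[folded Y_def, OF \<tau>Y H.group_axioms iso_imp_homomorphism[OF iso_set_refl] _ p D.transport_hol[OF p uw]]
      h_closed by (simp add: restrict_all pathstart_def pathfinish_def)
  have hol_Y_vertices: "C.hol p (pathstart p) (pathfinish p) = ?inr (?cY p)"
    if p: "path p" "path_image p \<subseteq> Y" and "pathstart p \<in> V" "pathfinish p \<in> V" for p
  proof -
    have "pathstart p \<in> Y" "pathfinish p \<in> Y" using p by (auto simp: pathstart_in pathfinish_in)
    then show ?thesis
      using that X.vertex_in_star hol_in_Y[OF p, of "pathstart p" "pathfinish p"]
        hol_Y[OF p, of "pathstart p" "pathfinish p"] path_class_closed[OF \<tau>Y p]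
      by (simp add: path_class_const[OF \<tau>Y])
  qed

  have loops: "path p" "path_image p \<subseteq> X" "pathstart p = a" "pathfinish p = a"
    if "p \<in> loops_at X a" for p
    using that by (auto simp: loops_at_def)
  obtain F where F: "F \<in> hom ?G ?\<Gamma>" "\<And>p. p \<in> loops_at X a \<Longrightarrow> F (loop_rel X a `` {p}) = C.hol p a a"
  proof (rule fundamental_group_induced_hom[of X a "\<lambda>p. C.hol p a a" ?\<Gamma>])
    show "C.hol p a a \<in> carrier ?\<Gamma>" if "p \<in> loops_at X a" for p
      using loops[OF that] a aU C.transport_hol[of p a a]
      by (intro C.transport_closed[of p 0 1 a a]) (auto simp: path_image_def)
    show "C.hol p a a = C.hol q a a"
      if "p \<in> loops_at X a" "q \<in> loops_at X a" "homotopic_paths X p q" for p q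
      using loops[OF that(1)] that(3) a aU by (intro C.hol_homotopic) auto
    show "C.hol (p +++ q) a a = C.hol p a a \<otimes>\<^bsub>?\<Gamma>\<^esub> C.hol q a a"
      if "p \<in> loops_at X a" "q \<in> loops_at X a" for p q
      using loops[OF that(1)] loops[OF that(2)] a aU by (intro C.hol_join) auto
  qed (rule that)
  interpret F: group_hom ?G ?\<Gamma> F by unfold_locales (fact F)

  have left_inverse: "\<psi> (F x) = x" if x: "x \<in> carrier ?G" for x
  proof -
    obtain p where p: "p \<in> loops_at X a" "x = loop_rel X a `` {p}"
      using x by (auto simp: carrier_fundamental_group)
    note p' = loops[OF p(1)]
    have "\<tau> a = (\<lambda>_. a)" using \<tau>\<sigma>[OF aY] \<sigma>a by simp
    then have cp: "?cX p = x" using path_class_of_loop[OF \<tau>X _ p(1)] p(2) by simp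
    have "C.tr p 0 1 a a (C.hol p a a)" using p' a aU by (intro C.transport_hol) auto
    then have "\<psi> (C.hol p a a) = ?cX (segment_path a (p 0)) \<otimes>\<^bsub>?G\<^esub> ?cX (p \<circ> linepath 0 1) \<otimes>\<^bsub>?G\<^esub> ?cX (segment_path (p 1) a)"
      using X.path_class_transport[folded X_def, OF \<tau>X \<Gamma>.group_axioms \<psi>(1) _ p'(1,2), of g 0 1 a a "C.hol p a a"] g_closed g_\<psi>
      by simp
    moreover have "p 0 = a" "p 1 = a" using p'(3,4) by (auto simp: pathstart_def pathfinish_def)
    ultimately show ?thesis
      using F(2)[OF p(1)] p(2) cp x \<open>a \<in> X\<close> by (simp add: restrict_all path_class_const[OF \<tau>X])
  qed

  have "F ` carrier ?G = carrier ?\<Gamma>"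
  proof
    show "F ` carrier ?G \<subseteq> carrier ?\<Gamma>" by auto
    show "carrier ?\<Gamma> \<subseteq> F ` carrier ?G"
    proof (rule free_product_generated[OF K H.group_axioms F.img_is_subgroup])
      fix y assume "y \<in> carrier ?H"
      then obtain p where p: "p \<in> loops_at Y a" "y = loop_rel Y a `` {p}"
        by (auto simp: carrier_fundamental_group)
      have p': "path p" "path_image p \<subseteq> Y" "pathstart p = a" "pathfinish p = a"
        using p(1) by (auto simp: loops_at_def)
      have pX: "p \<in> loops_at X a" using p(1) YX by (auto simp: loops_at_def)
      have "?inr y = F (loop_rel X a `` {p})"
        using F(2)[OF pX] hol_Y_vertices[OF p'(1,2)] a p'(3,4) p(2)
          path_class_of_loop[OF \<tau>Y \<sigma>a p(1)] by simp
      then show "?inr y \<in> F ` carrier ?G"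
        using pX by (auto simp: carrier_fundamental_group)
    next
      fix x assume "x \<in> carrier K"
      then obtain f u v where f: "f \<in> A" "u \<in> V \<inter> f" "v \<in> V \<inter> f" "x = k u v" using k_surj by blast
      have uvY: "u \<in> Y" "v \<in> Y" using f AY by auto
      then have uvX: "u \<in> X" "v \<in> X" using YX by auto
      have uvU: "u \<in> U u" "v \<in> U v" using f X.vertex_in_star by auto
      note bu = base_pathsD[OF \<tau>Y uvY(1)] and bv = base_pathsD[OF \<tau>Y uvY(2)]
      let ?l = "segment_path u v" and ?u = "\<sigma> u" and ?v = "reversepath (\<sigma> v)"
      have l: "path_image ?l \<subseteq> f" using f by (intro path_image_segment_path X.face_convex) auto
      have fX: "f \<subseteq> X" using f(1) by (auto simp: X_def)
      have im: "path_image ?l \<subseteq> X" "path_image ?u \<subseteq> X" "path_image ?v \<subseteq> X"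
        using l fX bu(2) bv(2) YX by auto
      have loop: "?u +++ ?l +++ ?v \<in> loops_at X a"
        using im bu bv by (simp add: loops_at_def subset_path_image_join)
      have "F (loop_rel X a `` {?u +++ ?l +++ ?v}) = C.hol (?u +++ ?l +++ ?v) a a"
        by (rule F(2)[OF loop])
      also have "\<dots> = C.hol ?u a u \<otimes>\<^bsub>?\<Gamma>\<^esub> C.hol (?l +++ ?v) u a"
        using im bu bv f uvU a aU by (intro C.hol_join) (auto simp: subset_path_image_join)
      also have "C.hol (?l +++ ?v) u a = C.hol ?l u v \<otimes>\<^bsub>?\<Gamma>\<^esub> C.hol ?v v a"
        using im bu bv f uvU a aU by (intro C.hol_join) auto
      also have "C.hol ?u a u = \<one>\<^bsub>?\<Gamma>\<^esub>"
        using hol_Y_vertices[of ?u] bu f a path_class_base_path[where \<tau> = \<sigma>, OF \<tau>Y \<sigma>a uvY(1)] by simp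
      also have "C.hol ?v v a = \<one>\<^bsub>?\<Gamma>\<^esub>"
      proof -
        have "?cY ?v = ?cY (\<sigma> v) \<otimes>\<^bsub>?H\<^esub> ?cY ?v"
          using path_class_base_path[where \<tau> = \<sigma>, OF \<tau>Y \<sigma>a uvY(2)] path_class_closed[OF \<tau>Y, of ?v] bv by simp
        also have "\<dots> = ?cY (\<sigma> v +++ ?v)"
          using bv by (intro path_class_join[OF \<tau>Y, symmetric]) auto
        also have "\<dots> = ?cY (\<lambda>_. a)"
          using homotopic_paths_reverse_join[of ?v Y] bv by (intro path_class_cong[OF \<tau>Y]) simp
        also have "\<dots> = \<one>\<^bsub>?H\<^esub>" by (rule path_class_const[OF \<tau>Y aY])
        finally show ?thesis using hol_Y_vertices[of ?v] bv f a by simp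
      qed
      also have "C.hol ?l u v = g u v"
      proof -
        have "C.tr ?l 0 1 u v (C.hol ?l u v)"
          using im f uvU by (intro C.transport_hol) auto
        moreover have "?l ` {0..1} \<subseteq> f" using l by (simp add: path_image_def)
        ultimately show ?thesis
          using X.transport_in_face[OF \<Gamma>.group_axioms, of f g ?l 0 1 u v "C.hol ?l u v"] f g_closed[of f] g_cocycle[of f]
          by blast
      qed
      also have "g u v = ?inl x" using gA f by simp
      finally have "F (loop_rel X a `` {?u +++ ?l +++ ?v}) = ?inl x"
        using \<open>x \<in> carrier K\<close> by simp
      moreover have "loop_rel X a `` {?u +++ ?l +++ ?v} \<in> carrier ?G"
        using loop by (auto simp: carrier_fundamental_group)
      ultimately show "?inl x \<in> F ` carrier ?G" by (metis imageI)
    qed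
  qed
  moreover have "inj_on F (carrier ?G)"
    using left_inverse by (rule inj_on_inverseI)
  ultimately have "F \<in> iso ?G ?\<Gamma>" using F(1) by (simp add: iso_def bij_betw_def)
  then show ?thesis by (rule is_isoI)
qed


section \<open>Faces and vertex stars of the cube\<close>

definition cube_vertex :: "nat set \<Rightarrow> nat \<Rightarrow> real" where
  "cube_vertex Z = (\<lambda>i. of_bool (i \<in> Z))"

definition cube_star :: "nat \<Rightarrow> (nat \<Rightarrow> real) \<Rightarrow> (nat \<Rightarrow> real) set" where
  "cube_star n v = {x. \<forall>i<n. \<bar>x i - v i\<bar> < 1}"

lemma cube_vertex_in_face: "cube_vertex Z \<in> cube_face S W \<longleftrightarrow> (\<forall>i. i \<notin> S \<longrightarrow> (i \<in> Z \<longleftrightarrow> i \<in> W))"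
  by (auto simp: cube_vertex_def cube_face_def)

lemma inj_cube_vertex [simp]: "cube_vertex Z = cube_vertex Z' \<longleftrightarrow> Z = Z'"
  by (auto simp: cube_vertex_def fun_eq_iff)

lemma cube_face_cong: "(\<And>i. i \<notin> S \<Longrightarrow> i \<in> W \<longleftrightarrow> i \<in> W') \<Longrightarrow> cube_face S W = cube_face S W'"
  by (auto simp: cube_face_def)

text \<open>
  The free coordinates of a face can be recovered from its points.
\<close>

lemma cube_face_free_coordinates: "S = {i. \<exists>x\<in>cube_face S W. x i = 1/2}"
proof -
  have "(\<lambda>i. if i \<in> S then 1/2 else of_bool (i \<in> W)) \<in> cube_face S W"
    by (auto simp: cube_face_def)
  then have "\<exists>x\<in>cube_face S W. x i = 1/2" if "i \<in> S" for i
    using that by (metis (mono_tags, lifting))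
  moreover have "x i \<noteq> 1/2" if "x \<in> cube_face S W" "i \<notin> S" for x i
    using that by (auto simp: cube_face_def)
  ultimately show ?thesis by blast
qed

lemma cube_face_eqD:
  assumes "cube_face S W = cube_face S' W'"
  shows "S = S'" "i \<notin> S \<Longrightarrow> i \<in> W \<longleftrightarrow> i \<in> W'"
proof -
  show S: "S = S'" using cube_face_free_coordinates[of S W] cube_face_free_coordinates[of S' W'] assms by simp
  have "cube_vertex W \<in> cube_face S' W'" using assms cube_vertex_in_face by metis
  then show "i \<notin> S \<Longrightarrow> i \<in> W \<longleftrightarrow> i \<in> W'" using S by (simp add: cube_vertex_in_face)
qed

lemma cube_faceI:
  "\<lbrakk>S \<subseteq> {..<n}; card S = k; W \<subseteq> {..<n}\<rbrakk> \<Longrightarrow> cube_face S W \<in> cube_faces n k"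
  unfolding cube_faces_def
  by (intro CollectI exI[of _ S] exI[of _ "W - S"] conjI cube_face_cong) auto

lemma segment_convex_cube_face: "segment_convex (cube_face S W)"
proof -
  have "segment_path x y t \<in> cube_face S W"
    if x: "x \<in> cube_face S W" and y: "y \<in> cube_face S W" and t: "t \<in> {0..1}" for x y t
  proof -
    have "if i \<in> S then 0 \<le> (1 - t) * x i + t * y i \<and> (1 - t) * x i + t * y i \<le> 1
        else (1 - t) * x i + t * y i = of_bool (i \<in> W)" for i
    proof (cases "i \<in> S")
      case True
      then have b: "x i \<in> {0..1}" "y i \<in> {0..1}" using x y by (auto simp: cube_face_def)
      then have "(1 - t) * x i + t * y i \<le> (1 - t) * 1 + t * 1"
        using t by (intro add_mono mult_left_mono) auto
      with b t True show ?thesis by simp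
    next
      case False
      then have "x i = of_bool (i \<in> W)" "y i = of_bool (i \<in> W)"
        using x y by (auto simp: cube_face_def)
      with False show ?thesis by (simp add: algebra_simps)
    qed
    then show ?thesis unfolding cube_face_def segment_path_def by blast
  qed
  then show ?thesis by (simp add: segment_convex_def)
qed

lemma segment_convex_cube_star: "segment_convex (cube_star n v)"
proof -
  have "\<bar>(1 - t) * x + t * y - c\<bar> < 1" if "\<bar>x - c\<bar> < 1" "\<bar>y - c\<bar> < 1" "t \<in> {0..1}" for x y c t :: real
  proof -
    have "x \<in> {c-1<..<c+1}" "y \<in> {c-1<..<c+1}" using that by auto
    then have "(1 - t) *\<^sub>R x + t *\<^sub>R y \<in> {c-1<..<c+1}"
      using that(3) convex_real_interval(8)[of "c-1" "c+1"] unfolding convex_alt by simp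
    then show ?thesis by auto
  qed
  then show ?thesis by (simp add: segment_convex_def segment_path_def cube_star_def)
qed

lemma open_cube_star: "open (cube_star n v)"
proof -
  have "cube_star n v = (\<Inter>i\<in>{..<n}. {x. \<bar>x i - v i\<bar> < 1})" by (auto simp: cube_star_def)
  also have "open \<dots>"
    by (intro open_INT ballI finite_lessThan open_Collect_less continuous_intros
        continuous_on_product_coordinates)
  finally show ?thesis .
qed

text \<open>
  The vertex obtained by rounding the coordinates of a point has the point in its star. A coordinate
  that is constantly 0 or 1 on a face has the same value at each vertex whose star meets the face, as it
  differs by less than 1.
\<close>

lemma star_complex_cube:
  assumes "F \<subseteq> (\<Union>k. cube_faces n k)"
  shows "star_complex F (cube_vertex ` Pow {..<n}) (cube_star n)"
proof
  fix f assume "f \<in> F"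
  then obtain S W where f: "f = cube_face S W" "S \<subseteq> {..<n}" "W \<subseteq> {..<n}"
    using assms unfolding cube_faces_def by blast
  show "segment_convex f" unfolding f by (rule segment_convex_cube_face)
  fix x assume x: "x \<in> f"
  show "\<exists>v\<in>cube_vertex ` Pow {..<n}. x \<in> cube_star n v"
  proof (intro bexI imageI)
    let ?Z = "{i\<in>{..<n}. x i > 1/2}"
    show "x \<in> cube_star n (cube_vertex ?Z)"
    proof -
      have "\<bar>x i - of_bool (x i > 1/2)\<bar> < 1" for i
        using x f(1) by (auto simp: cube_face_def split: if_splits)
          (smt (verit, best) of_bool_eq field_sum_of_halves)+
      then show ?thesis by (simp add: cube_star_def cube_vertex_def)
    qed
  qed auto
  fix v assume v: "v \<in> cube_vertex ` Pow {..<n}" "x \<in> cube_star n v"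
  then obtain Z where Z: "v = cube_vertex Z" "Z \<subseteq> {..<n}" by auto
  have "i \<in> Z \<longleftrightarrow> i \<in> W" if "i \<notin> S" for i
  proof (cases "i < n")
    case True
    then have "\<bar>x i - of_bool (i \<in> Z)\<bar> < 1" "x i = of_bool (i \<in> W)"
      using v(2) x that by (auto simp: Z f cube_star_def cube_vertex_def cube_face_def)
    then show ?thesis by (auto simp: of_bool_def split: if_splits)
  qed (use Z f in auto)
  then show "v \<in> f" by (simp add: Z f cube_vertex_in_face)
next
  fix v show "v \<in> cube_star n v" by (simp add: cube_star_def)
qed (rule segment_convex_cube_star open_cube_star)+


section \<open>The projective plane in the five-dimensional cube\<close>

text \<open>
  Consider sets of residues modulo 5. The triples \<open>{i, i+1, i+3}\<close> are the triangles of a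
  Moebius band on five points, in which each pair \<open>{i, i+2}\<close> is an edge of two triangles and each pair
  \<open>{i, i+1}\<close> of one. The boundary is the pentagon with the edges \<open>{i, i+1}\<close>, and filling it with a disc
  gives a projective plane.
  
  In the cube, a triple \<open>T\<close> is divided into the three squares spanned by the sets between \<open>{a}\<close> and
  \<open>T\<close>, for \<open>a\<close> in \<open>T\<close>; the disc consists of the five squares spanned by the subsets of \<open>{i, i+1}\<close>, which
  meet at the empty set. A square is given as \<open>(S, W)\<close>, with free coordinates \<open>S\<close> and smallest vertex
  \<open>W\<close>; an edge is given as \<open>(a, i)\<close>, with ends \<open>a\<close> and \<open>insert i a\<close>.
\<close>

definition rp2_triple :: "nat \<Rightarrow> nat set" where
  "rp2_triple i = {i, (i + 1) mod 5, (i + 3) mod 5}"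

definition rp2_faces :: "(nat set \<times> nat set) set" where
  "rp2_faces = (\<lambda>i. ({i, (i + 1) mod 5}, {})) ` {..<5} \<union>
     (\<lambda>(i, a). (rp2_triple i - {a}, {a})) ` (SIGMA i:{..<5}. rp2_triple i)"

definition rp2_edges :: "(nat set \<times> nat) set" where
  "rp2_edges = Pair {} ` {..<5} \<union> (\<lambda>(a, i). ({a}, i)) ` (SIGMA a:{..<5}. {..<5} - {a}) \<union>
     (\<lambda>(i, a). (rp2_triple i - {a}, a)) ` (SIGMA i:{..<5}. rp2_triple i)"

text \<open>
  A spanning tree, directed away from the root \<open>{}\<close>. Every step adds one element, so that the
  cardinality of a vertex is its depth.
\<close>

definition rp2_tree :: "(nat set \<times> nat set) set" where
  "rp2_tree = (\<Union>i<5. {({}, {i}), ({i}, {i, (i + 1) mod 5}), ({i}, {i, (i + 2) mod 5}),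
     ({i, (i + 1) mod 5}, rp2_triple i)})"

text \<open>
  The cocycle of the orientation double cover. Over the star of the singleton \<open>{e}\<close>, which is
  formed by the vertices containing \<open>e\<close>, the double cover is trivial, and \<open>rp2_sheet e\<close> is a labelling of
  the sheets there; on the disc around \<open>{}\<close> all labels are equal. Two vertices with a common element are
  compared over the star of that element; by \<open>rp2_cocycle_triple\<close> the choice of the element
  does not matter for vertices of one triangle.
\<close>

definition rp2_sheet :: "nat \<Rightarrow> nat set \<Rightarrow> bool" where
  "rp2_sheet e Z \<longleftrightarrow> (e + 3) mod 5 \<in> Z \<and> (e + 1) mod 5 \<notin> Z"

definition rp2_cocycle :: "nat set \<Rightarrow> nat set \<Rightarrow> int" where
  "rp2_cocycle Z Z' = (if Z \<inter> Z' = {} then 0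
     else of_bool (rp2_sheet (Min (Z \<inter> Z')) Z \<noteq> rp2_sheet (Min (Z \<inter> Z')) Z'))"

lemma lessThan_5: "{..<5::nat} = {0, 1, 2, 3, 4}"
  by auto

lemma card_rp2_triple: "i < 5 \<Longrightarrow> card (rp2_triple i) = 3"
proof -
  have "\<forall>i\<in>{0,1,2,3,4}. card (rp2_triple i) = 3" by (simp add: rp2_triple_def)
  then show "i < 5 \<Longrightarrow> card (rp2_triple i) = 3" unfolding lessThan_5[symmetric] by simp
qed

lemma card_rp2_flags: "card (SIGMA i:{..<5}. rp2_triple i) = 15"
proof -
  have "card (SIGMA i:{..<5}. rp2_triple i) = (\<Sum>i<5. card (rp2_triple i))"
    by (rule card_SigmaI) (auto simp: rp2_triple_def)
  also have "\<dots> = (\<Sum>i<5::nat. 3)" by (intro sum.cong card_rp2_triple) auto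
  finally show ?thesis by simp
qed

lemma rp2_triple_subset: "i < 5 \<Longrightarrow> rp2_triple i \<subseteq> {..<5}"
  by (auto simp: rp2_triple_def)

lemma card_rp2_faces: "card rp2_faces \<le> 20"
proof -
  have "card rp2_faces \<le> card {..<5::nat} + card (SIGMA i:{..<5}. rp2_triple i)"
    unfolding rp2_faces_def by (intro order_trans[OF card_Un_le] add_mono card_image_le)
      (auto simp: rp2_triple_def)
  also have "\<dots> = 20" by (simp add: card_rp2_flags)
  finally show ?thesis .
qed

lemma card_rp2_edges: "card rp2_edges \<le> 40"
proof -
  have "card rp2_edges \<le> card {..<5::nat} + card (SIGMA a:{..<5::nat}. {..<5} - {a}) +
      card (SIGMA i:{..<5}. rp2_triple i)"
    unfolding rp2_edges_def by (intro order_trans[OF card_Un_le] add_mono card_image_le)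
      (auto simp: rp2_triple_def)
  also note card_rp2_flags
  also have "card (SIGMA a:{..<5::nat}. {..<5} - {a}) = 20"
    by (subst card_SigmaI) auto
  finally show ?thesis by simp
qed

lemma finite_rp2_edges: "finite rp2_edges"
  by (auto simp: rp2_edges_def rp2_triple_def)

lemma rp2_faces_cases:
  assumes "(S, W) \<in> rp2_faces"
  obtains (pentagon) i where "i < 5" "S = {i, (i + 1) mod 5}" "W = {}"
  | (triple) i a where "i < 5" "a \<in> rp2_triple i" "S = rp2_triple i - {a}" "W = {a}"
  using assms unfolding rp2_faces_def by auto

lemma rp2_face_props:
  assumes "(S, W) \<in> rp2_faces"
  shows "S \<subseteq> {..<5}" "W \<subseteq> {..<5}" "card S = 2" "S \<inter> W = {}"
proof -
  have "S \<subseteq> {..<5} \<and> W \<subseteq> {..<5} \<and> card S = 2 \<and> S \<inter> W = {}"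
    using assms
  proof (cases rule: rp2_faces_cases)
    case (pentagon i)
    have "i \<noteq> (i + 1) mod 5" using pentagon(1) by presburger
    with pentagon show ?thesis by auto
  next
    case (triple i a)
    then show ?thesis
      using rp2_triple_subset[of i] card_rp2_triple[of i] by (auto simp: card_Diff_singleton)
  qed
  then show "S \<subseteq> {..<5}" "W \<subseteq> {..<5}" "card S = 2" "S \<inter> W = {}" by auto
qed

lemma rp2_face_edge:
  assumes "(S, W) \<in> rp2_faces" "W \<subseteq> Z" "Z \<subseteq> W \<union> S" "j \<in> S - Z"
  shows "(Z, j) \<in> rp2_edges"
  using assms(1)
proof (cases rule: rp2_faces_cases)
  case (pentagon i)
  have lt: "i < 5" "(i + 1) mod 5 < 5" using pentagon by auto
  have "i \<noteq> (i + 1) mod 5" using pentagon(1) by presburger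
  moreover have "Z \<subseteq> {i, (i + 1) mod 5} - {j}" "j \<in> {i, (i + 1) mod 5}"
    using assms pentagon by auto
  ultimately have "Z = {} \<or> (\<exists>b\<in>{i, (i + 1) mod 5} - {j}. Z = {b})"
    by (auto dest!: subset_singletonD simp: insert_Diff_if)
  then show ?thesis using assms(4) lt unfolding rp2_edges_def pentagon(2) by auto
next
  case (triple i a)
  obtain x y where "S = {x, y}" "x \<noteq> y"
    using rp2_face_props(3)[OF assms(1)] by (auto simp: card_2_iff)
  then have "\<exists>b. S = {j, b} \<and> b \<noteq> j" using assms(4) by (cases "j = x") auto
  then obtain b where b: "S = {j, b}" "b \<noteq> j" by blast
  have T: "rp2_triple i = {a, j, b}" "a \<noteq> j" "a \<noteq> b" using triple b by auto
  have "Z = {a} \<or> Z = {a, b}" using assms b triple by auto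
  then show ?thesis
  proof
    assume "Z = {a}"
    then show ?thesis
      using T rp2_triple_subset[OF triple(1)] unfolding rp2_edges_def by auto
  next
    assume "Z = {a, b}"
    then have "Z = rp2_triple i - {j}" "j \<in> rp2_triple i" using T b by auto
    then show ?thesis using triple(1) unfolding rp2_edges_def by auto
  qed
qed

lemma rp2_treeE:
  assumes "(W, Z) \<in> rp2_tree"
  obtains i where "i < 5" "i \<notin> W" "Z = insert i W" "W \<subseteq> {..<5}" "W = {} \<or> W \<in> Range rp2_tree"
proof -
  have "\<forall>(W, Z)\<in>rp2_tree. \<exists>i\<in>{0,1,2,3,4}. i \<notin> W \<and> Z = insert i W \<and> W \<subseteq> {0,1,2,3,4} \<and>
      (W = {} \<or> W \<in> Range rp2_tree)"
    unfolding rp2_tree_def lessThan_5 rp2_triple_def Range_snd by code_simp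
  from bspec[OF this assms] obtain i where
    "i < 5" "i \<notin> W" "Z = insert i W" "W \<subseteq> {..<5}" "W = {} \<or> W \<in> Range rp2_tree"
    unfolding lessThan_5[symmetric] by auto
  then show thesis by (rule that)
qed

lemma rp2_tree_functional:
  assumes "(W, Z) \<in> rp2_tree" "(W', Z) \<in> rp2_tree"
  shows "W = W'"
proof -
  have "\<forall>(W, Z)\<in>rp2_tree. \<forall>(W', Z')\<in>rp2_tree. Z = Z' \<longrightarrow> W = W'"
    unfolding rp2_tree_def lessThan_5 rp2_triple_def by code_simp
  with assms show ?thesis by blast
qed

lemma rp2_cocycle_tree:
  "(W, Z) \<in> rp2_tree \<Longrightarrow> rp2_cocycle W Z = 0 \<and> rp2_cocycle Z W = 0"
proof -
  have "\<forall>(W, Z)\<in>rp2_tree. rp2_cocycle W Z = 0 \<and> rp2_cocycle Z W = 0"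
    unfolding rp2_tree_def lessThan_5 rp2_triple_def rp2_cocycle_def rp2_sheet_def by code_simp
  then show "(W, Z) \<in> rp2_tree \<Longrightarrow> rp2_cocycle W Z = 0 \<and> rp2_cocycle Z W = 0" by blast
qed

lemma rp2_cocycle_pentagon:
  assumes "i < 5" "Z \<subseteq> {i, (i + 1) mod 5}" "Z' \<subseteq> {i, (i + 1) mod 5}"
  shows "rp2_cocycle Z Z' = 0"
proof -
  have "\<forall>i\<in>{0,1,2,3,4}. \<forall>Z\<in>Pow {i, (i + 1) mod 5}. \<forall>Z'\<in>Pow {i, (i + 1) mod 5}. rp2_cocycle Z Z' = 0"
    unfolding rp2_cocycle_def rp2_sheet_def by code_simp
  with assms show ?thesis unfolding lessThan_5[symmetric] by simp
qed

lemma rp2_cocycle_triple: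
  assumes "i < 5" "a \<in> rp2_triple i" "{a} \<subseteq> Z" "Z \<subseteq> rp2_triple i" "{a} \<subseteq> Z'" "Z' \<subseteq> rp2_triple i"
  shows "rp2_cocycle Z Z' = of_bool (rp2_sheet a Z \<noteq> rp2_sheet a Z')"
proof -
  have "\<forall>i\<in>{0,1,2,3,4}. \<forall>Z\<in>Pow (rp2_triple i). \<forall>Z'\<in>Pow (rp2_triple i).
      \<forall>a\<in>rp2_triple i. a \<in> Z \<longrightarrow> a \<in> Z' \<longrightarrow> rp2_cocycle Z Z' = of_bool (rp2_sheet a Z \<noteq> rp2_sheet a Z')"
    unfolding rp2_cocycle_def rp2_sheet_def rp2_triple_def by code_simp
  with assms show ?thesis unfolding lessThan_5[symmetric] by simp
qed

lemma rp2_sheet_simps: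
  assumes "i < 5"
  shows "\<not> rp2_sheet i {i} \<and> \<not> rp2_sheet i {i, (i + 1) mod 5} \<and>
    \<not> rp2_sheet i {i, (i + 2) mod 5} \<and> rp2_sheet i {i, (i + 3) mod 5} \<and>
    \<not> rp2_sheet ((i + 1) mod 5) {i, (i + 1) mod 5} \<and>
    \<not> rp2_sheet i (rp2_triple i) \<and> \<not> rp2_sheet ((i + 1) mod 5) (rp2_triple i) \<and>
    rp2_sheet ((i + 3) mod 5) (rp2_triple i)" (is "?P i")
proof -
  have "\<forall>i\<in>{0,1,2,3,4}. ?P i"
    unfolding rp2_sheet_def rp2_triple_def by code_simp
  with assms show ?thesis unfolding lessThan_5[symmetric] by simp
qed

text \<open>
  The twenty squares and the tree determine all values of \<open>C\<close> up to one element \<open>t\<close> with square 1. The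
  disc around \<open>{}\<close> has trivial values. Let \<open>y i\<close> be the value on the edge from \<open>{i}\<close> to \<open>{i, i+3}\<close>. The
  three squares of the \<open>i\<close>-th triple give \<open>y i \<otimes> y (i+3) = \<one>\<close>. As 3 generates the residues modulo 5 and 5
  is odd, going round once gives \<open>y 0 = inv (y 0)\<close>.
\<close>

lemma rp2_labels:
  fixes G (structure) and C :: "nat set \<Rightarrow> nat set \<Rightarrow> 'g"
  assumes "group G"
    and closed: "\<And>S W Z Z'. \<lbrakk>(S, W) \<in> rp2_faces; W \<subseteq> Z; Z \<subseteq> W \<union> S; W \<subseteq> Z'; Z' \<subseteq> W \<union> S\<rbrakk> \<Longrightarrow> C Z Z' \<in> carrier G"
    and cocycle: "\<And>S W Z Z' Z''. \<lbrakk>(S, W) \<in> rp2_faces; W \<subseteq> Z; Z \<subseteq> W \<union> S; W \<subseteq> Z'; Z' \<subseteq> W \<union> S;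
        W \<subseteq> Z''; Z'' \<subseteq> W \<union> S\<rbrakk> \<Longrightarrow> C Z Z' \<otimes> C Z' Z'' = C Z Z''"
    and tree: "\<And>W Z. (W, Z) \<in> rp2_tree \<Longrightarrow> C W Z = \<one>"
  obtains t where "t \<in> carrier G" "t \<otimes> t = \<one>"
    "\<And>S W Z Z'. \<lbrakk>(S, W) \<in> rp2_faces; W \<subseteq> Z; Z \<subseteq> W \<union> S; W \<subseteq> Z'; Z' \<subseteq> W \<union> S\<rbrakk> \<Longrightarrow>
        C Z Z' = (if rp2_cocycle Z Z' = 0 then \<one> else t)"
proof -
  interpret group G by fact
  define T where "T = rp2_triple"
  define s1 s2 s3 where "s1 i = (i + 1) mod 5" and "s2 i = (i + 2) mod 5" and "s3 i = (i + 3) mod 5" for i :: nat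
  have T: "T i = {i, s1 i, s3 i}" for i by (simp add: T_def rp2_triple_def s1_def s3_def)
  have lt: "s1 i < 5" "s3 i < 5" for i by (simp_all add: s1_def s3_def)
  have s: "s2 (s1 i) = s3 i" "s3 (s3 i) = s1 i" for i unfolding s1_def s2_def s3_def by presburger+
  have s': "s2 (s3 i) = i" if "i < 5" for i using that unfolding s2_def s3_def by presburger
  have trees: "C {} {i} = \<one>" "C {i} {i, s1 i} = \<one>" "C {i} {i, s2 i} = \<one>" "C {i, s1 i} (T i) = \<one>"
    if "i < 5" for i
    using that by (auto intro!: tree simp: rp2_tree_def T_def s1_def s2_def)

  \<comment> \<open>around \<open>{}\<close> all values are trivial\<close>
  have pent: "({i, s1 i}, {}) \<in> rp2_faces" if "i < 5" for i
    using that by (auto simp: rp2_faces_def s1_def)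
  have pentC: "C Z Z' \<in> carrier G" "C Z Z' \<otimes> C Z' Z'' = C Z Z''"
    if "i < 5" "Z \<subseteq> {i, s1 i}" "Z' \<subseteq> {i, s1 i}" "Z'' \<subseteq> {i, s1 i}" for i Z Z' Z''
    using closed[OF pent[OF that(1)], of Z Z'] cocycle[OF pent[OF that(1)], of Z Z' Z''] that by auto
  have pent_refl: "C Z Z = \<one>" if "i < 5" "Z \<subseteq> {i, s1 i}" for i Z
    using pentC[OF that(1,2,2,2)] by (simp add: l_cancel_one')
  have pent0: "C {} Z = \<one>" if i: "i < 5" and Z: "Z \<subseteq> {i, s1 i}" for i Z
  proof -
    have "Z = {} \<or> Z = {i} \<or> Z = {s1 i} \<or> Z = {i, s1 i}" using Z by auto
    moreover have "C {} {i, s1 i} = \<one>"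
      using pentC(2)[OF i, of "{}" "{i}" "{i, s1 i}"] trees[OF i] by simp
    ultimately show ?thesis using trees(1)[OF i] trees(1)[OF lt(1)[of i]] pent_refl[OF i, of "{}"] by auto
  qed
  have pent1: "C Z Z' = \<one>" if "i < 5" "Z \<subseteq> {i, s1 i}" "Z' \<subseteq> {i, s1 i}" for i Z Z'
    using pentC(2)[OF that(1), of "{}" Z Z'] pentC(1)[OF that(1,2,3,3)] pent0[OF that(1)] that by simp

  \<comment> \<open>in the squares of a triple all values are expressed by \<open>y\<close>\<close>
  have tri: "(T i - {a}, {a}) \<in> rp2_faces" if "i < 5" "a \<in> T i" for i a
    using that by (auto simp: rp2_faces_def T_def)
  have triC: "C Z Z' \<in> carrier G" "C Z Z' \<otimes> C Z' Z'' = C Z Z''"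
    if "i < 5" "a \<in> T i" "a \<in> Z" "Z \<subseteq> T i" "a \<in> Z'" "Z' \<subseteq> T i" "a \<in> Z''" "Z'' \<subseteq> T i" for i a Z Z' Z''
    using closed[OF tri[OF that(1,2)], of Z Z'] cocycle[OF tri[OF that(1,2)], of Z Z' Z''] that by auto
  have tri_refl: "C Z Z = \<one>" if "i < 5" "a \<in> T i" "a \<in> Z" "Z \<subseteq> T i" for i a Z
    using triC[OF that that(3,4,3,4)] by (simp add: l_cancel_one')
  define y where "y i = C {i} {i, s3 i}" for i
  have y: "y i \<in> carrier G" if "i < 5" for i
    using triC(1)[OF that, of i "{i}" "{i, s3 i}" "{i}"] by (simp add: T y_def)
  have base_i: "C {i} (T i) = \<one>" if i: "i < 5" for i
    using triC(2)[OF i, of i "{i}" "{i, s1 i}" "T i"] trees[OF i] by (simp add: T)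
  have base_s1: "C {s1 i} {i, s1 i} = \<one>" "C {s1 i} {s1 i, s3 i} = \<one>" "C {s1 i} (T i) = \<one>" if i: "i < 5" for i
  proof -
    show 1: "C {s1 i} {i, s1 i} = \<one>" by (rule pent1[OF i]) auto
    show "C {s1 i} {s1 i, s3 i} = \<one>" using trees(3)[OF lt(1)[of i]] by (simp add: s)
    show "C {s1 i} (T i) = \<one>"
      using triC(2)[OF i, of "s1 i" "{s1 i}" "{i, s1 i}" "T i"] trees(4)[OF i] 1 by (simp add: T)
  qed
  have P2T: "C {s1 i, s3 i} (T i) = \<one>" if i: "i < 5" for i
    using triC(2)[OF i, of "s1 i" "{s1 i}" "{s1 i, s3 i}" "T i"] base_s1[OF i]
      triC(1)[OF i, of "s1 i" "{s1 i, s3 i}" "T i" "T i"] by (simp add: T)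
  have base_s3: "C {s3 i} {i, s3 i} = \<one>" "C {s3 i} {s1 i, s3 i} = y (s3 i)" "C {s3 i} (T i) = y (s3 i)"
    if i: "i < 5" for i
  proof -
    show "C {s3 i} {i, s3 i} = \<one>" using trees(3)[OF lt(2)[of i]] by (simp add: s' i insert_commute)
    show 1: "C {s3 i} {s1 i, s3 i} = y (s3 i)" by (simp add: y_def s insert_commute)
    show "C {s3 i} (T i) = y (s3 i)"
      using triC(2)[OF i, of "s3 i" "{s3 i}" "{s1 i, s3 i}" "T i"] P2T[OF i] 1 y[OF lt(2)[of i]] by (simp add: T)
  qed
  have y_step: "y i \<otimes> y (s3 i) = \<one>" if i: "i < 5" for i
  proof -
    have "C {i, s3 i} (T i) = y (s3 i)"
      using triC(2)[OF i, of "s3 i" "{s3 i}" "{i, s3 i}" "T i"] base_s3[OF i]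
        triC(1)[OF i, of "s3 i" "{i, s3 i}" "T i" "T i"] by (simp add: T)
    then show ?thesis
      using triC(2)[OF i, of i "{i}" "{i, s3 i}" "T i"] base_i[OF i] by (simp add: T y_def)
  qed
  have inv_step: "y (s3 i) = inv (y i)" if "i < 5" for i
    using y_step[OF that] y[OF that] y[OF lt(2)[of i]] by (metis inv_solve_left' l_one one_closed r_inv_ex inv_equality inv_inv)
  let ?t = "y 0"
  have y_vals: "y 3 = inv ?t" "y 1 = ?t" "y 4 = inv ?t" "y 2 = ?t" "y 0 = inv ?t"
    using inv_step[of 0] inv_step[of 3] inv_step[of 1] inv_step[of 4] inv_step[of 2] y[of 0]
    by (simp_all add: s3_def)
  then have y_eq: "y i = ?t" if "i < 5" for i
    using that by (auto simp: numeral_eq_Suc less_Suc_eq)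
  have t: "?t \<in> carrier G" "?t \<otimes> ?t = \<one>"
    using y[of 0] y_step[of 0] y_eq[of "s3 0"] lt by simp_all

  have lab: "C {a} Z = (if rp2_sheet a Z then ?t else \<one>)"
    if i: "i < 5" "a \<in> T i" and Z: "a \<in> Z" "Z \<subseteq> T i" for i a Z
  proof -
    note sh = rp2_sheet_simps[OF i(1), folded T_def s1_def s2_def s3_def]
    have s3': "rp2_sheet (s3 i) {s1 i, s3 i}" "\<not> rp2_sheet (s3 i) {i, s3 i}" "\<not> rp2_sheet (s3 i) {s3 i}"
      using rp2_sheet_simps[OF lt(2)[of i], folded T_def s1_def s2_def s3_def] s s'[OF i(1)]
      by (simp_all add: insert_commute)
    have s1': "\<not> rp2_sheet (s1 i) {s1 i, s3 i}" "\<not> rp2_sheet (s1 i) {s1 i}"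
      using rp2_sheet_simps[OF lt(1)[of i], folded T_def s1_def s2_def s3_def] s
      by simp_all
    have "a = i \<or> a = s1 i \<or> a = s3 i" using i(2) by (simp add: T)
    then show ?thesis
    proof (elim disjE)
      assume a: "a = i"
      then have "Z = {i} \<or> Z = {i, s1 i} \<or> Z = {i, s3 i} \<or> Z = T i" using Z by (auto simp: T)
      then show ?thesis
        using a sh trees[OF i(1)] base_i[OF i(1)] y_eq[OF i(1)] tri_refl[OF i(1), of i "{i}"]
        by (auto simp: y_def T)
    next
      assume a: "a = s1 i"
      then have "Z = {s1 i} \<or> Z = {i, s1 i} \<or> Z = {s1 i, s3 i} \<or> Z = T i" using Z by (auto simp: T)
      then show ?thesis
        using a sh s1' base_s1[OF i(1)] tri_refl[OF i(1), of "s1 i" "{s1 i}"]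
        by (auto simp: T)
    next
      assume a: "a = s3 i"
      then have "Z = {s3 i} \<or> Z = {i, s3 i} \<or> Z = {s1 i, s3 i} \<or> Z = T i" using Z by (auto simp: T)
      then show ?thesis
        using a sh s3' base_s3[OF i(1)] tri_refl[OF i(1), of "s3 i" "{s3 i}"] y_eq[OF lt(2)[of i]]
        by (auto simp: T)
    qed
  qed
  show thesis
  proof (rule that[OF t])
    fix S W Z Z'
    assume f: "(S, W) \<in> rp2_faces" and Z: "W \<subseteq> Z" "Z \<subseteq> W \<union> S" "W \<subseteq> Z'" "Z' \<subseteq> W \<union> S"
    show "C Z Z' = (if rp2_cocycle Z Z' = 0 then \<one> else ?t)"
      using f
    proof (cases rule: rp2_faces_cases)
      case (pentagon i)
      then show ?thesis
        using pent1[OF pentagon(1), of Z Z'] rp2_cocycle_pentagon[OF pentagon(1), of Z Z'] Z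
        by (simp add: s1_def)
    next
      case (triple i a)
      then have aT: "a \<in> T i" by (simp add: T_def)
      have ZT: "a \<in> Z" "Z \<subseteq> T i" "a \<in> Z'" "Z' \<subseteq> T i" using Z triple by (auto simp: T_def)
      note l = lab[OF triple(1) aT ZT(1,2)] lab[OF triple(1) aT ZT(3,4)]
      have c: "C {a} Z \<otimes> C Z Z' = C {a} Z'"
        using triC(2)[OF triple(1) aT _ _ ZT(1,2,3,4), of "{a}"] aT by simp
      have cl: "C Z Z' \<in> carrier G" using triC(1)[OF triple(1) aT ZT ZT(1,2)] .
      have k: "rp2_cocycle Z Z' = of_bool (rp2_sheet a Z \<noteq> rp2_sheet a Z')"
        using triple ZT by (intro rp2_cocycle_triple[of i]) (auto simp: T_def)
      have tt: "?t \<otimes> x = z \<longleftrightarrow> x = ?t \<otimes> z" if "x \<in> carrier G" "z \<in> carrier G" for x z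
        using t that by (metis l_one m_assoc)
      show ?thesis
        using c cl t l k tt[of "C Z Z'"] by (cases "rp2_sheet a Z"; cases "rp2_sheet a Z'") auto
    qed
  qed
qed


lemma rp2_edge_props:
  assumes "(a, i) \<in> rp2_edges"
  shows "i < 5" "a \<subseteq> {..<5}" "i \<notin> a"
    "\<exists>(S, W)\<in>rp2_faces. i \<in> S \<and> W \<subseteq> a \<and> a \<subseteq> W \<union> S"
proof -
  have "\<forall>(a, i)\<in>rp2_edges. i < 5 \<and> a \<subseteq> {0,1,2,3,4} \<and> i \<notin> a \<and>
      (\<exists>(S, W)\<in>rp2_faces. i \<in> S \<and> W \<subseteq> a \<and> a \<subseteq> W \<union> S)"
    unfolding rp2_edges_def rp2_faces_def rp2_triple_def lessThan_5 by code_simp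
  from bspec[OF this assms] show "i < 5" "a \<subseteq> {..<5}" "i \<notin> a"
    "\<exists>(S, W)\<in>rp2_faces. i \<in> S \<and> W \<subseteq> a \<and> a \<subseteq> W \<union> S"
    unfolding lessThan_5[symmetric] by simp_all
qed

lemma rp2_face_vertex:
  assumes f: "(S, W) \<in> rp2_faces" and Y: "Y \<inter> {..<5} = {}"
  shows "cube_vertex Z' \<in> cube_face S (W \<union> Y) \<longleftrightarrow> (\<exists>Z. Z' = Z \<union> Y \<and> W \<subseteq> Z \<and> Z \<subseteq> W \<union> S)"
proof
  note p = rp2_face_props[OF f]
  assume "cube_vertex Z' \<in> cube_face S (W \<union> Y)"
  then have *: "i \<in> Z' \<longleftrightarrow> i \<in> W \<union> Y" if "i \<notin> S" for i
    using that by (simp add: cube_vertex_in_face)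
  have "Z' = (Z' \<inter> {..<5}) \<union> Y" using * p(1,2) Y by blast
  moreover have "W \<subseteq> Z' \<inter> {..<5}" "Z' \<inter> {..<5} \<subseteq> W \<union> S" using * p Y by blast+
  ultimately show "\<exists>Z. Z' = Z \<union> Y \<and> W \<subseteq> Z \<and> Z \<subseteq> W \<union> S" by blast
next
  assume "\<exists>Z. Z' = Z \<union> Y \<and> W \<subseteq> Z \<and> Z \<subseteq> W \<union> S"
  then show "cube_vertex Z' \<in> cube_face S (W \<union> Y)" by (auto simp: cube_vertex_in_face)
qed

lemma rp2_cocycle_add:
  assumes "(S, W) \<in> rp2_faces" "W \<subseteq> Z" "Z \<subseteq> W \<union> S" "W \<subseteq> Z'" "Z' \<subseteq> W \<union> S" "W \<subseteq> Z''" "Z'' \<subseteq> W \<union> S"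
  shows "(rp2_cocycle Z Z' + rp2_cocycle Z' Z'') mod 2 = rp2_cocycle Z Z''"
  using assms(1)
proof (cases rule: rp2_faces_cases)
  case (pentagon i)
  then show ?thesis using assms(2-) rp2_cocycle_pentagon[OF pentagon(1)] by simp
next
  case (triple i a)
  then have "{a} \<subseteq> Z" "Z \<subseteq> rp2_triple i" "{a} \<subseteq> Z'" "Z' \<subseteq> rp2_triple i" "{a} \<subseteq> Z''" "Z'' \<subseteq> rp2_triple i"
    using assms(2-) by auto
  then show ?thesis using rp2_cocycle_triple[OF triple(1,2)] by (simp add: of_bool_def)
qed

section \<open>An isolated copy of the projective plane\<close>

definition rp2_copy :: "nat set \<Rightarrow> (nat \<Rightarrow> real) set set" where
  "rp2_copy Y = (\<lambda>(S, W). cube_face S (W \<union> Y)) ` rp2_faces"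

locale isolated_rp2 =
  fixes n :: nat and Y :: "nat set" and Q :: "(nat \<Rightarrow> real) set set"
  assumes n: "5 < n" and Y: "Y \<subseteq> {5..<n}"
    and Q_faces: "Q \<subseteq> cube_faces n 0 \<union> cube_faces n 1 \<union> cube_faces n 2"
    and skeleton: "cube_faces n 0 \<union> cube_faces n 1 \<subseteq> Q"
    and inside: "rp2_copy Y \<subseteq> Q"
    and outside: "\<lbrakk>f \<in> Q; f \<in> cube_faces n 2; (a, i) \<in> rp2_edges;
        cube_vertex (a \<union> Y) \<in> f; cube_vertex (insert i a \<union> Y) \<in> f\<rbrakk> \<Longrightarrow> f \<in> rp2_copy Y"
begin

definition non_tree_edges where
  "non_tree_edges = {cube_face {i} (a \<union> Y) | a i. (a, i) \<in> rp2_edges \<and> (a, insert i a) \<notin> rp2_tree}"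

text \<open>
  \<open>rest\<close> contains the tree, but none of the other edges and no square of the copy.
\<close>

definition rest where "rest = Q - rp2_copy Y - non_tree_edges"

lemma Yn: "Y \<subseteq> {..<n}" using Y by auto

lemma Y5: "Y \<inter> {..<5} = {}" using Y by auto

lemma Un_Y_cancel: "\<lbrakk>Z \<subseteq> {..<5}; Z' \<subseteq> {..<5}; Z \<union> Y = Z' \<union> Y\<rbrakk> \<Longrightarrow> Z = Z'"
  using Y5 by blast

lemma rp2_copyE:
  assumes "f \<in> rp2_copy Y"
  obtains S W where "(S, W) \<in> rp2_faces" "f = cube_face S (W \<union> Y)"
  using assms by (auto simp: rp2_copy_def)

lemma vertex_of_copy:
  assumes "(S, W) \<in> rp2_faces" "u \<in> cube_vertex ` Pow {..<n} \<inter> cube_face S (W \<union> Y)"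
  obtains Z where "u = cube_vertex (Z \<union> Y)" "W \<subseteq> Z" "Z \<subseteq> W \<union> S" "Z \<subseteq> {..<5}"
proof -
  obtain Z' where Z': "u = cube_vertex Z'" using assms(2) by blast
  then obtain Z where "Z' = Z \<union> Y" "W \<subseteq> Z" "Z \<subseteq> W \<union> S"
    using assms(2) rp2_face_vertex[OF assms(1) Y5] by auto
  moreover from this have "Z \<subseteq> {..<5}" using rp2_face_props[OF assms(1)] by blast
  ultimately show thesis using Z' that by simp
qed

text \<open>
  Edges that are left out of \<open>rest\<close> lie in squares of the copy.
\<close>

lemma Union_copy_rest: "\<Union>(rp2_copy Y \<union> rest) = \<Union>Q"
proof -
  have "\<exists>g\<in>rp2_copy Y. f \<subseteq> g" if f: "f \<in> non_tree_edges" for f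
  proof -
    obtain a i where ai: "f = cube_face {i} (a \<union> Y)" "(a, i) \<in> rp2_edges"
      using f by (auto simp: non_tree_edges_def)
    obtain S W where SW: "(S, W) \<in> rp2_faces" "i \<in> S" "W \<subseteq> a" "a \<subseteq> W \<union> S"
      using rp2_edge_props(4)[OF ai(2)] by auto
    have "f \<subseteq> cube_face S (W \<union> Y)"
    proof
      fix x assume x: "x \<in> f"
      have "if j \<in> S then 0 \<le> x j \<and> x j \<le> 1 else x j = of_bool (j \<in> W \<union> Y)" for j
      proof -
        have "if j = i then 0 \<le> x j \<and> x j \<le> 1 else x j = of_bool (j \<in> a \<union> Y)"
          using x ai(1) by (auto simp: cube_face_def)
        moreover have "j \<in> a \<union> Y \<longleftrightarrow> j \<in> W \<union> Y" if "j \<notin> S" using SW that by auto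
        ultimately show ?thesis using SW(2) by (auto split: if_splits)
      qed
      then show "x \<in> cube_face S (W \<union> Y)" unfolding cube_face_def by blast
    qed
    with SW(1) show ?thesis by (auto simp: rp2_copy_def)
  qed
  then show ?thesis using inside unfolding rest_def by blast
qed

lemma star_complex_copy_rest:
  "star_complex (rp2_copy Y \<union> rest) (cube_vertex ` Pow {..<n}) (cube_star n)"
  using inside Q_faces unfolding rest_def by (intro star_complex_cube) blast

lemma low_face_in_rest:
  assumes "j < n" "Z \<subseteq> {..<n}"
  shows "cube_face {} Z \<in> rest"
    and "5 \<le> j \<or> Z - {..<5} \<noteq> Y \<Longrightarrow> cube_face {j} Z \<in> rest"
    and "\<lbrakk>Z = W \<union> Y; (W, insert j W) \<in> rp2_tree; j \<notin> W\<rbrakk> \<Longrightarrow> cube_face {j} Z \<in> rest"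
proof -
  have not_copy: "cube_face S Z \<notin> rp2_copy Y" if "card S < 2" for S
  proof
    assume "cube_face S Z \<in> rp2_copy Y"
    then obtain S' W where "(S', W) \<in> rp2_faces" "cube_face S Z = cube_face S' (W \<union> Y)"
      by (rule rp2_copyE)
    then have "card S = 2" using rp2_face_props(3) cube_face_eqD(1) by metis
    with that show False by simp
  qed
  have "cube_face {} Z \<in> cube_faces n 0" "cube_face {j} Z \<in> cube_faces n 1"
    using assms by (auto intro!: cube_faceI)
  then have Q: "cube_face {} Z \<in> Q" "cube_face {j} Z \<in> Q" using skeleton by auto
  have "cube_face {} Z \<notin> non_tree_edges"
    using cube_face_eqD(1)[of "{}" Z] by (auto simp: non_tree_edges_def)
  then show "cube_face {} Z \<in> rest" using Q not_copy[of "{}"] by (simp add: rest_def)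
  have nt: "\<exists>a. (a, j) \<in> rp2_edges \<and> (a, insert j a) \<notin> rp2_tree \<and> Z - {j} = a \<union> Y"
    if "cube_face {j} Z \<in> non_tree_edges"
  proof -
    obtain a i where ai: "cube_face {j} Z = cube_face {i} (a \<union> Y)" "(a, i) \<in> rp2_edges"
      "(a, insert i a) \<notin> rp2_tree"
      using \<open>cube_face {j} Z \<in> non_tree_edges\<close> by (auto simp: non_tree_edges_def)
    then have "i = j" using cube_face_eqD(1)[OF ai(1)] by simp
    moreover have "k \<in> Z \<longleftrightarrow> k \<in> a \<union> Y" if "k \<noteq> j" for k
      using cube_face_eqD(2)[OF ai(1), of k] that by simp
    moreover have "j \<notin> a \<union> Y" using rp2_edge_props(1,3)[OF ai(2)] Y5 \<open>i = j\<close> by auto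
    ultimately have "k \<in> Z - {j} \<longleftrightarrow> k \<in> a \<union> Y" for k by (cases "k = j") simp_all
    then have "Z - {j} = a \<union> Y" by (rule Set.set_eqI)
    then show ?thesis using ai \<open>i = j\<close> by blast
  qed
  show "cube_face {j} Z \<in> rest" if "5 \<le> j \<or> Z - {..<5} \<noteq> Y"
  proof -
    have "cube_face {j} Z \<notin> non_tree_edges"
    proof
      assume "cube_face {j} Z \<in> non_tree_edges"
      then obtain a where a: "(a, j) \<in> rp2_edges" "Z - {j} = a \<union> Y" using nt by blast
      then have "j < 5" "a \<subseteq> {..<5}" using rp2_edge_props by blast+
      then have "Z - {..<5} = Y" using a(2) Y5 by auto
      with that \<open>j < 5\<close> show False by auto
    qed
    then show ?thesis using Q not_copy[of "{j}"] by (simp add: rest_def)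
  qed
  show "cube_face {j} Z \<in> rest" if Z: "Z = W \<union> Y" "(W, insert j W) \<in> rp2_tree" "j \<notin> W"
  proof -
    have W: "W \<subseteq> {..<5}" "insert j W \<subseteq> {..<5}" using rp2_treeE[OF Z(2)] by (metis insert_subset lessThan_iff)+
    have "cube_face {j} Z \<notin> non_tree_edges"
    proof
      assume "cube_face {j} Z \<in> non_tree_edges"
      then obtain a where a: "(a, j) \<in> rp2_edges" "(a, insert j a) \<notin> rp2_tree" "Z - {j} = a \<union> Y"
        using nt by blast
      have "a \<subseteq> {..<5}" using rp2_edge_props(2)[OF a(1)] .
      moreover have "Z - {j} = W \<union> Y" using Z W Y5 by auto
      ultimately have "a = W" using a(3) W Un_Y_cancel by metis
      with a(2) Z(2) show False by simp
    qed
    then show ?thesis using Q not_copy[of "{j}"] by (simp add: rest_def)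
  qed
qed

lemma vertex_in_rest: "Z \<subseteq> {..<n} \<Longrightarrow> cube_vertex Z \<in> \<Union>rest"
  by (rule UnionI[OF low_face_in_rest(1)[of 0 Z]]) (use n in \<open>auto simp: cube_vertex_in_face\<close>)

lemma face_in_cube:
  assumes "f \<in> Q"
  obtains S Z where "f = cube_face S Z" "S \<subseteq> {..<n}" "card S \<le> 2"
    "card S = 2 \<Longrightarrow> f \<in> cube_faces n 2"
proof -
  obtain k where k: "k \<in> {0, 1, 2}" "f \<in> cube_faces n k" using assms Q_faces by auto
  then obtain S Z where SZ: "f = cube_face S Z" "S \<subseteq> {..<n}" "card S = k"
    unfolding cube_faces_def by blast
  show thesis using k SZ by (intro that[OF SZ(1,2)]) auto
qed

lemma common_edge:
  assumes f: "f \<in> rp2_copy Y" and b: "b \<in> rest"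
    and Z: "Z \<subseteq> {..<5}" "cube_vertex (Z \<union> Y) \<in> f \<inter> b" and j: "j \<notin> Z" "j < 5"
      "cube_vertex (insert j Z \<union> Y) \<in> f \<inter> b"
  shows "(Z, insert j Z) \<in> rp2_tree"
proof (rule ccontr)
  assume nt: "(Z, insert j Z) \<notin> rp2_tree"
  obtain S W where SW: "(S, W) \<in> rp2_faces" "f = cube_face S (W \<union> Y)" using f by (rule rp2_copyE)
  note p = rp2_face_props[OF SW(1)]
  have zj: "\<exists>X. Z \<union> Y = X \<union> Y \<and> W \<subseteq> X \<and> X \<subseteq> W \<union> S" "\<exists>X. insert j Z \<union> Y = X \<union> Y \<and> W \<subseteq> X \<and> X \<subseteq> W \<union> S"
    using Z(2) j(3) rp2_face_vertex[OF SW(1) Y5] unfolding SW(2) by blast+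
  have "W \<subseteq> Z" "Z \<subseteq> W \<union> S" "insert j Z \<subseteq> W \<union> S"
    using zj p(1,2) Z(1) j(2) Y5 by blast+
  then have e: "(Z, j) \<in> rp2_edges"
    using j(1) by (intro rp2_face_edge[OF SW(1)]) auto
  obtain S' Z' where b': "b = cube_face S' Z'" "S' \<subseteq> {..<n}" "card S' \<le> 2" "card S' = 2 \<Longrightarrow> b \<in> cube_faces n 2"
    using b face_in_cube[of b] unfolding rest_def by blast
  have mem: "k \<in> Z \<union> Y \<longleftrightarrow> k \<in> Z'" "k \<in> insert j Z \<union> Y \<longleftrightarrow> k \<in> Z'" if "k \<notin> S'" for k
    using Z(2) j(3) that unfolding b'(1) by (auto simp: cube_vertex_in_face)
  have "j \<in> S'" using mem[of j] j Y5 by auto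
  moreover have "finite S'" using b'(2) finite_subset by blast
  ultimately have "card S' \<noteq> 0" by auto
  then have "card S' = 1 \<or> card S' = 2" using b'(3) by linarith
  then show False
  proof
    assume "card S' = 1"
    then have "S' = {j}" using \<open>j \<in> S'\<close> by (auto simp: card_1_singleton_iff)
    moreover have "cube_face S' Z' = cube_face S' (Z \<union> Y)"
      using mem(1) by (intro cube_face_cong) simp
    ultimately have "b = cube_face {j} (Z \<union> Y)" unfolding b'(1) by simp
    then have "b \<in> non_tree_edges" using e nt by (auto simp: non_tree_edges_def)
    then show False using b by (simp add: rest_def)
  next
    assume "card S' = 2"
    then have "b \<in> rp2_copy Y"
      using outside[OF _ b'(4) e] b Z(2) j(3) by (simp add: rest_def)
    then show False using b by (simp add: rest_def)
  qed
qed

text \<open>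
  Two vertices of a square of the copy span a diagonal or an edge. A face that contains the diagonal of
  a square contains the square, and a face that contains an edge of the copy is this edge or, by
  isolation, a square of the copy.
\<close>

lemma common_link:
  assumes f: "f \<in> rp2_copy Y" and b: "b \<in> rest"
    and Z: "Z \<subseteq> {..<5}" "cube_vertex (Z \<union> Y) \<in> f \<inter> b"
    and Z': "Z' \<subseteq> {..<5}" "cube_vertex (Z' \<union> Y) \<in> f \<inter> b"
  shows "Z = Z' \<or> (Z, Z') \<in> rp2_tree \<or> (Z', Z) \<in> rp2_tree"
proof -
  obtain S W where SW: "(S, W) \<in> rp2_faces" "f = cube_face S (W \<union> Y)" using f by (rule rp2_copyE)
  note p = rp2_face_props[OF SW(1)]
  have mS: "k \<in> Z \<union> Y \<longleftrightarrow> k \<in> W \<union> Y" "k \<in> Z' \<union> Y \<longleftrightarrow> k \<in> W \<union> Y" if "k \<notin> S" for k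
    using Z(2) Z'(2) that unfolding SW(2) by (auto simp: cube_vertex_in_face)
  obtain S' X where b': "b = cube_face S' X" "S' \<subseteq> {..<n}" "card S' \<le> 2"
    using b face_in_cube[of b] unfolding rest_def by blast
  have mem: "k \<in> Z \<union> Y \<longleftrightarrow> k \<in> X" "k \<in> Z' \<union> Y \<longleftrightarrow> k \<in> X" if "k \<notin> S'" for k
    using Z(2) Z'(2) that unfolding b'(1) by (auto simp: cube_vertex_in_face)
  let ?D = "(Z - Z') \<union> (Z' - Z)"
  have D: "?D \<subseteq> S" "?D \<subseteq> S'" using mS mem Y5 Z(1) Z'(1) by blast+
  have fin: "finite S" "finite S'" using p(1) b'(2) finite_subset by blast+
  have "?D \<noteq> S"
  proof
    assume "?D = S"
    then have "S \<subseteq> S'" using D by simp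
    then have "S = S'" using b'(3) p(3) fin by (metis card_seteq)
    have "cube_face S X = cube_face S (W \<union> Y)"
      using mS(1) mem(1) \<open>S = S'\<close> by (intro cube_face_cong) simp
    then have "b = f" unfolding b'(1) SW(2) \<open>S = S'\<close> .
    then show False using f b by (simp add: rest_def)
  qed
  then have "card ?D < 2" using D(1) fin p(3) by (metis psubset_card_mono psubsetI)
  then have "card ?D = 0 \<or> card ?D = 1" by linarith
  then show ?thesis
  proof
    assume "card ?D = 0"
    moreover have "finite ?D" using D(1) fin finite_subset by blast
    ultimately have "?D = {}" by simp
    then show ?thesis by blast
  next
    assume "card ?D = 1"
    then obtain j where j: "?D = {j}" by (auto simp: card_1_singleton_iff)
    then have "j < 5" using Z(1) Z'(1) by auto
    have D': "(x \<in> Z \<longleftrightarrow> x \<in> Z') \<longleftrightarrow> x \<noteq> j" for x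
      using arg_cong[OF j, of "\<lambda>A. x \<in> A"] by auto
    show ?thesis
    proof (cases "j \<in> Z")
      case True
      have "j \<notin> Z'" using D' True by metis
      moreover have "Z = insert j Z'"
      proof (rule Set.set_eqI)
        show "x \<in> Z \<longleftrightarrow> x \<in> insert j Z'" for x using D'[of x] True by auto
      qed
      ultimately show ?thesis using common_edge[OF f b Z' _ \<open>j < 5\<close>] Z by simp
    next
      case False
      have "Z' = insert j Z"
      proof (rule Set.set_eqI)
        show "x \<in> Z' \<longleftrightarrow> x \<in> insert j Z" for x using D'[of x] False by auto
      qed
      then show ?thesis using common_edge[OF f b Z False \<open>j < 5\<close>] Z' by simp
    qed
  qed
qed

definition reachable :: "(nat \<Rightarrow> real) \<Rightarrow> bool" where
  "reachable y \<longleftrightarrow> (\<exists>p. path p \<and> path_image p \<subseteq> \<Union>rest \<and> pathstart p = cube_vertex Y \<and> pathfinish p = y)"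

lemma reachable_face:
  assumes "reachable y" "f \<in> rest" "y \<in> f" "z \<in> f"
  shows "reachable z"
proof -
  obtain p where p: "path p" "path_image p \<subseteq> \<Union>rest" "pathstart p = cube_vertex Y" "pathfinish p = y"
    using assms(1) by (auto simp: reachable_def)
  have "segment_convex f"
    using star_complex.face_convex[OF star_complex_copy_rest, of f] assms(2) by simp
  then have "path_image (segment_path y z) \<subseteq> f" using assms by (intro path_image_segment_path)
  then have "path_image (segment_path y z) \<subseteq> \<Union>rest" using assms(2) by blast
  then show ?thesis
    using p unfolding reachable_def
    by (intro exI[of _ "p +++ segment_path y z"]) (simp add: subset_path_image_join)
qed

text \<open>
  Changing one coordinate of a vertex moves along an edge of \<open>rest\<close>, unless the edge might belong to the
  copy. In that case the move is made in a parallel cube instead: coordinate 5 is changed before and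
  after.
\<close>

lemma reachable_all:
  assumes "y \<in> \<Union>rest"
  shows "reachable y"
proof -
  have edge: "reachable (cube_vertex Z) \<longleftrightarrow> reachable (cube_vertex Z')"
    if "j < n" "Z \<subseteq> {..<n}" "5 \<le> j \<or> Z - {..<5} \<noteq> Y" "Z' = insert j Z \<or> Z' = Z - {j}" for j Z Z'
  proof -
    have "cube_face {j} Z \<in> rest" using that by (intro low_face_in_rest(2))
    moreover have "cube_vertex Z \<in> cube_face {j} Z" "cube_vertex Z' \<in> cube_face {j} Z"
      using that(4) by (auto simp: cube_vertex_in_face)
    ultimately show ?thesis using reachable_face by blast
  qed
  have step: "reachable (cube_vertex Z) \<longleftrightarrow> reachable (cube_vertex (insert j Z))"
    if j: "j < n" and Z: "Z \<subseteq> {..<n}" for j Z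
  proof (cases "5 \<le> j \<or> Z - {..<5} \<noteq> Y")
    case True
    then show ?thesis using edge[of j Z] that by blast
  next
    case False
    define fl where "fl X = (if 5 \<in> X then X - {5} else insert (5::nat) X)" for X
    have fl: "reachable (cube_vertex X) \<longleftrightarrow> reachable (cube_vertex (fl X))" if "X \<subseteq> {..<n}" for X
      using n that by (intro edge[of 5]) (auto simp: fl_def)
    have "5 \<in> Z \<longleftrightarrow> 5 \<in> Y" using False by auto
    then have "5 \<in> fl Z - {..<5} \<longleftrightarrow> 5 \<notin> Y" by (simp add: fl_def)
    then have "fl Z - {..<5} \<noteq> Y" by blast
    moreover have "fl Z \<subseteq> {..<n}" using Z n by (auto simp: fl_def)
    ultimately have "reachable (cube_vertex (fl Z)) \<longleftrightarrow> reachable (cube_vertex (insert j (fl Z)))"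
      using edge[of j "fl Z"] j by blast
    moreover have "insert j (fl Z) = fl (insert j Z)"
      using False by (simp add: fl_def insert_commute insert_Diff_if)
    ultimately show ?thesis using fl[of Z] fl[of "insert j Z"] Z j by simp
  qed
  have empty: "reachable (cube_vertex Z) \<longleftrightarrow> reachable (cube_vertex {})" if "Z \<subseteq> {..<n}" for Z
  proof -
    have "finite Z" using that finite_subset by blast
    then show ?thesis using that
      by (induction Z rule: finite_induct) (use step in auto)
  qed
  have "reachable (cube_vertex Y)"
    unfolding reachable_def using vertex_in_rest[OF Yn]
    by (intro exI[of _ "\<lambda>_. cube_vertex Y"])
      (simp add: path_def path_image_def pathstart_def pathfinish_def image_constant_conv del: Union_iff)
  then have vertices: "reachable (cube_vertex Z)" if "Z \<subseteq> {..<n}" for Z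
    using empty[of Z] empty[OF Yn] that by simp
  interpret star_complex rest "cube_vertex ` Pow {..<n}" "cube_star n"
    by (rule star_complex.star_complex_subset[OF star_complex_copy_rest]) simp
  obtain f where f: "f \<in> rest" "y \<in> f" using assms by blast
  then obtain v where "v \<in> cube_vertex ` Pow {..<n}" "y \<in> cube_star n v" using stars_cover by blast
  then have "v \<in> f" "reachable v" using star_face[OF f] vertices by auto
  then show ?thesis using f reachable_face by blast
qed

text \<open>
  The path in the tree from the root to \<open>Z\<close>. The first argument is the number of edges of the path.
\<close>

primrec tree_path :: "nat \<Rightarrow> nat set \<Rightarrow> real \<Rightarrow> nat \<Rightarrow> real" where
  "tree_path 0 Z = (\<lambda>_. cube_vertex Y)"
| "tree_path (Suc m) Z = tree_path m (THE W. (W, Z) \<in> rp2_tree) +++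
     segment_path (cube_vertex ((THE W. (W, Z) \<in> rp2_tree) \<union> Y)) (cube_vertex (Z \<union> Y))"

lemma tree_path_step:
  assumes "(W, Z) \<in> rp2_tree"
  shows "tree_path (card Z) Z =
    tree_path (card W) W +++ segment_path (cube_vertex (W \<union> Y)) (cube_vertex (Z \<union> Y))"
proof -
  obtain i where "i \<notin> W" "Z = insert i W" "W \<subseteq> {..<5}" using rp2_treeE[OF assms] by metis
  then have "card Z = Suc (card W)" using finite_subset by (metis card_insert_disjoint finite_lessThan)
  moreover have "(THE W. (W, Z) \<in> rp2_tree) = W"
    using assms rp2_tree_functional by (intro the_equality) auto
  ultimately show ?thesis by simp
qed

lemma tree_segment:
  assumes "(W, Z) \<in> rp2_tree"
  shows "path_image (segment_path (cube_vertex (W \<union> Y)) (cube_vertex (Z \<union> Y))) \<subseteq> \<Union>rest"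
proof -
  obtain i where i: "i < 5" "i \<notin> W" "Z = insert i W" "W \<subseteq> {..<5}" using rp2_treeE[OF assms] by metis
  have sub: "W \<union> Y \<subseteq> {..<n}" using i(4) Y n by auto
  have r: "cube_face {i} (W \<union> Y) \<in> rest"
    using assms i n by (intro low_face_in_rest(3)[OF _ sub]) auto
  have "path_image (segment_path (cube_vertex (W \<union> Y)) (cube_vertex (Z \<union> Y))) \<subseteq> cube_face {i} (W \<union> Y)"
    using i(3) by (intro path_image_segment_path segment_convex_cube_face) (auto simp: cube_vertex_in_face)
  with r show ?thesis by blast
qed

lemma tree_path:
  assumes "Z = {} \<or> Z \<in> Range rp2_tree"
  shows "path (tree_path (card Z) Z) \<and> path_image (tree_path (card Z) Z) \<subseteq> \<Union>rest \<and>
    pathstart (tree_path (card Z) Z) = cube_vertex Y \<and> pathfinish (tree_path (card Z) Z) = cube_vertex (Z \<union> Y)"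
  using assms
proof (induction "card Z" arbitrary: Z rule: less_induct)
  case less
  show ?case
  proof (cases "Z = {}")
    case True
    then show ?thesis using vertex_in_rest[OF Yn]
      by (simp add: path_def path_image_def pathstart_def pathfinish_def image_constant_conv subset_eq del: Union_iff)
  next
    case False
    then obtain W where W: "(W, Z) \<in> rp2_tree" using less.prems by auto
    obtain i where i: "i \<notin> W" "Z = insert i W" "W \<subseteq> {..<5}" "W = {} \<or> W \<in> Range rp2_tree"
      using rp2_treeE[OF W] by metis
    have "finite W" using i(3) finite_subset by blast
    then have "card W < card Z" using i by simp
    note IH = less.hyps[OF this i(4)]
    show ?thesis
      unfolding tree_path_step[OF W] using IH tree_segment[OF W]
      by (simp add: subset_path_image_join)
  qed
qed

text \<open>
  Base paths of vertices of the tree run in the tree. This makes the classes of its edges trivial.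
\<close>

definition base_path :: "(nat \<Rightarrow> real) \<Rightarrow> real \<Rightarrow> nat \<Rightarrow> real" where
  "base_path y = (if \<exists>Z. y = cube_vertex (Z \<union> Y) \<and> (Z = {} \<or> Z \<in> Range rp2_tree)
     then let Z = (THE Z. y = cube_vertex (Z \<union> Y) \<and> (Z = {} \<or> Z \<in> Range rp2_tree)) in tree_path (card Z) Z
     else SOME p. path p \<and> path_image p \<subseteq> \<Union>rest \<and> pathstart p = cube_vertex Y \<and> pathfinish p = y)"

lemma rp2_tree_subset: "Z = {} \<or> Z \<in> Range rp2_tree \<Longrightarrow> Z \<subseteq> {..<5}"
  using rp2_treeE by (metis Range.cases empty_subsetI insert_subset lessThan_iff)

lemma base_path_tree:
  assumes "Z = {} \<or> Z \<in> Range rp2_tree"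
  shows "base_path (cube_vertex (Z \<union> Y)) = tree_path (card Z) Z"
proof -
  have "(THE Z'. cube_vertex (Z \<union> Y) = cube_vertex (Z' \<union> Y) \<and> (Z' = {} \<or> Z' \<in> Range rp2_tree)) = Z"
    using assms rp2_tree_subset Un_Y_cancel unfolding inj_cube_vertex by (intro the_equality) metis+
  moreover have "\<exists>Z'. cube_vertex (Z \<union> Y) = cube_vertex (Z' \<union> Y) \<and> (Z' = {} \<or> Z' \<in> Range rp2_tree)"
    using assms by blast
  ultimately show ?thesis unfolding base_path_def Let_def by (simp only: if_True)
qed

lemma base_paths_rest: "base_paths (\<Union>rest) (cube_vertex Y) base_path"
  unfolding base_paths_def
proof
  fix y assume y: "y \<in> \<Union>rest"
  show "path (base_path y) \<and> path_image (base_path y) \<subseteq> \<Union>rest \<and>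
      pathstart (base_path y) = cube_vertex Y \<and> pathfinish (base_path y) = y"
  proof (cases "\<exists>Z. y = cube_vertex (Z \<union> Y) \<and> (Z = {} \<or> Z \<in> Range rp2_tree)")
    case True
    then show ?thesis using base_path_tree tree_path by metis
  next
    case False
    have "\<exists>p. path p \<and> path_image p \<subseteq> \<Union>rest \<and> pathstart p = cube_vertex Y \<and> pathfinish p = y"
      using reachable_all[OF y] by (simp add: reachable_def)
    from someI_ex[OF this] show ?thesis unfolding base_path_def if_not_P[OF False] .
  qed
qed

lemma base_path_root: "base_path (cube_vertex Y) = (\<lambda>_. cube_vertex Y)"
  using base_path_tree[of "{}"] by simp

text \<open>
  The base path of \<open>Z\<close> is that of \<open>W\<close> followed by the edge from \<open>W\<close> to \<open>Z\<close>, and base paths have trivial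
  class. The set \<open>S\<close> is \<open>\<Union>rest\<close> or the whole complex.
\<close>

lemma path_class_tree:
  assumes \<tau>: "base_paths S (cube_vertex Y) \<tau>" and S: "\<Union>rest \<subseteq> S"
    and eq: "\<And>y. y \<in> \<Union>rest \<Longrightarrow> \<tau> y = base_path y" and WZ: "(W, Z) \<in> rp2_tree"
  shows "path_class S (cube_vertex Y) \<tau> (segment_path (cube_vertex (W \<union> Y)) (cube_vertex (Z \<union> Y))) =
      \<one>\<^bsub>fundamental_group S (cube_vertex Y)\<^esub>"
    and "path_class S (cube_vertex Y) \<tau> (segment_path (cube_vertex (Z \<union> Y)) (cube_vertex (W \<union> Y))) =
      \<one>\<^bsub>fundamental_group S (cube_vertex Y)\<^esub>"
proof -
  let ?w = "cube_vertex (W \<union> Y)" and ?z = "cube_vertex (Z \<union> Y)" and ?a = "cube_vertex Y"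
  let ?c = "path_class S ?a \<tau>" and ?G = "fundamental_group S ?a"
  obtain i where i: "i < 5" "Z = insert i W" "W \<subseteq> {..<5}" "W = {} \<or> W \<in> Range rp2_tree" "i \<notin> W"
    using rp2_treeE[OF WZ] by metis
  have sub: "W \<union> Y \<subseteq> {..<n}" "Z \<union> Y \<subseteq> {..<n}" using i Y n by auto
  have in_rest: "?w \<in> \<Union>rest" "?z \<in> \<Union>rest" "?a \<in> \<Union>rest"
    using vertex_in_rest sub Yn by simp_all
  then have inS: "?w \<in> S" "?z \<in> S" "?a \<in> S" using S by auto
  interpret G: group ?G using inS(3) by (rule group_fundamental_group)
  have root: "\<tau> ?a = (\<lambda>_. ?a)" using eq[OF in_rest(3)] base_path_root by simp
  have im: "path_image (segment_path ?w ?z) \<subseteq> S" using tree_segment[OF WZ] S by blast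
  have "\<tau> ?z = \<tau> ?w +++ segment_path ?w ?z"
    using eq[OF in_rest(1)] eq[OF in_rest(2)] base_path_tree[OF i(4)] base_path_tree[of Z]
      tree_path_step[OF WZ] WZ by auto
  then have "?c (\<tau> ?z) = ?c (\<tau> ?w) \<otimes>\<^bsub>?G\<^esub> ?c (segment_path ?w ?z)"
    using base_pathsD[OF \<tau> inS(1)] im path_class_join[OF \<tau>, of "\<tau> ?w" "segment_path ?w ?z"] by simp
  then show 1: "?c (segment_path ?w ?z) = \<one>\<^bsub>?G\<^esub>"
    using path_class_base_path[OF \<tau> root inS(1)] path_class_base_path[OF \<tau> root inS(2)]
      path_class_closed[OF \<tau> _ im] by simp
  have f: "segment_convex (cube_face {i} (W \<union> Y))" by (rule segment_convex_cube_face)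
  have fS: "cube_face {i} (W \<union> Y) \<subseteq> S"
  proof -
    have "cube_face {i} (W \<union> Y) \<in> rest"
      using WZ i n by (intro low_face_in_rest(3)[OF _ sub(1)]) auto
    then show ?thesis using S by blast
  qed
  have wz: "?w \<in> cube_face {i} (W \<union> Y)" "?z \<in> cube_face {i} (W \<union> Y)"
    using i by (auto simp: cube_vertex_in_face)
  have "?c (segment_path ?z ?w) \<otimes>\<^bsub>?G\<^esub> ?c (segment_path ?w ?z) = ?c (segment_path ?z ?z)"
    by (rule path_class_segments[OF \<tau> f fS wz(2,1,2)])
  moreover have "?c (segment_path ?z ?z) = \<one>\<^bsub>?G\<^esub>" using path_class_const[OF \<tau> inS(2)] by simp
  moreover have "path_image (segment_path ?z ?w) \<subseteq> S"
    using path_image_segment_path[OF f wz(2,1)] fS by blast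
  ultimately show "?c (segment_path ?z ?w) = \<one>\<^bsub>?G\<^esub>"
    using 1 path_class_closed[OF \<tau>, of "segment_path ?z ?w"] by simp
qed

theorem free_factor_copy:
  assumes x: "x \<in> \<Union>Q"
  shows "free_factor (integer_mod_group 2) (fundamental_group (\<Union>Q) x)"
proof -
  let ?A = "rp2_copy Y" and ?V = "cube_vertex ` Pow {..<n}" and ?a = "cube_vertex Y"
  let ?X = "\<Union>Q" and ?R = "\<Union>rest"
  let ?G = "fundamental_group ?X ?a"
  note X = Union_copy_rest
  interpret X: star_complex "?A \<union> rest" ?V "cube_star n" by (rule star_complex_copy_rest)
  have RX: "?R \<subseteq> ?X" unfolding X[symmetric] by blast
  have aR: "?a \<in> ?R" by (rule vertex_in_rest[OF Yn])
  then have aX: "?a \<in> ?X" using RX by blast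
  interpret G: group ?G using aX by (rule group_fundamental_group)
  have VR: "?V \<subseteq> ?R" using vertex_in_rest by auto

  define \<tau> where "\<tau> y = (if y \<in> ?R then base_path y
    else SOME p. path p \<and> path_image p \<subseteq> ?X \<and> pathstart p = ?a \<and> pathfinish p = y)" for y
  have \<tau>: "base_paths ?X ?a \<tau>"
    unfolding base_paths_def
  proof
    fix y assume y: "y \<in> ?X"
    show "path (\<tau> y) \<and> path_image (\<tau> y) \<subseteq> ?X \<and> pathstart (\<tau> y) = ?a \<and> pathfinish (\<tau> y) = y"
    proof (cases "y \<in> ?R")
      case True
      then show ?thesis using base_pathsD[OF base_paths_rest True] RX by (simp add: \<tau>_def)
    next
      case False
      obtain f where f: "f \<in> ?A \<union> rest" "y \<in> f" using y unfolding X[symmetric] by blast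
      then obtain v where v: "v \<in> ?V" "y \<in> cube_star n v" using X.stars_cover by blast
      then have "v \<in> f" using X.star_face f by blast
      then have "path_image (segment_path v y) \<subseteq> f" using f by (intro path_image_segment_path X.face_convex)
      then have "path_image (segment_path v y) \<subseteq> ?X" using f(1) unfolding X[symmetric] by blast
      moreover have "v \<in> ?R" using v(1) VR by blast
      note base_pathsD[OF base_paths_rest this]
      ultimately have "\<exists>p. path p \<and> path_image p \<subseteq> ?X \<and> pathstart p = ?a \<and> pathfinish p = y"
        using RX by (intro exI[of _ "base_path v +++ segment_path v y"]) (simp add: subset_path_image_join)
      from someI_ex[OF this] show ?thesis unfolding \<tau>_def if_not_P[OF False] .
    qed
  qed
  have \<tau>R: "\<tau> y = base_path y" if "y \<in> ?R" for y using that by (simp add: \<tau>_def)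

  let ?c = "path_class ?X ?a \<tau>"
  define C where "C Z Z' = ?c (segment_path (cube_vertex (Z \<union> Y)) (cube_vertex (Z' \<union> Y)))" for Z Z'
  have vf: "cube_vertex (Z \<union> Y) \<in> cube_face S (W \<union> Y)"
    if "(S, W) \<in> rp2_faces" "W \<subseteq> Z" "Z \<subseteq> W \<union> S" for S W Z
    using rp2_face_vertex[OF that(1) Y5] that by blast
  have fX: "cube_face S (W \<union> Y) \<subseteq> ?X" if "(S, W) \<in> rp2_faces" for S W
    using that inside by (auto simp: rp2_copy_def)
  obtain t where t: "t \<in> carrier ?G" "t \<otimes>\<^bsub>?G\<^esub> t = \<one>\<^bsub>?G\<^esub>"
    and Ct: "\<And>S W Z Z'. \<lbrakk>(S, W) \<in> rp2_faces; W \<subseteq> Z; Z \<subseteq> W \<union> S; W \<subseteq> Z'; Z' \<subseteq> W \<union> S\<rbrakk> \<Longrightarrow>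
        C Z Z' = (if rp2_cocycle Z Z' = 0 then \<one>\<^bsub>?G\<^esub> else t)"
  proof (rule rp2_labels[of ?G C, OF G.group_axioms])
    show "C Z Z' \<in> carrier ?G"
      if "(S, W) \<in> rp2_faces" "W \<subseteq> Z" "Z \<subseteq> W \<union> S" "W \<subseteq> Z'" "Z' \<subseteq> W \<union> S" for S W Z Z'
    proof -
      have "path_image (segment_path (cube_vertex (Z \<union> Y)) (cube_vertex (Z' \<union> Y))) \<subseteq> ?X"
        using path_image_segment_path[OF segment_convex_cube_face vf[OF that(1,2,3)] vf[OF that(1,4,5)]]
          fX[OF that(1)] by blast
      then show ?thesis unfolding C_def by (intro path_class_closed[OF \<tau>]) auto
    qed
    show "C Z Z' \<otimes>\<^bsub>?G\<^esub> C Z' Z'' = C Z Z''"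
      if "(S, W) \<in> rp2_faces" "W \<subseteq> Z" "Z \<subseteq> W \<union> S" "W \<subseteq> Z'" "Z' \<subseteq> W \<union> S" "W \<subseteq> Z''" "Z'' \<subseteq> W \<union> S"
      for S W Z Z' Z''
      unfolding C_def
      by (rule path_class_segments[OF \<tau> segment_convex_cube_face fX[OF that(1)]
            vf[OF that(1,2,3)] vf[OF that(1,4,5)] vf[OF that(1,6,7)]])
    show "C W Z = \<one>\<^bsub>?G\<^esub>" if "(W, Z) \<in> rp2_tree" for W Z
      unfolding C_def using path_class_tree(1)[OF \<tau> RX \<tau>R that] .
  qed (rule that)

  define \<phi> where "\<phi> k = (if k = 0 then \<one>\<^bsub>?G\<^esub> else t)" for k :: int
  have \<phi>: "\<phi> \<in> hom (integer_mod_group 2) ?G"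
  proof (rule homI)
    have cases: "x = 0 \<or> x = 1" if "x \<in> carrier (integer_mod_group 2)" for x
      using that by (auto simp: carrier_integer_mod_group)
    show "\<phi> x \<in> carrier ?G" if "x \<in> carrier (integer_mod_group 2)" for x
      using t by (simp add: \<phi>_def)
    show "\<phi> (x \<otimes>\<^bsub>integer_mod_group 2\<^esub> y) = \<phi> x \<otimes>\<^bsub>?G\<^esub> \<phi> y"
      if "x \<in> carrier (integer_mod_group 2)" "y \<in> carrier (integer_mod_group 2)" for x y
      using cases[OF that(1)] cases[OF that(2)] t by (elim disjE) (simp_all add: \<phi>_def)
  qed
  define code where "code u = {i\<in>{..<5}. u i = 1}" for u :: "nat \<Rightarrow> real"
  have code: "code (cube_vertex (Z \<union> Y)) = Z" if "Z \<subseteq> {..<5}" for Z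
    using that Y5 by (auto simp: code_def cube_vertex_def)
  define k where "k u v = rp2_cocycle (code u) (code v)" for u v
  have vertexE: "\<exists>Z. u = cube_vertex (Z \<union> Y) \<and> W \<subseteq> Z \<and> Z \<subseteq> W \<union> S \<and> Z \<subseteq> {..<5}"
    if "(S, W) \<in> rp2_faces" "u \<in> ?V \<inter> cube_face S (W \<union> Y)" for u S W
    using vertex_of_copy[OF that] by metis
  have link: "k u v \<in> {0, 1} \<and> \<phi> (k u v) = ?c (segment_path u v)"
    if "f \<in> ?A" "u \<in> ?V \<inter> f" "v \<in> ?V \<inter> f" for f u v
  proof -
    obtain S W where SW: "(S, W) \<in> rp2_faces" "f = cube_face S (W \<union> Y)" using \<open>f \<in> ?A\<close> by (rule rp2_copyE)
    obtain Z where Z: "u = cube_vertex (Z \<union> Y)" "W \<subseteq> Z" "Z \<subseteq> W \<union> S" "Z \<subseteq> {..<5}"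
      using vertexE[OF SW(1), of u] \<open>u \<in> ?V \<inter> f\<close> SW(2) by blast
    obtain Z' where Z': "v = cube_vertex (Z' \<union> Y)" "W \<subseteq> Z'" "Z' \<subseteq> W \<union> S" "Z' \<subseteq> {..<5}"
      using vertexE[OF SW(1), of v] \<open>v \<in> ?V \<inter> f\<close> SW(2) by blast
    show ?thesis
      using Ct[OF SW(1) Z(2,3) Z'(2,3)] code[OF Z(4)] code[OF Z'(4)]
      by (auto simp: k_def \<phi>_def Z(1) Z'(1) C_def rp2_cocycle_def)
  qed
  have "?G \<cong> free_product (integer_mod_group 2) (fundamental_group ?R ?a)"
  proof (rule fundamental_group_free_product[where A = ?A and B = rest, unfolded X])
    show "star_complex (?A \<union> rest) ?V (cube_star n)" by (rule star_complex_copy_rest)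
    show "?a \<in> ?V" using Yn by blast
    show "base_paths ?X ?a \<tau>" by (rule \<tau>)
    show "base_paths ?R ?a base_path" by (rule base_paths_rest)
    show "\<tau> y = base_path y" if "y \<in> ?R" for y using that by (rule \<tau>R)
    show "base_path ?a = (\<lambda>_. ?a)" by (rule base_path_root)
    show "?a \<in> ?R" by (rule aR)
    show "?V \<inter> \<Union>?A \<subseteq> ?R" using VR by blast
    show "group (integer_mod_group 2)" by simp
    show "\<phi> \<in> hom (integer_mod_group 2) ?G" by (rule \<phi>)
    show "k u v \<in> carrier (integer_mod_group 2) \<and> \<phi> (k u v) = ?c (segment_path u v)"
      if "f \<in> ?A" "u \<in> ?V \<inter> f" "v \<in> ?V \<inter> f" for f u v
      using link[OF that] by (auto simp: carrier_integer_mod_group)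
    show "k u v \<otimes>\<^bsub>integer_mod_group 2\<^esub> k v w = k u w"
      if uvw: "f \<in> ?A" "u \<in> ?V \<inter> f" "v \<in> ?V \<inter> f" "w \<in> ?V \<inter> f" for f u v w
    proof -
      obtain S W where SW: "(S, W) \<in> rp2_faces" "f = cube_face S (W \<union> Y)" using uvw(1) by (rule rp2_copyE)
      from vertexE[OF SW(1)] uvw(2-4)[unfolded SW(2)] obtain Z Z' Z''
        where Z: "u = cube_vertex (Z \<union> Y)" "W \<subseteq> Z" "Z \<subseteq> W \<union> S" "Z \<subseteq> {..<5}"
          "v = cube_vertex (Z' \<union> Y)" "W \<subseteq> Z'" "Z' \<subseteq> W \<union> S" "Z' \<subseteq> {..<5}"
          "w = cube_vertex (Z'' \<union> Y)" "W \<subseteq> Z''" "Z'' \<subseteq> W \<union> S" "Z'' \<subseteq> {..<5}" by metis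
      show ?thesis
        using rp2_cocycle_add[OF SW(1) Z(2,3,6,7,10,11)] code Z by (simp add: k_def)
    qed
    show "\<exists>f\<in>?A. \<exists>u\<in>?V \<inter> f. \<exists>v\<in>?V \<inter> f. z = k u v" if "z \<in> carrier (integer_mod_group 2)" for z
    proof -
      \<comment> \<open>the label of the sheet changes on the edge from \<open>{2}\<close> to \<open>{0, 2}\<close>\<close>
      have SW: "({0, 3}, {2}) \<in> rp2_faces"
        unfolding rp2_faces_def rp2_triple_def lessThan_5 by code_simp
      have cc: "rp2_cocycle {2} {2} = 0" "rp2_cocycle {2} {0, 2} = 1"
        by (auto simp: rp2_cocycle_def rp2_sheet_def)
      let ?f = "cube_face {0, 3} ({2} \<union> Y)"
      have f: "?f \<in> ?A" using SW by (force simp: rp2_copy_def)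
      have v: "cube_vertex ({2} \<union> Y) \<in> ?V \<inter> ?f" "cube_vertex ({0, 2} \<union> Y) \<in> ?V \<inter> ?f"
      proof -
        have "{2} \<union> Y \<subseteq> {..<n}" "{0, 2} \<union> Y \<subseteq> {..<n}" using Y n by auto
        then show "cube_vertex ({2} \<union> Y) \<in> ?V \<inter> ?f" "cube_vertex ({0, 2} \<union> Y) \<in> ?V \<inter> ?f"
          by (auto simp: cube_vertex_in_face simp del: insert_subset Un_subset_iff Un_insert_left)
      qed
      have kk: "k (cube_vertex ({2} \<union> Y)) (cube_vertex ({2} \<union> Y)) = 0"
        "k (cube_vertex ({2} \<union> Y)) (cube_vertex ({0, 2} \<union> Y)) = 1"
        unfolding k_def using code[of "{2}"] code[of "{0, 2}"] cc by simp_all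
      have "z = 0 \<or> z = 1" using that by (auto simp: carrier_integer_mod_group)
      then show ?thesis using f v kk by metis
    qed
    show "k u v = \<one>\<^bsub>integer_mod_group 2\<^esub> \<and>
        path_class ?R ?a base_path (segment_path u v) = \<one>\<^bsub>fundamental_group ?R ?a\<^esub>"
      if fb: "f \<in> ?A" "b \<in> rest" "u \<in> ?V \<inter> f \<inter> b" "v \<in> ?V \<inter> f \<inter> b" for f b u v
    proof -
      obtain S W where SW: "(S, W) \<in> rp2_faces" "f = cube_face S (W \<union> Y)" using fb(1) by (rule rp2_copyE)
      have "u \<in> ?V \<inter> cube_face S (W \<union> Y)" "v \<in> ?V \<inter> cube_face S (W \<union> Y)" using fb SW(2) by auto
      with vertexE[OF SW(1)] obtain Z Z' where Z: "u = cube_vertex (Z \<union> Y)" "Z \<subseteq> {..<5}"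
          "v = cube_vertex (Z' \<union> Y)" "Z' \<subseteq> {..<5}" by metis
      have kk: "k u v = rp2_cocycle Z Z'" using code Z by (simp add: k_def)
      have "Z = Z' \<or> (Z, Z') \<in> rp2_tree \<or> (Z', Z) \<in> rp2_tree"
        using common_link[OF fb(1,2) Z(2) _ Z(4)] fb(3,4) Z by simp
      moreover have "u \<in> ?R" using fb by blast
      ultimately show ?thesis
        using path_class_const[OF base_paths_rest, of u] kk rp2_cocycle_tree
          path_class_tree[OF base_paths_rest order_refl refl] Z
        by (elim disjE) (auto simp: rp2_cocycle_def)
    qed
  qed
  moreover have "fundamental_group ?X x \<cong> ?G"
    by (rule fundamental_group_base_change[OF \<tau> _ x]) (simp add: \<tau>R[OF aR] base_path_root)
  ultimately have "fundamental_group ?X x \<cong> free_product (integer_mod_group 2) (fundamental_group ?R ?a)"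
    by (rule iso_trans[rotated])
  then show ?thesis
    unfolding free_factor_def using group_fundamental_group[OF aR] by blast
qed

end


section \<open>Disjoint blocks of independent coordinates\<close>

lemma prob_Pi_pmf_block:
  assumes "finite A" "K \<subseteq> A"
  shows "measure_pmf.prob (Pi_pmf A d p) {X. \<forall>x\<in>K. X x \<in> B x} = (\<Prod>x\<in>K. measure_pmf.prob (p x) (B x))"
proof -
  have "{X. \<forall>x\<in>K. X x \<in> B x} = Pi A (\<lambda>x. if x \<in> K then B x else UNIV)"
    using assms(2) by (auto simp: Pi_def)
  then have "measure_pmf.prob (Pi_pmf A d p) {X. \<forall>x\<in>K. X x \<in> B x} =
      (\<Prod>x\<in>A. if x \<in> K then measure_pmf.prob (p x) (B x) else 1)"
    using assms(1) by (simp add: measure_Pi_pmf_Pi if_distrib cong: if_cong prod.cong)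
  also have "\<dots> = (\<Prod>x\<in>K. measure_pmf.prob (p x) (B x))"
    using assms by (simp add: prod.If_cases Int_absorb1 flip: Collect_mem_eq Int_def)
  finally show ?thesis .
qed

text \<open>
  The events that belong to different blocks of coordinates are independent.
\<close>

lemma prob_Pi_pmf_no_block:
  assumes A: "finite A" and J: "finite J" and K: "\<And>j. j \<in> J \<Longrightarrow> K j \<subseteq> A"
    and disj: "disjoint_family_on K J"
  shows "measure_pmf.prob (Pi_pmf A d p) {X. \<forall>j\<in>J. \<not> (\<forall>x\<in>K j. X x \<in> B j x)} =
     (\<Prod>j\<in>J. 1 - (\<Prod>x\<in>K j. measure_pmf.prob (p x) (B j x)))"
proof (cases "J = {}")
  case False
  let ?M = "measure_pmf (Pi_pmf A d p)"
  let ?N = "\<lambda>j. PiM (K j) (\<lambda>_. count_space UNIV)"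
  let ?R = "\<lambda>j X. restrict (\<lambda>i. X i) (K j)"
  let ?S = "\<lambda>j. space (?N j) - PiE (K j) (B j)"
  let ?prob = "measure_pmf.prob (Pi_pmf A d p)"
  have vimage: "?R j -` ?S j \<inter> space ?M = {X. \<not> (\<forall>x\<in>K j. X x \<in> B j x)}" for j
    by (auto simp: space_PiM PiE_def Pi_def)
  have "prob_space.indep_vars ?M ?N ?R J"
    using prob_space.indep_vars_restrict[OF prob_space_measure_pmf indep_vars_Pi_pmf[OF A] K disj] by simp
  moreover have "?S j \<in> sets (?N j)" if "j \<in> J" for j
    using finite_subset[OF K[OF that] A] by (intro sets.Diff sets.top sets_PiM_I_finite) auto
  ultimately have "?prob (\<Inter>j\<in>J. ?R j -` ?S j \<inter> space ?M) = (\<Prod>j\<in>J. ?prob (?R j -` ?S j \<inter> space ?M))"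
    using False J by (intro prob_space.indep_varsD_finite[OF prob_space_measure_pmf])
  then have "?prob (\<Inter>j\<in>J. {X. \<not> (\<forall>x\<in>K j. X x \<in> B j x)}) =
      (\<Prod>j\<in>J. ?prob {X. \<not> (\<forall>x\<in>K j. X x \<in> B j x)})"
    by (simp only: vimage)
  moreover have "?prob {X. \<not> (\<forall>x\<in>K j. X x \<in> B j x)} = 1 - (\<Prod>x\<in>K j. measure_pmf.prob (p x) (B j x))"
    if "j \<in> J" for j
  proof -
    have "{X. \<not> (\<forall>x\<in>K j. X x \<in> B j x)} = space ?M - {X. \<forall>x\<in>K j. X x \<in> B j x}" by auto
    then show ?thesis
      using measure_pmf.prob_compl[of "{X. \<forall>x\<in>K j. X x \<in> B j x}" "Pi_pmf A d p"]
        prob_Pi_pmf_block[OF A K[OF that], of d p "B j"] by simp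
  qed
  moreover have "(\<Inter>j\<in>J. {X. \<not> (\<forall>x\<in>K j. X x \<in> B j x)}) = {X. \<forall>j\<in>J. \<not> (\<forall>x\<in>K j. X x \<in> B j x)}"
    by auto
  ultimately show ?thesis by simp
qed simp


section \<open>Many disjoint copies\<close>

text \<open>
  The squares that decide whether the copy at \<open>Y\<close> is contained in the complex and isolated.
\<close>

definition touching_faces :: "nat \<Rightarrow> nat set \<Rightarrow> (nat \<Rightarrow> real) set set" where
  "touching_faces n Y = {f \<in> cube_faces n 2. \<exists>(a, i)\<in>rp2_edges.
     cube_vertex (a \<union> Y) \<in> f \<and> cube_vertex (insert i a \<union> Y) \<in> f}"

lemma touching_facesE:
  assumes "f \<in> touching_faces n Y" "Y \<inter> {..<5} = {}"
  obtains a i j where "(a, i) \<in> rp2_edges" "j < n" "f = cube_face {i, j} (a \<union> Y)"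
proof -
  obtain a i where ai: "(a, i) \<in> rp2_edges" "cube_vertex (a \<union> Y) \<in> f" "cube_vertex (insert i a \<union> Y) \<in> f"
    using assms(1) by (auto simp: touching_faces_def)
  obtain S W where SW: "f = cube_face S W" "S \<subseteq> {..<n}" "card S = 2"
    using assms(1) by (auto simp: touching_faces_def cube_faces_def)
  have "i \<notin> a \<union> Y" using rp2_edge_props(1,3)[OF ai(1)] assms(2) by auto
  then have "i \<in> S" using ai(2,3) unfolding SW(1) cube_vertex_in_face by blast
  obtain x y where "S = {x, y}" using SW(3) by (auto simp: card_2_iff)
  with \<open>i \<in> S\<close> have "\<exists>j. S = {i, j}" by auto
  then obtain j where j: "S = {i, j}" by blast
  have "f = cube_face S (a \<union> Y)"
    using ai(2) unfolding SW(1) cube_vertex_in_face by (intro cube_face_cong) auto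
  with j SW(2) ai(1) that show thesis by auto
qed

lemma card_touching_faces:
  assumes "Y \<inter> {..<5} = {}"
  shows "card (touching_faces n Y) \<le> 40 * n"
proof -
  have "touching_faces n Y \<subseteq> (\<lambda>((a, i), j). cube_face {i, j} (a \<union> Y)) ` (rp2_edges \<times> {..<n})"
  proof
    fix f assume "f \<in> touching_faces n Y"
    then obtain a i j where "(a, i) \<in> rp2_edges" "j < n" "f = cube_face {i, j} (a \<union> Y)"
      using assms by (rule touching_facesE)
    then show "f \<in> (\<lambda>((a, i), j). cube_face {i, j} (a \<union> Y)) ` (rp2_edges \<times> {..<n})"
      by (intro image_eqI[of _ _ "((a, i), j)"]) auto
  qed
  then have "card (touching_faces n Y) \<le> card (rp2_edges \<times> {..<n})"
    using finite_rp2_edges by (intro surj_card_le) auto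
  also have "\<dots> \<le> 40 * n" using card_rp2_edges by (simp add: card_cartesian_product)
  finally show ?thesis .
qed

lemma rp2_copy_touching:
  assumes "Y \<subseteq> {5..<n}" "5 \<le> n"
  shows "rp2_copy Y \<subseteq> touching_faces n Y"
proof
  fix f assume "f \<in> rp2_copy Y"
  then obtain S W where SW: "(S, W) \<in> rp2_faces" "f = cube_face S (W \<union> Y)" by (auto simp: rp2_copy_def)
  note p = rp2_face_props[OF SW(1)]
  obtain j where j: "j \<in> S" using p(3) by fastforce
  then have "j \<notin> W" using p(4) by auto
  have "(W, j) \<in> rp2_edges" using p j by (intro rp2_face_edge[OF SW(1)]) auto
  moreover have "cube_vertex (W \<union> Y) \<in> f" "cube_vertex (insert j W \<union> Y) \<in> f"
    using j unfolding SW(2) by (auto simp: cube_vertex_in_face)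
  moreover have "S \<subseteq> {..<n}" "W \<union> Y \<subseteq> {..<n}" using p(1,2) assms by (auto simp: subset_iff)
  then have "f \<in> cube_faces n 2" unfolding SW(2) using p(3) by (intro cube_faceI)
  ultimately show "f \<in> touching_faces n Y" unfolding touching_faces_def by blast
qed

text \<open>
  Two vertices of a square differ in at most two coordinates. One of the free coordinates of a square
  that contains an edge of a copy is the direction of this edge, which is less than 5. So \<open>Y\<close> and \<open>Y'\<close>
  differ in at most one element, and then they are equal by parity.
\<close>

lemma touching_faces_disjoint:
  assumes Y: "Y \<subseteq> {5..<n}" "Y' \<subseteq> {5..<n}" and even: "even (card Y)" "even (card Y')"
    and f: "f \<in> touching_faces n Y" "f \<in> touching_faces n Y'"
  shows "Y = Y'"
proof -
  have Y5: "Y \<inter> {..<5} = {}" "Y' \<inter> {..<5} = {}" using Y by auto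
  obtain a i j where ai: "(a, i) \<in> rp2_edges" "f = cube_face {i, j} (a \<union> Y)"
    using touching_facesE[OF f(1) Y5(1)] by metis
  obtain a' i' where ai': "(a', i') \<in> rp2_edges" "cube_vertex (a' \<union> Y') \<in> f"
    using f(2) by (auto simp: touching_faces_def)
  note p = rp2_edge_props(1,2)[OF ai(1)] rp2_edge_props(2)[OF ai'(1)]
  have off: "k \<in> Y \<longleftrightarrow> k \<in> Y'" if "k \<noteq> j" for k
  proof (cases "k < 5")
    case True
    then show ?thesis using Y5 by auto
  next
    case False
    then have "k \<notin> {i, j}" "k \<notin> a" "k \<notin> a'" using p that by auto
    then show ?thesis using ai'(2) unfolding ai(2) cube_vertex_in_face by auto
  qed
  have fin: "finite Y" "finite Y'" using Y finite_subset by blast+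
  have "j \<in> Y \<longleftrightarrow> j \<in> Y'"
  proof (rule ccontr)
    assume ne: "\<not> ?thesis"
    show False
    proof (cases "j \<in> Y")
      case True
      then have "j \<notin> Y'" using ne by simp
      moreover have "k \<in> Y \<longleftrightarrow> k \<in> insert j Y'" for k using off[of k] True by (cases "k = j") auto
      then have "Y = insert j Y'" by (rule Set.set_eqI)
      ultimately show False using even fin by simp
    next
      case False
      then have "j \<in> Y'" using ne by simp
      then have "k \<in> Y' \<longleftrightarrow> k \<in> insert j Y" for k using off[of k] by (cases "k = j") auto
      then have "Y' = insert j Y" by (rule Set.set_eqI)
      then show False using even fin False by simp
    qed
  qed
  then have "k \<in> Y \<longleftrightarrow> k \<in> Y'" for k using off[of k] by (cases "k = j") auto
  then show ?thesis by (rule Set.set_eqI)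
qed

lemma isolated_copy_event:
  assumes n: "5 < n" and Y: "Y \<subseteq> {5..<n}"
    and X: "\<forall>f\<in>touching_faces n Y. X f \<in> {f \<in> rp2_copy Y}"
  shows "isolated_rp2 n Y (cube_faces n 0 \<union> cube_faces n 1 \<union> {f \<in> cube_faces n 2. X f})"
proof
  show "5 < n" "Y \<subseteq> {5..<n}" by fact+
  have "rp2_copy Y \<subseteq> touching_faces n Y" using n Y by (intro rp2_copy_touching) auto
  then show "rp2_copy Y \<subseteq> cube_faces n 0 \<union> cube_faces n 1 \<union> {f \<in> cube_faces n 2. X f}"
    using X by (auto simp: touching_faces_def)
  fix f a i
  assume f: "f \<in> cube_faces n 0 \<union> cube_faces n 1 \<union> {f \<in> cube_faces n 2. X f}" "f \<in> cube_faces n 2"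
    "(a, i) \<in> rp2_edges" "cube_vertex (a \<union> Y) \<in> f" "cube_vertex (insert i a \<union> Y) \<in> f"
  have "f \<notin> cube_faces n k" if "k \<noteq> 2" for k
  proof
    assume "f \<in> cube_faces n k"
    then obtain S W where 1: "f = cube_face S W" "card S = k" unfolding cube_faces_def by blast
    obtain S' W' where 2: "f = cube_face S' W'" "card S' = 2" using f(2) unfolding cube_faces_def by blast
    have "S = S'" using cube_face_eqD(1)[of S W S' W'] 1(1) 2(1) by simp
    with 1 2 that show False by simp
  qed
  then have "X f" using f(1) by simp
  moreover have "f \<in> touching_faces n Y" using f(2-5) by (auto simp: touching_faces_def)
  ultimately show "f \<in> rp2_copy Y" using X by auto
qed auto

text \<open>
  The copies are indexed by the subsets of \<open>{6..<n}\<close>; coordinate 5 is used to make the parity even.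
\<close>

lemma no_isolated_copy_bound:
  fixes p :: real
  assumes p: "0 < p" "p < 1" and n: "5 < n"
  shows "measure_pmf.prob (random_cubical_complex n p)
      {Q. \<not> (\<forall>x \<in> \<Union>Q. free_factor (integer_mod_group 2) (fundamental_group (\<Union>Q) x))}
    \<le> (1 - p ^ 20 * (1 - p) ^ (40 * n)) ^ (2 ^ (n - 6))"
proof -
  let ?M = "Pi_pmf (cube_faces n 2) False (\<lambda>_. bernoulli_pmf p)"
  let ?\<Phi> = "\<lambda>X. cube_faces n 0 \<union> cube_faces n 1 \<union> {f \<in> cube_faces n 2. X f}"
  let ?good = "\<lambda>Q. \<forall>x \<in> \<Union>Q. free_factor (integer_mod_group 2) (fundamental_group (\<Union>Q) x)"
  define Y where "Y J = (if even (card J) then J else insert 5 J)" for J :: "nat set"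
  let ?J = "Pow {6..<n}"
  have Y: "Y J \<subseteq> {5..<n}" "even (card (Y J))" if "J \<in> ?J" for J
  proof -
    have J: "finite J" "5 \<notin> J" "J \<subseteq> {5..<n}" using that finite_subset by fastforce+
    then show "Y J \<subseteq> {5..<n}" using n by (simp add: Y_def)
    show "even (card (Y J))" using J by (simp add: Y_def)
  qed
  have inj: "J = J'" if "J \<in> ?J" "J' \<in> ?J" "Y J = Y J'" for J J'
  proof -
    have "J = Y J - {5}" "J' = Y J' - {5}" using that(1,2) by (auto simp: Y_def)
    with that(3) show ?thesis by simp
  qed
  let ?K = "\<lambda>J. touching_faces n (Y J)" and ?B = "\<lambda>J f. {f \<in> rp2_copy (Y J)}"
  have disj: "disjoint_family_on ?K ?J"
    unfolding disjoint_family_on_def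
  proof (intro ballI impI)
    fix J J' assume J: "J \<in> ?J" "J' \<in> ?J" "J \<noteq> J'"
    then have "Y J \<noteq> Y J'" using inj by metis
    then show "?K J \<inter> ?K J' = {}"
      using touching_faces_disjoint[OF Y(1)[OF J(1)] Y(1)[OF J(2)] Y(2)[OF J(1)] Y(2)[OF J(2)]] by auto
  qed
  have "measure_pmf.prob (random_cubical_complex n p) {Q. \<not> ?good Q} = measure_pmf.prob ?M {X. \<not> ?good (?\<Phi> X)}"
    unfolding random_cubical_complex_def by (subst measure_map_pmf) (simp only: vimage_def mem_Collect_eq)
  also have "\<dots> \<le> measure_pmf.prob ?M {X. \<forall>J\<in>?J. \<not> (\<forall>f\<in>?K J. X f \<in> ?B J f)}"
  proof (rule measure_pmf.finite_measure_mono)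
    have "?good (?\<Phi> X)" if "J \<in> ?J" "\<forall>f\<in>?K J. X f \<in> ?B J f" for X J
      using isolated_rp2.free_factor_copy[OF isolated_copy_event[OF n Y(1)[OF that(1)] that(2)]] by blast
    then show "{X. \<not> ?good (?\<Phi> X)} \<subseteq> {X. \<forall>J\<in>?J. \<not> (\<forall>f\<in>?K J. X f \<in> ?B J f)}" by blast
  qed simp
  also have "\<dots> = (\<Prod>J\<in>?J. 1 - (\<Prod>f\<in>?K J. measure_pmf.prob (bernoulli_pmf p) (?B J f)))"
    by (rule prob_Pi_pmf_no_block[OF finite_cube_faces _ _ disj]) (auto simp: touching_faces_def)
  also have "\<dots> \<le> (\<Prod>J\<in>?J. 1 - p ^ 20 * (1 - p) ^ (40 * n))"
  proof (rule prod_mono)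
    fix J assume J: "J \<in> ?J"
    have fin: "finite (?K J)" using finite_cube_faces by (simp add: touching_faces_def)
    have sub: "rp2_copy (Y J) \<subseteq> ?K J" using Y(1)[OF J] n by (intro rp2_copy_touching) auto
    have "measure_pmf.prob (bernoulli_pmf p) (?B J f) = (if f \<in> rp2_copy (Y J) then p else 1 - p)" for f
      using p by (simp add: measure_pmf_single)
    then have eq: "(\<Prod>f\<in>?K J. measure_pmf.prob (bernoulli_pmf p) (?B J f)) =
        p ^ card (rp2_copy (Y J)) * (1 - p) ^ card (?K J - rp2_copy (Y J))"
      using fin sub by (simp add: prod.If_cases Int_absorb1 Diff_eq)
    have "card (rp2_copy (Y J)) \<le> 20"
      unfolding rp2_copy_def using card_rp2_faces
      by (intro order_trans[OF card_image_le]) (auto simp: rp2_faces_def rp2_triple_def)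
    then have 1: "p ^ 20 \<le> p ^ card (rp2_copy (Y J))" using p by (intro power_decreasing) auto
    have "card (?K J - rp2_copy (Y J)) \<le> card (?K J)" using fin by (intro card_mono) auto
    also have "\<dots> \<le> 40 * n" using Y(1)[OF J] by (intro card_touching_faces) auto
    finally have 2: "(1 - p) ^ (40 * n) \<le> (1 - p) ^ card (?K J - rp2_copy (Y J))"
      using p by (intro power_decreasing) auto
    have "p ^ 20 * (1 - p) ^ (40 * n) \<le> (\<Prod>f\<in>?K J. measure_pmf.prob (bernoulli_pmf p) (?B J f))"
      unfolding eq using 1 2 p by (intro mult_mono) auto
    moreover have "(\<Prod>f\<in>?K J. measure_pmf.prob (bernoulli_pmf p) (?B J f)) \<le> 1"
      by (intro prod_le_1) auto
    ultimately show "0 \<le> 1 - (\<Prod>f\<in>?K J. measure_pmf.prob (bernoulli_pmf p) (?B J f)) \<and>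
        1 - (\<Prod>f\<in>?K J. measure_pmf.prob (bernoulli_pmf p) (?B J f)) \<le> 1 - p ^ 20 * (1 - p) ^ (40 * n)"
      by simp
  qed
  also have "\<dots> = (1 - p ^ 20 * (1 - p) ^ (40 * n)) ^ (2 ^ (n - 6))"
    by (simp add: card_Pow)
  finally show ?thesis .
qed

section \<open>The projective plane as a free factor\<close>

text \<open>
  This follows from Bernoulli's inequality, since \<open>(1 - q) ^ N * (1 + q) ^ N \<le> 1\<close>.
\<close>

lemma one_minus_power_le:
  fixes q :: real
  assumes "0 < q" "q \<le> 1" "0 < N"
  shows "(1 - q) ^ N \<le> 1 / (real N * q)"
proof -
  have "(1 - q) ^ N * (1 + real N * q) \<le> (1 - q) ^ N * (1 + q) ^ N"
    using assms Bernoulli_inequality[of q N] by (intro mult_left_mono) (auto simp: mult.commute)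
  also have "\<dots> = (1 - q\<^sup>2) ^ N" by (simp add: power_mult_distrib[symmetric] power2_eq_square algebra_simps)
  also have "\<dots> \<le> 1" using assms by (intro power_le_one) (auto simp: power_le_one)
  finally have "(1 - q) ^ N * (1 + real N * q) \<le> 1" .
  moreover have "(1 - q) ^ N * (real N * q) \<le> (1 - q) ^ N * (1 + real N * q)"
    using assms by (intro mult_left_mono) auto
  ultimately show ?thesis using assms by (simp add: pos_le_divide_eq)
qed

theorem theorem5p4:
  fixes p :: real
  assumes "0 < p" and "p < 1 - (1/2) powr (1/40)"
  shows "(\<lambda>n. measure_pmf.prob (random_cubical_complex n p)
            {Q. \<forall>x \<in> \<Union>Q. free_factor (integer_mod_group 2) (fundamental_group (\<Union>Q) x)})
         \<longlonglongrightarrow> 1"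
proof -
  let ?good = "\<lambda>Q. \<forall>x \<in> \<Union>Q. free_factor (integer_mod_group 2) (fundamental_group (\<Union>Q) x)"
  let ?P = "\<lambda>n. measure_pmf.prob (random_cubical_complex n p) {Q. ?good Q}"
  let ?N = "\<lambda>n. measure_pmf.prob (random_cubical_complex n p) {Q. \<not> ?good Q}"
  have half: "0 < (1/2::real) powr (1/40)" by simp
  then have p: "p < 1" "(1/2) powr (1/40) < 1 - p" using assms(2) by linarith+
  have "(1/2::real) = ((1/2) powr (1/40)) ^ 40"
    by (simp add: powr_powr flip: powr_realpow)
  also have "\<dots> < (1 - p) ^ 40"
    using p half by (intro power_strict_mono) auto
  finally have r: "1 < 2 * (1 - p) ^ 40" by simp
  define r where "r = 2 * (1 - p) ^ 40"
  have bound: "?N n \<le> 64 / p ^ 20 * (1 / r) ^ n" if n: "n \<ge> 6" for n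
  proof -
    let ?q = "p ^ 20 * (1 - p) ^ (40 * n)"
    have q: "0 < ?q" "?q \<le> 1" using assms(1) p(1) by (auto intro!: mult_le_one power_le_one)
    have "?N n \<le> (1 - ?q) ^ (2 ^ (n - 6))"
      using no_isolated_copy_bound[of p n] assms(1) p(1) n by simp
    also have "\<dots> \<le> 1 / (real (2 ^ (n - 6)) * ?q)"
      using q by (intro one_minus_power_le) auto
    also have "real (2 ^ (n - 6)) = 2 ^ n / 64"
      using power_diff[of "2::real" 6 n] n by simp
    also have "1 / (2 ^ n / 64 * ?q) = 64 / p ^ 20 * (1 / r) ^ n"
      unfolding r_def power_mult by (simp add: power_mult_distrib power_divide)
    finally show ?thesis .
  qed
  have "(\<lambda>n. (1 / r) ^ n) \<longlonglongrightarrow> 0"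
    using r[folded r_def] by (intro LIMSEQ_power_zero) (simp add: divide_less_eq)
  from tendsto_mult_left[OF this, of "64 / p ^ 20"]
  have lim: "(\<lambda>n. 64 / p ^ 20 * (1 / r) ^ n) \<longlonglongrightarrow> 0" by simp
  have "?N \<longlonglongrightarrow> 0"
  proof (rule tendsto_sandwich[OF _ _ tendsto_const lim])
    show "\<forall>\<^sub>F n in sequentially. ?N n \<le> 64 / p ^ 20 * (1 / r) ^ n"
      using eventually_ge_at_top[of 6] by (rule eventually_mono) (rule bound)
  qed simp
  then have "(\<lambda>n. 1 - ?N n) \<longlonglongrightarrow> 1 - 0" by (intro tendsto_diff tendsto_const)
  moreover have "1 - ?N n = ?P n" for n
  proof -
    have "{Q. \<not> ?good Q} = space (measure_pmf (random_cubical_complex n p)) - {Q. ?good Q}" by auto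
    then have "?N n = 1 - ?P n"
      using measure_pmf.prob_compl[of "{Q. ?good Q}" "random_cubical_complex n p"] by (simp only:) simp
    then show ?thesis by simp
  qed
  ultimately show ?thesis by simp
qed

end
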